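(* Let $\ell\ge0$ be an integer and let $r_1,\dots,r_k$ be positive integers such that $3+2\ell=\sum_{h=1}^k r_h$, $r_h\le \ell+1$ for every $h=1,\dots,k$, and $k\ge3$. Then $$\mathsf{Tev}_{0,\ell,r_1,\dots,r_k}=1.$$
   Context: We work over $\mathbb{C}$. Let $g\ge0$ and $\ell\in\mathbb{Z}$, and let $\mu_h=(e_{h,1},\dots,e_{h,r_h})\in\mathbb{Z}_{\ge1}^{r_h}$ with $r_h\ge1$ for $h=1,\dots,k$. Set $|\mu_h|=\sum_{j=1}^{r_h}e_{h,j}$, $d=g+1+\ell$, $n=\sum_{h=1}^k r_h$, and $b=2g+2d-2-\sum_{h=1}^k|\mu_h|+n$. Hurwitz stack. When $g+3+2\ell=\sum_h|\mu_h|$ and $|\mu_h|\le d$ for all $h$, let $\overline{\mathcal{H}}_{g,d,\mu_1,\dots,\mu_k}$ be the Deligne–Mumford stack of (Harris–Mumford) admissible covers whose objects over a scheme $S$ are morphisms $\pi:C\to D$ over $S$ together with sections such that: (i) $C\to S$ is a proper flat family of connected, reduced, at most nodal curves of genus $g$ with $n$ distinct sections $p_1,\dots,p_n$ in the smooth locus; (ii) $(D\to S,q_1,\dots,q_k,Q_1,\dots,Q_b)$ is a stable $(k+b)$-pointed curve of genus $0$; (iii) $\pi\circ p_i=q_h$ whenever $r_1+\dots+r_{h-1}+1\le i\le r_1+\dots+r_h$; (iv) $\pi^{-1}(\mathrm{Sing}(D/S))=\mathrm{Sing}(C/S)$ set-theoretically; (v) $\pi$ is finite of degree $d$ and étale with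 the following exceptions: at a node of $C$ lying over a node of $D$ the map is given locally by $C: xy=a$, $D: uv=a^p$, $u=x^p$, $v=y^p$ for some $p\ge1$; over each $Q_t$ there is a unique smooth point $P_t$ at which $\pi$ has ramification index $2$; and $\pi$ has ramification index $e_{h,j}$ at $p_{r_1+\dots+r_{h-1}+j}$ for $1\le h\le k$, $1\le j\le r_h$. Morphisms are cartesian diagrams compatible with all the data. Tevelev degrees. If moreover $k\ge3$, let $\tau_{g,\ell,\mu_1,\dots,\mu_k}:\overline{\mathcal{H}}_{g,d,\mu_1,\dots,\mu_k}\to\overline{\mathcal{M}}_{g,n}\times\overline{M}_{0,k}$ be the morphism remembering only the (stabilized) domain curve with $p_1,\dots,p_n$ and the (stabilized) target curve with $q_1,\dots,q_k$; source and target have the same dimension. The generalized Tevelev degree is $$\mathsf{Tev}_{g,\ell,\mu_1,\dots,\mu_k}=\frac{\deg(\tau_{g,\ell,\mu_1,\dots,\mu_k})}{b!}$$ if $g+3+2\ell=\sum_h|\mu_h|$, $|\mu_h|\le d$ for all $h$, and $k\ge3$; it is defined to be $0$ otherwise. For positive integers $m_1,\dots,m_k$, $\mathsf{Tev}_{g,\ell,m_1,\dots,m_k}$ denotes $\mathsf{Tev}_{g,\ell,\mu_1,\dots,\mu_k}$ with $\mu_h=(1,\dots,1)$ ($m_h$ entries). *)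

theory Defs
  imports Complex_Main "HOL-Computational_Algebra.Computational_Algebra"
    "HOL-Library.FuncSet" "HOL-Library.Disjoint_Sets"
begin

text \<open>
  All moduli spaces below are described through their complex points.  The source curves have
  genus 0, so both source and target of a cover are nodal curves of arithmetic genus 0.
\<close>

section \<open>The projective line and its morphisms\<close>

datatype proj1 = Pt complex | Infty

text \<open>
  A pair \<open>(A, B)\<close> of coprime polynomials, not both constant, stands for the nonconstant morphism
  \<open>[A : B]\<close> from the projective line to itself.  Proportional pairs give the same morphism.
\<close>

type_synonym ratmap = "complex poly \<times> complex poly"

definition rdeg :: "ratmap \<Rightarrow> nat" where
  "rdeg R = max (degree (fst R)) (degree (snd R))"

definition is_ratmap :: "ratmap \<Rightarrow> bool" where
  "is_ratmap R \<longleftrightarrow> coprime (fst R) (snd R) \<and> rdeg R \<ge> 1"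

text \<open>At infinity the pair is read as a pair of binary forms of degree \<open>rdeg R\<close>.\<close>

definition reval :: "ratmap \<Rightarrow> proj1 \<Rightarrow> proj1" where
  "reval R z = (let (a, b) = (case z of
       Pt t \<Rightarrow> (poly (fst R) t, poly (snd R) t)
     | Infty \<Rightarrow> (coeff (fst R) (rdeg R), coeff (snd R) (rdeg R)))
   in if b = 0 then Infty else Pt (a / b))"

text \<open>The polynomial whose zeros, with \<open>Infty\<close> having multiplicity \<open>rdeg R\<close> minus its degree,
  form the divisor of the fibre of \<open>R\<close> over a given point.\<close>

definition fibre_poly :: "ratmap \<Rightarrow> proj1 \<Rightarrow> complex poly" where
  "fibre_poly R q = (case q of Pt c \<Rightarrow> fst R - smult c (snd R) | Infty \<Rightarrow> snd R)"

definition ram_index :: "ratmap \<Rightarrow> proj1 \<Rightarrow> nat" where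
  "ram_index R z = (let F = fibre_poly R (reval R z) in
     case z of Pt t \<Rightarrow> order t F | Infty \<Rightarrow> rdeg R - degree F)"

definition moebius :: "(proj1 \<Rightarrow> proj1) \<Rightarrow> bool" where
  "moebius \<phi> \<longleftrightarrow> (\<exists>R. is_ratmap R \<and> rdeg R = 1 \<and> \<phi> = reval R)"


section \<open>Nodal curves of arithmetic genus 0\<close>

text \<open>
  A nodal curve is given by its normalization, a disjoint union of projective lines, and by the
  pairs of points of the normalization that are glued to nodes.  A connected nodal curve of
  arithmetic genus 0 has only rational components, so every such curve arises in this way.
\<close>

type_synonym point = "nat \<times> proj1"

record nodal_curve =
  comps :: "nat set"
  nodes :: "point set set"

definition points :: "nodal_curve \<Rightarrow> point set" where
  "points C = comps C \<times> UNIV"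

definition sing :: "nodal_curve \<Rightarrow> point set" where
  "sing C = \<Union>(nodes C)"

definition adjacency :: "nodal_curve \<Rightarrow> (nat \<times> nat) set" where
  "adjacency C = {(fst a, fst b) | a b. {a, b} \<in> nodes C}"

definition arithmetic_genus :: "nodal_curve \<Rightarrow> int" where
  "arithmetic_genus C = int (card (nodes C)) - int (card (comps C)) + 1"

definition genus0_curve :: "nodal_curve \<Rightarrow> bool" where
  "genus0_curve C \<longleftrightarrow>
     finite (comps C) \<and> comps C \<noteq> {} \<and> finite (nodes C) \<and>
     (\<forall>N\<in>nodes C. N \<subseteq> points C \<and> card N = 2) \<and> disjoint (nodes C) \<and>
     (\<forall>u\<in>comps C. \<forall>v\<in>comps C. (u, v) \<in> (adjacency C)\<^sup>*) \<and>
     arithmetic_genus C = 0"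

definition pointed_curve :: "nat \<Rightarrow> nodal_curve \<Rightarrow> (nat \<Rightarrow> point) \<Rightarrow> bool" where
  "pointed_curve m C s \<longleftrightarrow>
     genus0_curve C \<and> inj_on s {..<m} \<and> s ` {..<m} \<subseteq> points C - sing C"

definition stable_curve :: "nat \<Rightarrow> nodal_curve \<Rightarrow> (nat \<Rightarrow> point) \<Rightarrow> bool" where
  "stable_curve m C s \<longleftrightarrow>
     pointed_curve m C s \<and>
     (\<forall>v\<in>comps C. 3 \<le> card {a \<in> s ` {..<m} \<union> sing C. fst a = v})"

definition curve_iso :: "nodal_curve \<Rightarrow> nodal_curve \<Rightarrow> (point \<Rightarrow> point) \<Rightarrow> bool" where
  "curve_iso C C' \<Phi> \<longleftrightarrow>
     \<Phi> \<in> extensional (points C) \<and>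
     (\<exists>\<beta> \<phi>. bij_betw \<beta> (comps C) (comps C') \<and>
        (\<forall>v\<in>comps C. moebius (\<phi> v) \<and> (\<forall>z. \<Phi> (v, z) = (\<beta> v, \<phi> v z)))) \<and>
     (\<lambda>N. \<Phi> ` N) ` nodes C = nodes C'"

text \<open>
  Used for \<open>m \<ge> 3\<close> and distinct \<open>x 0, \<dots>, x (m - 1)\<close>: the stabilization of \<open>(C, s)\<close> is then
  isomorphic to the projective line with these markings.  The stabilization morphism \<open>c\<close> is given on
  the normalization; taking equal values on the two branches of every node, it descends to \<open>C\<close>.
\<close>

definition stabilizes_to :: "nat \<Rightarrow> nodal_curve \<Rightarrow> (nat \<Rightarrow> point) \<Rightarrow> (nat \<Rightarrow> complex) \<Rightarrow> bool" where
  "stabilizes_to m C s x \<longleftrightarrow>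
     (\<exists>c. \<exists>v\<in>comps C.
        moebius (\<lambda>z. c (v, z)) \<and>
        (\<forall>u\<in>comps C - {v}. \<forall>z z'. c (u, z) = c (u, z')) \<and>
        (\<forall>a b. {a, b} \<in> nodes C \<longrightarrow> c a = c b) \<and>
        (\<forall>i<m. c (s i) = Pt (x i)))"


section \<open>Admissible covers\<close>

text \<open>
  \<open>src_pts\<close> lists \<open>p\<^sub>1, \<dots>, p\<^sub>n\<close>; \<open>tgt_pts\<close> lists \<open>q\<^sub>1, \<dots>, q\<^sub>k\<close> and then \<open>Q\<^sub>1, \<dots>, Q\<^sub>b\<close>;
  all indices start at 0.  The component \<open>v\<close> of the source is mapped to the component
  \<open>comp_map v\<close> of the target by \<open>rat_map v\<close>.
\<close>

record cover =
  src :: nodal_curve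
  src_pts :: "nat \<Rightarrow> point"
  tgt :: nodal_curve
  tgt_pts :: "nat \<Rightarrow> point"
  comp_map :: "nat \<Rightarrow> nat"
  rat_map :: "nat \<Rightarrow> ratmap"

definition cover_map :: "cover \<Rightarrow> point \<Rightarrow> point" where
  "cover_map X a = (comp_map X (fst a), reval (rat_map X (fst a)) (snd a))"

definition ram :: "cover \<Rightarrow> point \<Rightarrow> nat" where
  "ram X a = ram_index (rat_map X (fst a)) (snd a)"

text \<open>
  For a list of ramification profiles, the entry at position \<open>i\<close> of \<open>flat_profile\<close> is the pair of
  the index \<open>h\<close> with \<open>\<pi> (p\<^sub>i) = q\<^sub>h\<close> and of the ramification index prescribed at \<open>p\<^sub>i\<close>.
\<close>

definition flat_profile :: "nat list list \<Rightarrow> (nat \<times> nat) list" where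
  "flat_profile \<mu>s = concat (map (\<lambda>h. map (Pair h) (\<mu>s ! h)) [0..<length \<mu>s])"

text \<open>
  Neither \<open>C\<close> nor \<open>D\<close> need be smooth.  The local form \<open>u = x^p, v = y^p\<close> of the cover at a node says
  that the two branches are mapped to the two branches of a node with the same ramification index.
\<close>

definition admissible_cover :: "nat \<Rightarrow> nat \<Rightarrow> nat list list \<Rightarrow> cover \<Rightarrow> bool" where
  "admissible_cover d b \<mu>s X \<longleftrightarrow>
    (let C = src X; D = tgt X; \<pi> = cover_map X; p = src_pts X; q = tgt_pts X;
         k = length \<mu>s; prof = flat_profile \<mu>s; n = length prof
     in pointed_curve n C p \<and>
        stable_curve (k + b) D q \<and>
        (\<forall>v\<in>comps C. comp_map X v \<in> comps D \<and> is_ratmap (rat_map X v)) \<and>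
        (\<forall>w\<in>comps D. (\<Sum>v\<in>{v\<in>comps C. comp_map X v = w}. rdeg (rat_map X v)) = d) \<and>
        (\<forall>a\<in>points C. \<pi> a \<in> sing D \<longleftrightarrow> a \<in> sing C) \<and>
        (\<forall>a a'. {a, a'} \<in> nodes C \<longrightarrow> {\<pi> a, \<pi> a'} \<in> nodes D \<and> ram X a = ram X a') \<and>
        (\<forall>i<n. \<pi> (p i) = q (fst (prof ! i)) \<and> ram X (p i) = snd (prof ! i)) \<and>
        (\<forall>t<b. \<exists>!a. a \<in> points C - sing C \<and> \<pi> a = q (k + t) \<and> ram X a = 2) \<and>
        (\<forall>a\<in>points C - sing C - p ` {..<n}.
           ram X a = 1 \<or> (\<exists>t<b. \<pi> a = q (k + t) \<and> ram X a = 2)))"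

definition cover_isos ::
  "nat \<Rightarrow> nat \<Rightarrow> cover \<Rightarrow> cover \<Rightarrow> ((point \<Rightarrow> point) \<times> (point \<Rightarrow> point)) set" where
  "cover_isos n m X Y = {(\<Phi>, \<Psi>).
     curve_iso (src X) (src Y) \<Phi> \<and> curve_iso (tgt X) (tgt Y) \<Psi> \<and>
     (\<forall>a\<in>points (src X). \<Psi> (cover_map X a) = cover_map Y (\<Phi> a)) \<and>
     (\<forall>i<n. \<Phi> (src_pts X i) = src_pts Y i) \<and>
     (\<forall>j<m. \<Psi> (tgt_pts X j) = tgt_pts Y j)}"


section \<open>The degree of the forgetful morphism\<close>

text \<open>
  A point of \<open>M\<^sub>0\<^sub>,\<^sub>n \<times> M\<^sub>0\<^sub>,\<^sub>k\<close> is represented by distinct complex numbers \<open>x 0, \<dots>, x (n - 1)\<close> and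
  distinct complex numbers \<open>y 0, \<dots>, y (k - 1)\<close>.  For \<open>n, k \<ge> 3\<close> the pointed curves represented have
  no automorphisms, so the fibre of the forgetful morphism over such a point is the full
  subgroupoid on the following objects, which include covers of nodal curves by nodal curves.
\<close>

definition fibre ::
  "nat \<Rightarrow> nat \<Rightarrow> nat list list \<Rightarrow> (nat \<Rightarrow> complex) \<Rightarrow> (nat \<Rightarrow> complex) \<Rightarrow> cover set" where
  "fibre d b \<mu>s x y = {X. admissible_cover d b \<mu>s X \<and>
     stabilizes_to (length (flat_profile \<mu>s)) (src X) (src_pts X) x \<and>
     stabilizes_to (length \<mu>s) (tgt X) (tgt_pts X) y}"

definition fibre_classes ::
  "nat \<Rightarrow> nat \<Rightarrow> nat list list \<Rightarrow> (nat \<Rightarrow> complex) \<Rightarrow> (nat \<Rightarrow> complex) \<Rightarrow> cover set set" where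
  "fibre_classes d b \<mu>s x y = fibre d b \<mu>s x y //
     {(X, Y). X \<in> fibre d b \<mu>s x y \<and> Y \<in> fibre d b \<mu>s x y \<and>
        cover_isos (length (flat_profile \<mu>s)) (length \<mu>s + b) X Y \<noteq> {}}"

definition fibre_count ::
  "nat \<Rightarrow> nat \<Rightarrow> nat list list \<Rightarrow> (nat \<Rightarrow> complex) \<Rightarrow> (nat \<Rightarrow> complex) \<Rightarrow> real" where
  "fibre_count d b \<mu>s x y = (\<Sum>c\<in>fibre_classes d b \<mu>s x y.
     let X = (SOME X. X \<in> c)
     in 1 / real (card (cover_isos (length (flat_profile \<mu>s)) (length \<mu>s + b) X X)))"

inductive_set poly_funs ::
  "nat \<Rightarrow> nat \<Rightarrow> ((nat \<Rightarrow> complex) \<Rightarrow> (nat \<Rightarrow> complex) \<Rightarrow> complex) set" for n k :: nat where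
  const: "(\<lambda>x y. c) \<in> poly_funs n k"
| var_x: "i < n \<Longrightarrow> (\<lambda>x y. x i) \<in> poly_funs n k"
| var_y: "j < k \<Longrightarrow> (\<lambda>x y. y j) \<in> poly_funs n k"
| add: "P \<in> poly_funs n k \<Longrightarrow> Q \<in> poly_funs n k \<Longrightarrow> (\<lambda>x y. P x y + Q x y) \<in> poly_funs n k"
| mult: "P \<in> poly_funs n k \<Longrightarrow> Q \<in> poly_funs n k \<Longrightarrow> (\<lambda>x y. P x y * Q x y) \<in> poly_funs n k"

text \<open>A property holds at the general point of \<open>M\<^sub>0\<^sub>,\<^sub>n \<times> M\<^sub>0\<^sub>,\<^sub>k\<close> if it holds on a nonempty Zariski
  open subset; such subsets are also dense in the product of the compactified spaces.\<close>

definition generally ::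
  "nat \<Rightarrow> nat \<Rightarrow> ((nat \<Rightarrow> complex) \<Rightarrow> (nat \<Rightarrow> complex) \<Rightarrow> bool) \<Rightarrow> bool" where
  "generally n k \<Phi> \<longleftrightarrow> (\<exists>P\<in>poly_funs n k. (\<exists>x y. P x y \<noteq> 0) \<and>
     (\<forall>x y. inj_on x {..<n} \<and> inj_on y {..<k} \<and> P x y \<noteq> 0 \<longrightarrow> \<Phi> x y))"

text \<open>
  The degree of a morphism of Deligne--Mumford stacks of the same dimension, in characteristic 0
  and with generically reduced source and irreducible target, is the number of points of its general
  fibre, each weighted by the inverse of the order of its automorphism group.
\<close>

definition tau_degree :: "nat \<Rightarrow> nat \<Rightarrow> nat list list \<Rightarrow> real" where
  "tau_degree d b \<mu>s = (THE N.
     generally (length (flat_profile \<mu>s)) (length \<mu>s)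
       (\<lambda>x y. finite (fibre_classes d b \<mu>s x y) \<and> fibre_count d b \<mu>s x y = N))"


section \<open>Generalized Tevelev degrees in genus 0\<close>

definition Tev0 :: "int \<Rightarrow> nat list list \<Rightarrow> real" where
  "Tev0 l \<mu>s =
    (let g = 0; k = length \<mu>s; d = g + 1 + l;
         n = int (\<Sum>\<mu>\<leftarrow>\<mu>s. length \<mu>);
         total = int (\<Sum>\<mu>\<leftarrow>\<mu>s. sum_list \<mu>);
         b = 2 * g + 2 * d - 2 - total + n
     in if g + 3 + 2 * l = total \<and> (\<forall>\<mu>\<in>set \<mu>s. int (sum_list \<mu>) \<le> d) \<and> k \<ge> 3
        then tau_degree (nat d) (nat b) \<mu>s / fact (nat b)
        else 0)"

definition Tev0_simple :: "int \<Rightarrow> nat list \<Rightarrow> real" where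
  "Tev0_simple l ms = Tev0 l (map (\<lambda>m. replicate m 1) ms)"

end

theory Submission
  imports Defs "Jordan_Normal_Form.Determinant"
begin

text \<open>
  For general marked points, interpolation gives a unique map \<open>f = A / B\<close> of degree \<open>d = l + 1\<close> from
  the projective line to itself with \<open>f (x i) = y (h i)\<close> for the \<open>n = 2 * d + 1\<close> marks, and \<open>f\<close> has
  \<open>2 * d - 2\<close> simple branch values distinct from the \<open>y j\<close>.  Both statements amount to the
  nonvanishing of determinants and resultants that are polynomials in \<open>x\<close> and \<open>y\<close>, so one example
  suffices.  In an admissible cover in the fibre over \<open>(x, y)\<close>, let \<open>v\<close> and \<open>w\<close> be the components that
  survive stabilization.  Counting degrees shows that \<open>v\<close> lies over \<open>w\<close> and that \<open>v\<close> fulfils enough of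
  the interpolation conditions to be mapped by \<open>f\<close>, with full degree \<open>d\<close>.  Each branch value then
  takes up one of the points \<open>Q\<^sub>t\<close>, which leaves too few marked points for further components of the
  target.  Hence the fibre consists of the \<open>(2 * d - 2)!\<close> labelings of the branch values of \<open>f\<close>, none
  of which has automorphisms.
\<close>

text \<open>The number \<open>n = 2 * d + 1\<close> is tight in two counts. Let \<open>v\<close>
  have degree \<open>e\<close>; at most \<open>d - e\<close> marks are lost to other components over
  the same target component. Distinct maps of degrees \<open>e\<close> and \<open>d\<close> agree in
  at most \<open>d + e\<close> points, while at least \<open>d + e + 1\<close> good marks remain,
  which forces the map to be \<open>f\<close>. If \<open>v\<close> did not lie over
  \<open>w\<close>, at most \<open>d\<close> marks would have the value to which the branch of the
  target containing the image of \<open>v\<close> is contracted, at most \<open>d - e\<close> would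
  be lost, and at most \<open>e\<close> would fit into one fibre of \<open>v\<close>: only
  \<open>2 * d\<close> in all. The bound on the number of marks with a common value enters here, and
  again in the example, where they are placed in one fibre of \<open>d\<close> points.

  To make the conditions polynomial, \<open>f\<close> is given by cofactors of a linear system,
  without division, and its branch values are the zeros of a resultant in an auxiliary variable, so
  that no individual critical point has to be followed. As the degree is a definite description, two
  nonempty open sets also have to meet; on a line this is a fact about polynomials in one
  variable.\<close>

hide_const (open) Module.smult

section \<open>Rational maps of the projective line\<close>

lemma coprime_no_common_root:
  fixes p q :: "complex poly"
  assumes "\<And>z. poly p z \<noteq> 0 \<or> poly q z \<noteq> 0"
  shows "coprime p q"
proof (rule ccontr)
  assume "\<not> coprime p q"
  then obtain g where g: "g dvd p" "g dvd q" "\<not> is_unit g"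
    using not_coprimeE by blast
  have "p \<noteq> 0 \<or> q \<noteq> 0" using assms[of 0] by auto
  hence "g \<noteq> 0" using g by auto
  hence "degree g \<noteq> 0" using g(3) by (simp add: is_unit_iff_degree)
  hence "\<exists>z. poly g z = 0"
    by (metis constant_degree fundamental_theorem_of_algebra)
  thus False using g assms by (metis dvd_trans poly_eq_0_iff_dvd)
qed

text \<open>A root of \<open>A\<close> is not a root of \<open>B\<close>, so it is one of
  \<open>C\<close>; removing the linear factor from both lowers the degree of
  \<open>A\<close>.\<close>

lemma poly_coprime_dvd_mult:
  fixes A B C :: "complex poly"
  assumes "coprime A B" "A dvd C * B"
  shows "A dvd C"
  using assms
proof (induction "degree A" arbitrary: A C)
  case 0
  show ?case
  proof (cases "A = 0")
    case True
    hence "is_unit B" using 0 by simp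
    thus ?thesis using True 0 by auto
  next
    case False
    hence "is_unit A" using 0 by (simp add: is_unit_iff_degree)
    thus ?thesis by blast
  qed
next
  case (Suc k)
  have "\<not> constant (poly A)" using Suc(2) by (simp add: constant_degree)
  then obtain r where r: "poly A r = 0" using fundamental_theorem_of_algebra by blast
  have B: "poly B r \<noteq> 0" using coprime_poly_0[OF Suc(3), of r] r by simp
  obtain D where D: "C * B = A * D" using Suc(4) by (elim dvdE)
  have "poly (C * B) r = 0" using r by (simp add: D)
  hence "poly C r = 0" using B by simp
  then obtain C' where C': "C = [:-r, 1:] * C'" by (auto simp: poly_eq_0_iff_dvd elim: dvdE)
  obtain A' where A': "A = [:-r, 1:] * A'" using r by (auto simp: poly_eq_0_iff_dvd elim: dvdE)
  have "A \<noteq> 0" using Suc(2) by auto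
  hence "degree A = degree [:-r, 1:] + degree A'" unfolding A' by (intro degree_mult_eq) auto
  hence deg: "k = degree A'" using Suc(2) by simp
  have cop: "coprime A' B" by (rule coprime_divisors[OF _ dvd_refl Suc(3)]) (simp only: A' dvd_triv_right)
  have "[:-r, 1:] * (C' * B) = [:-r, 1:] * (A' * D)"
    using D unfolding A' C' by (simp only: mult.assoc)
  hence "C' * B = A' * D" by (subst (asm) mult_left_cancel) auto
  hence "A' dvd C'" using Suc(1)[OF deg cop] by simp
  thus ?case unfolding A' C' by (rule mult_dvd_mono[OF dvd_refl])
qed

text \<open>The value at a point of the projective line of a binary form of degree \<open>n\<close>, dehomogenized
  to \<open>p\<close>; it depends on a choice of homogeneous coordinates only through a nonzero factor.\<close>

definition hval :: "nat \<Rightarrow> complex poly \<Rightarrow> proj1 \<Rightarrow> complex" where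
  "hval n p z = (case z of Pt t \<Rightarrow> poly p t | Infty \<Rightarrow> coeff p n)"

lemma hval_simps [simp]: "hval n p (Pt t) = poly p t" "hval n p Infty = coeff p n"
  by (simp_all add: hval_def)

lemma hval_linear:
  "hval n (p + q) z = hval n p z + hval n q z"
  "hval n (p - q) z = hval n p z - hval n q z"
  "hval n (smult a p) z = a * hval n p z"
  "hval n 0 z = 0"
  by (cases z; simp)+

lemma hval_sum: "hval n (\<Sum>i\<in>I. f i) z = (\<Sum>i\<in>I. hval n (f i) z)"
  by (cases z) (simp_all add: poly_sum coeff_sum)

lemma coeff_mult_top:
  fixes p q :: "'a :: comm_semiring_1 poly"
  assumes "degree p \<le> m" "degree q \<le> n"
  shows "coeff (p * q) (m + n) = coeff p m * coeff q n"
proof -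
  have "coeff (p * q) (m + n) = (\<Sum>i\<le>m + n. coeff p i * coeff q (m + n - i))"
    by (rule coeff_mult)
  also have "\<dots> = (\<Sum>i\<in>{m}. coeff p i * coeff q (m + n - i))"
  proof (rule sum.mono_neutral_right)
    show "\<forall>i\<in>{..m + n} - {m}. coeff p i * coeff q (m + n - i) = 0"
    proof
      fix i assume "i \<in> {..m + n} - {m}"
      hence "i > m \<or> m + n - i > n" by auto
      thus "coeff p i * coeff q (m + n - i) = 0"
        using assms by (auto simp: coeff_eq_0)
    qed
  qed auto
  finally show ?thesis by simp
qed

lemma hval_mult:
  assumes "degree p \<le> m" "degree q \<le> n"
  shows "hval (m + n) (p * q) z = hval m p z * hval n q z"
  using coeff_mult_top[OF assms] by (cases z) auto

lemma hval_power:
  assumes "degree p \<le> m"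
  shows "degree (p ^ j) \<le> m * j" "hval (m * j) (p ^ j) z = hval m p z ^ j"
proof -
  show deg: "degree (p ^ j) \<le> m * j" for j
    using order_trans[OF degree_power_le mult_le_mono1[OF assms]] by blast
  show "hval (m * j) (p ^ j) z = hval m p z ^ j"
  proof (induction j)
    case 0 show ?case by (cases z) auto
  next
    case (Suc j)
    thus ?case using hval_mult[OF assms deg[of j]] by simp
  qed
qed

text \<open>\<open>Infty\<close> is a zero exactly when the degree of \<open>p\<close> drops below
  \<open>n\<close>, so it fills at most the gap left by the affine roots.\<close>

lemma hval_zeros:
  assumes "degree p \<le> n" "p \<noteq> 0"
  shows "finite {z. hval n p z = 0}" "card {z. hval n p z = 0} \<le> n"
proof -
  let ?A = "{t. poly p t = 0}"
  have A: "finite ?A" "card ?A \<le> degree p"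
    using assms by (auto simp: poly_roots_finite card_poly_roots_bound)
  have c: "coeff p n = 0 \<longleftrightarrow> degree p < n"
    using assms by (metis coeff_eq_0 leading_coeff_0_iff le_neq_implies_less)
  have *: "{z. hval n p z = 0} = Pt ` ?A \<union> (if degree p < n then {Infty} else {})"
  proof (rule Set.set_eqI)
    fix z show "z \<in> {z. hval n p z = 0} \<longleftrightarrow> z \<in> Pt ` ?A \<union> (if degree p < n then {Infty} else {})"
      using c by (cases z) auto
  qed
  show "finite {z. hval n p z = 0}" using A by (simp add: *)
  have "card {z. hval n p z = 0} \<le> card (Pt ` ?A) + (if degree p < n then 1 else 0)"
    unfolding * by (rule order_trans[OF card_Un_le]) auto
  also have "card (Pt ` ?A) \<le> degree p" using A card_image_le order_trans by blast
  finally show "card {z. hval n p z = 0} \<le> n" using assms by (auto split: if_splits)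
qed

lemma reval_hval: "reval R z = (if hval (rdeg R) (snd R) z = 0 then Infty
    else Pt (hval (rdeg R) (fst R) z / hval (rdeg R) (snd R) z))"
  by (cases z) (auto simp: reval_def)

lemma degree_le_rdeg: "degree (fst R) \<le> rdeg R" "degree (snd R) \<le> rdeg R"
  by (auto simp: rdeg_def)

lemma hval_ratmap_nonzero:
  assumes "is_ratmap R"
  shows "hval (rdeg R) (fst R) z \<noteq> 0 \<or> hval (rdeg R) (snd R) z \<noteq> 0"
proof (cases z)
  case (Pt t)
  thus ?thesis using assms coprime_poly_0 by (auto simp: is_ratmap_def)
next
  case Infty
  have "rdeg R = degree (fst R) \<or> rdeg R = degree (snd R)" by (auto simp: rdeg_def max_def)
  moreover have "rdeg R \<ge> 1" using assms by (simp add: is_ratmap_def)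
  ultimately show ?thesis using Infty
    by (metis hval_simps(2) leading_coeff_0_iff degree_0 not_one_le_zero)
qed

text \<open>Absence of common zeros is the condition that is easy to carry through substitutions: at
  \<open>Infty\<close> it makes \<open>n\<close> the exact degree, at the other points it gives
  coprimality.\<close>

lemma ratmapI:
  assumes "degree A \<le> n" "degree B \<le> n" "n \<ge> 1"
    and nz: "\<And>z. hval n A z \<noteq> 0 \<or> hval n B z \<noteq> 0"
  shows "is_ratmap (A, B)" "rdeg (A, B) = n"
proof -
  have "coeff A n \<noteq> 0 \<or> coeff B n \<noteq> 0" using nz[of Infty] by simp
  hence "degree A = n \<or> degree B = n" using assms le_degree le_antisym by blast
  thus n: "rdeg (A, B) = n" using assms by (auto simp: rdeg_def)
  have "coprime A B"
    by (rule coprime_no_common_root) (metis nz hval_simps(1))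
  thus "is_ratmap (A, B)" using n assms by (simp add: is_ratmap_def)
qed

lemma reval_eq_iff:
  assumes "is_ratmap R" "is_ratmap S"
  shows "reval R z = reval S w \<longleftrightarrow>
    hval (rdeg R) (fst R) z * hval (rdeg S) (snd S) w = hval (rdeg S) (fst S) w * hval (rdeg R) (snd R) z"
  using hval_ratmap_nonzero[OF assms(1), of z] hval_ratmap_nonzero[OF assms(2), of w]
  by (auto simp: reval_hval frac_eq_eq)

text \<open>Two maps of degrees \<open>m\<close> and \<open>n\<close> agree on the zeros of a form of degree \<open>m + n\<close>.\<close>

lemma ratmaps_agree:
  assumes R: "is_ratmap R" and S: "is_ratmap S"
    and Z: "finite Z" "card Z > rdeg R + rdeg S" "\<And>z. z \<in> Z \<Longrightarrow> reval R z = reval S z"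
  shows "reval R = reval S" "rdeg R = rdeg S"
proof -
  obtain A B where AB: "R = (A, B)" by force
  obtain A' B' where AB': "S = (A', B')" by force
  let ?m = "rdeg R" and ?n = "rdeg S"
  let ?p = "A * B' - B * A'"
  have deg: "degree A \<le> ?m" "degree B \<le> ?m" "degree A' \<le> ?n" "degree B' \<le> ?n"
    using degree_le_rdeg[of R] degree_le_rdeg[of S] by (auto simp: AB AB')
  have h: "hval (?m + ?n) ?p z = hval ?m A z * hval ?n B' z - hval ?m B z * hval ?n A' z" for z
    by (simp add: hval_linear hval_mult deg)
  have "degree ?p \<le> ?m + ?n"
    using deg by (intro degree_diff_le order_trans[OF degree_mult_le] add_mono)
  moreover have sub: "Z \<subseteq> {z. hval (?m + ?n) ?p z = 0}"
    using Z(3) reval_eq_iff[OF R S] unfolding h by (auto simp: AB AB' mult.commute)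
  ultimately have p0: "?p = 0"
    using hval_zeros[of ?p "?m + ?n"] Z card_mono[OF _ sub] by force
  have "reval R z = reval S z" for z
    using h[of z] reval_eq_iff[OF R S, of z z] unfolding p0 by (auto simp: AB AB' hval_linear mult.commute)
  thus "reval R = reval S" by blast
  \<comment> \<open>The pairs are in lowest terms, so \<open>?p = 0\<close> makes corresponding
    entries divide each other; hence the degrees agree as well.\<close>
  have cop: "coprime A B" "coprime A' B'" using R S by (auto simp: is_ratmap_def AB AB')
  have eq: "A * B' = A' * B" using p0 by (simp add: mult.commute)
  have cop': "coprime B A" "coprime B' A'" using cop by (simp_all add: coprime_commute)
  have 1: "A dvd A'" using poly_coprime_dvd_mult[OF cop(1)] eq by (metis dvd_triv_left)
  have 2: "A' dvd A" using poly_coprime_dvd_mult[OF cop(2)] eq by (metis dvd_triv_left)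
  have 3: "B dvd B'" using poly_coprime_dvd_mult[OF cop'(1)] eq by (metis dvd_triv_right mult.commute)
  have 4: "B' dvd B" using poly_coprime_dvd_mult[OF cop'(2)] eq by (metis dvd_triv_right mult.commute)
  have "degree p = degree q" if "p dvd q" "q dvd p" for p q :: "complex poly"
    using that by (metis dvd_0_left dvd_imp_degree_le le_antisym)
  hence "degree A = degree A'" "degree B = degree B'" using 1 2 3 4 by blast+
  thus "rdeg R = rdeg S" by (simp add: rdeg_def AB AB')
qed

section \<open>Composition with Moebius transformations\<close>

lemma hval_degree1: "degree P \<le> 1 \<Longrightarrow> P = [:coeff P 0, coeff P 1:]"
  by (intro poly_eqI) (auto simp: coeff_pCons coeff_eq_0 split: nat.splits)

text \<open>The constant \<open>s\<close> relates the homogeneous coordinates \<open>(t : 1)\<close> or \<open>(1 : 0)\<close> chosen by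
  \<^const>\<open>hval\<close> to the coordinates \<open>(u : v)\<close>.\<close>

lemma hval_coords:
  assumes "u \<noteq> 0 \<or> v \<noteq> 0"
  shows "\<exists>s. s \<noteq> 0 \<and> (\<forall>n p. degree p \<le> n \<longrightarrow>
      (\<Sum>j\<le>n. coeff p j * u ^ j * v ^ (n - j)) = s ^ n * hval n p (if v = 0 then Infty else Pt (u / v)))"
proof (cases "v = 0")
  case True
  have "(\<Sum>j\<le>n. coeff p j * u ^ j * v ^ (n - j)) = u ^ n * coeff p n" for n p
  proof -
    have "(\<Sum>j\<le>n. coeff p j * u ^ j * v ^ (n - j)) = (\<Sum>j\<in>{n}. coeff p j * u ^ j * v ^ (n - j))"
      by (rule sum.mono_neutral_right) (auto simp: True)
    thus ?thesis by simp
  qed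
  thus ?thesis using True assms by (intro exI[of _ u]) auto
next
  case False
  have "(\<Sum>j\<le>n. coeff p j * u ^ j * v ^ (n - j)) = v ^ n * poly p (u / v)" if "degree p \<le> n" for n p
  proof -
    have "poly p (u / v) = (\<Sum>j\<le>n. coeff p j * (u / v) ^ j)"
      unfolding poly_altdef using that by (intro sum.mono_neutral_left) (auto simp: coeff_eq_0)
    thus ?thesis using False
      by (auto simp: sum_distrib_left power_divide power_diff intro!: sum.cong)
  qed
  thus ?thesis using False by (intro exI[of _ v]) auto
qed

text \<open>\<open>f\<close> is substituted into the binary forms of \<open>R\<close>. At every
  point the new forms are the old ones at \<open>f z\<close> times a common nonzero factor, so they
  have no common zero.\<close>

lemma ratmap_comp_moebius:
  assumes R: "is_ratmap R" and M: "moebius f"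
  shows "\<exists>S. is_ratmap S \<and> rdeg S = rdeg R \<and> reval S = reval R \<circ> f"
proof -
  obtain T where T: "is_ratmap T" "rdeg T = 1" "f = reval T"
    using M by (auto simp: moebius_def)
  obtain P Q where PQ: "T = (P, Q)" by force
  have degPQ: "degree P \<le> 1" "degree Q \<le> 1" using degree_le_rdeg[of T] T by (auto simp: PQ)
  define n where "n = rdeg R"
  \<comment> \<open>The homogenization of \<open>p\<close> in degree \<open>n\<close>, evaluated at
    \<open>(P, Q)\<close>.\<close>
  define sb where "sb p = (\<Sum>j\<le>n. smult (coeff p j) (P ^ j * Q ^ (n - j)))" for p
  have deg': "degree (P ^ j * Q ^ (n - j)) \<le> n" if "j \<le> n" for j
    using order_trans[OF degree_mult_le add_mono[OF hval_power(1)[OF degPQ(1), of j] hval_power(1)[OF degPQ(2), of "n - j"]]]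
      that by simp
  have deg: "degree (sb p) \<le> n" for p
    unfolding sb_def using deg' by (intro degree_sum_le) (auto intro: order_trans[OF degree_smult_le])
  have h: "hval n (sb p) z = (\<Sum>j\<le>n. coeff p j * hval 1 P z ^ j * hval 1 Q z ^ (n - j))" for p z
  proof -
    have "hval n (P ^ j * Q ^ (n - j)) z = hval 1 P z ^ j * hval 1 Q z ^ (n - j)" if "j \<le> n" for j
      using hval_mult[OF hval_power(1)[OF degPQ(1), of j] hval_power(1)[OF degPQ(2), of "n - j"], of z]
        hval_power(2)[OF degPQ(1), of j z] hval_power(2)[OF degPQ(2), of "n - j" z] that
      by simp
    thus ?thesis by (simp add: sb_def hval_sum hval_linear mult.assoc)
  qed
  have "\<exists>s. s \<noteq> 0 \<and> hval n (sb (fst R)) z = s * hval n (fst R) (f z)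
      \<and> hval n (sb (snd R)) z = s * hval n (snd R) (f z)" for z
  proof -
    have "hval 1 P z \<noteq> 0 \<or> hval 1 Q z \<noteq> 0"
      using hval_ratmap_nonzero[OF T(1), of z] T by (simp add: PQ)
    then obtain s where s: "s \<noteq> 0" "\<And>n p. degree p \<le> n \<Longrightarrow>
        (\<Sum>j\<le>n. coeff p j * hval 1 P z ^ j * hval 1 Q z ^ (n - j))
          = s ^ n * hval n p (if hval 1 Q z = 0 then Infty else Pt (hval 1 P z / hval 1 Q z))"
      using hval_coords[of "hval 1 P z" "hval 1 Q z"] by auto
    have fz: "f z = (if hval 1 Q z = 0 then Infty else Pt (hval 1 P z / hval 1 Q z))"
      using T by (simp add: reval_hval PQ)
    show ?thesis using s degree_le_rdeg[of R] h unfolding fz n_def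
      by (intro exI[of _ "s ^ rdeg R"]) auto
  qed
  then obtain s where s: "\<And>z. s z \<noteq> 0" "\<And>z. hval n (sb (fst R)) z = s z * hval n (fst R) (f z)"
      "\<And>z. hval n (sb (snd R)) z = s z * hval n (snd R) (f z)" by metis
  let ?S = "(sb (fst R), sb (snd R))"
  have S: "is_ratmap ?S" "rdeg ?S = n"
    using ratmapI[of "sb (fst R)" n "sb (snd R)"] deg s hval_ratmap_nonzero[OF R] R
    by (auto simp: n_def is_ratmap_def)
  have "reval ?S z = reval R (f z)" for z
    using s by (simp add: reval_hval S(2) n_def)
  thus ?thesis using S by (intro exI[of _ ?S]) (auto simp: n_def)
qed

lemma moebius_comp_ratmap:
  assumes R: "is_ratmap R" and M: "moebius f"
  shows "\<exists>S. is_ratmap S \<and> rdeg S = rdeg R \<and> reval S = f \<circ> reval R"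
proof -
  obtain T where T: "is_ratmap T" "rdeg T = 1" "f = reval T"
    using M by (auto simp: moebius_def)
  obtain P Q where PQ: "T = (P, Q)" by force
  obtain A B where AB: "R = (A, B)" by force
  have degPQ: "degree P \<le> 1" "degree Q \<le> 1" using degree_le_rdeg[of T] T by (auto simp: PQ)
  define n where "n = rdeg R"
  \<comment> \<open>The linear form belonging to \<open>p\<close>, evaluated at
    \<open>(A, B)\<close>.\<close>
  define cb where "cb p = smult (coeff p 1) A + smult (coeff p 0) B" for p
  have deg: "degree (cb p) \<le> n" for p
    using degree_le_rdeg[of R] unfolding cb_def n_def
    by (intro degree_add_le order_trans[OF degree_smult_le]) (auto simp: AB)
  have h: "\<exists>s. s \<noteq> 0 \<and> hval n (cb P) z = s * hval 1 P (reval R z) \<and> hval n (cb Q) z = s * hval 1 Q (reval R z)" for z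
  proof -
    have nz: "hval n A z \<noteq> 0 \<or> hval n B z \<noteq> 0"
      using hval_ratmap_nonzero[OF R, of z] by (simp add: AB n_def)
    then obtain s where s: "s \<noteq> 0" "\<And>m p. degree p \<le> m \<Longrightarrow>
        (\<Sum>j\<le>m. coeff p j * hval n A z ^ j * hval n B z ^ (m - j))
          = s ^ m * hval m p (if hval n B z = 0 then Infty else Pt (hval n A z / hval n B z))"
      using hval_coords[of "hval n A z" "hval n B z"] by auto
    have Rz: "reval R z = (if hval n B z = 0 then Infty else Pt (hval n A z / hval n B z))"
      by (simp add: reval_hval AB n_def)
    show ?thesis using s(1) s(2)[OF degPQ(1)] s(2)[OF degPQ(2)] unfolding Rz
      by (intro exI[of _ s]) (auto simp: cb_def hval_linear add.commute)
  qed
  then obtain s where s: "\<And>z. s z \<noteq> 0" "\<And>z. hval n (cb P) z = s z * hval 1 P (reval R z)"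
      "\<And>z. hval n (cb Q) z = s z * hval 1 Q (reval R z)" by metis
  let ?S = "(cb P, cb Q)"
  have S: "is_ratmap ?S" "rdeg ?S = n"
    using ratmapI[of "cb P" n "cb Q"] deg s hval_ratmap_nonzero[OF T(1)] R T
    by (auto simp: n_def is_ratmap_def PQ)
  have "reval ?S z = f (reval R z)" for z
    using s T unfolding T(3) reval_hval[of ?S] reval_hval[of T "reval R z"] by (simp add: S(2) PQ)
  thus ?thesis using S by (intro exI[of _ ?S]) (auto simp: n_def)
qed

lemma moebius_comp: "moebius f \<Longrightarrow> moebius g \<Longrightarrow> moebius (f \<circ> g)"
proof -
  assume "moebius f" and g: "moebius g"
  then obtain R where R: "is_ratmap R" "rdeg R = 1" "f = reval R" by (auto simp: moebius_def)
  show "moebius (f \<circ> g)"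
    using ratmap_comp_moebius[OF R(1) g] R unfolding moebius_def by metis
qed

lemma moebius_id: "moebius id"
proof -
  have "is_ratmap ([:0, 1:], 1)" "rdeg ([:0, 1:], 1) = 1"
    by (auto simp: is_ratmap_def rdeg_def)
  moreover have "reval ([:0, 1:], 1) = id"
  proof
    fix z show "reval ([:0, 1:], 1) z = id z" by (cases z) (auto simp: reval_def rdeg_def)
  qed
  ultimately show ?thesis unfolding moebius_def by (intro exI[of _ "([:0, 1:], 1)"]) simp
qed

lemma moebius_inverse:
  assumes "moebius f"
  obtains g where "moebius g" "f \<circ> g = id" "g \<circ> f = id"
proof -
  obtain T where T: "is_ratmap T" "rdeg T = 1" "f = reval T"
    using assms by (auto simp: moebius_def)
  obtain P Q where PQ: "T = (P, Q)" by force
  have degPQ: "degree P \<le> 1" "degree Q \<le> 1" using degree_le_rdeg[of T] T by (auto simp: PQ)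
  define a b c d where abcd: "a = coeff P 1" "b = coeff P 0" "c = coeff Q 1" "d = coeff Q 0"
  have P: "P = [:b, a:]" and Q: "Q = [:d, c:]"
    using hval_degree1 degPQ by (auto simp: abcd)
  have nz: "hval 1 P z \<noteq> 0 \<or> hval 1 Q z \<noteq> 0" for z
    using hval_ratmap_nonzero[OF T(1), of z] T by (simp add: PQ)
  have det: "a * d - b * c \<noteq> 0"
  proof
    \<comment> \<open>With zero determinant, the zero of one linear form is also a zero of the
      other.\<close>
    assume 0: "a * d - b * c = 0"
    have "a \<noteq> 0 \<or> c \<noteq> 0" using nz[of Infty] by (simp add: P Q)
    thus False
    proof
      assume "a \<noteq> 0"
      thus False using nz[of "Pt (- b / a)"] 0 by (auto simp: P Q field_simps)
    next
      assume "c \<noteq> 0"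
      thus False using nz[of "Pt (- d / c)"] 0 by (auto simp: P Q field_simps)
    qed
  qed
  \<comment> \<open>The adjugate matrix, that is, the map
    \<open>(d z - b) / (a - c z)\<close>.\<close>
  let ?P = "[:- b, d:]" and ?Q = "[:a, - c:]"
  have hz: "hval 1 ?P z \<noteq> 0 \<or> hval 1 ?Q z \<noteq> 0" for z
  proof (cases z)
    case (Pt t)
    \<comment> \<open>The two left sides are the determinant times \<open>t\<close> and the
      determinant itself.\<close>
    have "a * (d * t - b) + b * (a - c * t) \<noteq> 0 \<or> c * (d * t - b) + d * (a - c * t) \<noteq> 0"
      using det by (auto simp: algebra_simps)
    hence "d * t - b \<noteq> 0 \<or> a - c * t \<noteq> 0" by auto
    thus ?thesis by (auto simp: Pt algebra_simps)
  next
    case Infty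
    thus ?thesis using det by auto
  qed
  have S: "is_ratmap (?P, ?Q)" "rdeg (?P, ?Q) = 1"
    using ratmapI[of ?P 1 ?Q] hz by auto
  let ?g = "reval (?P, ?Q)"
  have fz: "f z = (case z of Pt t \<Rightarrow> if c * t + d = 0 then Infty else Pt ((a * t + b) / (c * t + d))
      | Infty \<Rightarrow> if c = 0 then Infty else Pt (a / c))" for z
    using T by (cases z) (auto simp: reval_def PQ P Q algebra_simps)
  have gz: "?g z = (case z of Pt t \<Rightarrow> if a - c * t = 0 then Infty else Pt ((d * t - b) / (a - c * t))
      | Infty \<Rightarrow> if c = 0 then Infty else Pt (d / - c))" for z
    using S by (cases z) (auto simp: reval_def algebra_simps)
  have e1: "f (?g z) = z" for z
  proof (cases z)
    case (Pt t)
    show ?thesis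
    proof (cases "a - c * t = 0")
      case True
      hence "c \<noteq> 0" using det by auto
      moreover have "?g z = Infty" using True by (subst gz) (simp add: Pt)
      ultimately show ?thesis using True by (simp add: fz Pt)
    next
      case False
      have 1: "c * ((d * t - b) / (a - c * t)) + d = (a * d - b * c) / (a - c * t)"
        using False by (simp add: divide_simps) (simp add: algebra_simps)
      have 2: "a * ((d * t - b) / (a - c * t)) + b = t * (a * d - b * c) / (a - c * t)"
        using False by (simp add: divide_simps) (simp add: algebra_simps)
      show ?thesis using False det 1 2 by (simp add: fz gz Pt)
    qed
  next
    case Infty
    show ?thesis using det by (auto simp: fz gz Infty field_simps)
  qed
  have e2: "?g (f z) = z" for z
  proof (cases z)
    case (Pt t)
    show ?thesis
    proof (cases "c * t + d = 0")
      case True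
      hence "c \<noteq> 0" using det by auto
      moreover have "t * c = - d" using True by (simp add: eq_neg_iff_add_eq_0 mult.commute)
      ultimately have "t = - (d / c)" by (simp add: field_simps)
      thus ?thesis using \<open>c \<noteq> 0\<close> by (simp add: fz gz Pt)
    next
      case False
      have 1: "a - c * ((a * t + b) / (c * t + d)) = (a * d - b * c) / (c * t + d)"
        using False by (simp add: divide_simps) (simp add: algebra_simps)
      have 2: "d * ((a * t + b) / (c * t + d)) - b = t * (a * d - b * c) / (c * t + d)"
        using False by (simp add: divide_simps) (simp add: algebra_simps)
      show ?thesis using False det 1 2 by (simp add: fz gz Pt)
    qed
  next
    case Infty
    show ?thesis using det by (auto simp: fz gz Infty field_simps)
  qed
  have "moebius ?g" unfolding moebius_def using S by blast
  thus ?thesis using that[of ?g] e1 e2 by (auto simp: fun_eq_iff)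
qed

lemma moebius_bij: "moebius f \<Longrightarrow> bij f"
  by (erule moebius_inverse) (rule o_bij)

lemma moebius_inv:
  assumes "moebius f"
  shows "moebius (inv_into UNIV f)"
proof -
  from assms obtain g where "moebius g" "f \<circ> g = id" "g \<circ> f = id" by (rule moebius_inverse)
  thus ?thesis using inv_unique_comp by metis
qed

lemma moebius_agree:
  assumes "moebius f" "moebius g" "finite Z" "card Z \<ge> 3" "\<And>z. z \<in> Z \<Longrightarrow> f z = g z"
  shows "f = g"
proof -
  obtain R S where "is_ratmap R" "rdeg R = 1" "f = reval R" "is_ratmap S" "rdeg S = 1" "g = reval S"
    using assms(1,2) by (auto simp: moebius_def)
  thus ?thesis using ratmaps_agree(1)[of R S Z] assms(3-5) by auto
qed

section \<open>Fibres and ramification\<close>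

lemma hval_fibre_poly:
  assumes R: "is_ratmap R"
  shows "reval R z = q \<longleftrightarrow> hval (rdeg R) (fibre_poly R q) z = 0"
  using hval_ratmap_nonzero[OF R, of z]
  by (cases q) (auto simp: reval_hval fibre_poly_def hval_linear field_simps)

lemma fibre_poly_props:
  assumes R: "is_ratmap R"
  shows "degree (fibre_poly R q) \<le> rdeg R" "fibre_poly R q \<noteq> 0"
proof -
  show "degree (fibre_poly R q) \<le> rdeg R"
    using degree_le_rdeg[of R]
    by (cases q) (auto simp: fibre_poly_def intro!: degree_diff_le order_trans[OF degree_smult_le])
  show "fibre_poly R q \<noteq> 0"
  proof
    assume 0: "fibre_poly R q = 0"
    have R': "coprime (fst R) (snd R)" "rdeg R \<ge> 1" using R by (auto simp: is_ratmap_def)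
    show False
    proof (cases q)
      case (Pt c)
      hence A: "fst R = smult c (snd R)" using 0 by (simp add: fibre_poly_def)
      hence "snd R dvd fst R" by (simp add: dvd_smult)
      hence "is_unit (snd R)" by (rule coprime_common_divisor[OF R'(1) _ dvd_refl])
      hence "degree (snd R) = 0" by (auto simp: is_unit_poly_iff)
      thus False using A R'(2) by (auto simp: rdeg_def split: if_splits)
    next
      case Infty
      hence B: "snd R = 0" using 0 by (simp add: fibre_poly_def)
      hence "is_unit (fst R)" using coprime_common_divisor[OF R'(1) dvd_refl] by simp
      hence "degree (fst R) = 0" by (auto simp: is_unit_poly_iff)
      thus False using B R'(2) by (simp add: rdeg_def)
    qed
  qed
qed

lemma fibre_finite_card:
  assumes R: "is_ratmap R"
  shows "finite {z. reval R z = q}" "card {z. reval R z = q} \<le> rdeg R"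
  unfolding hval_fibre_poly[OF R] by (rule hval_zeros[OF fibre_poly_props[OF R]])+

lemma card_roots_simple:
  fixes p :: "complex poly"
  assumes "p \<noteq> 0" "\<And>t. poly p t = 0 \<Longrightarrow> order t p = 1"
  shows "card {t. poly p t = 0} = degree p"
proof -
  let ?Z = "{t. poly p t = 0}"
  have "order a p = 0 \<or> order a p = 1" for a
    using assms(2)[of a] order_root[of p a] assms(1) by argo
  hence "rsquarefree p" 
    unfolding rsquarefree_def using assms by simp
  note dec = complex_poly_decompose_rsquarefree[OF this]
  have "degree p = degree (smult (lead_coeff p) (\<Prod>z\<in>?Z. [:- z, 1:]))" unfolding dec ..
  also have "\<dots> = degree (\<Prod>z\<in>?Z. [:- z, 1:])" using assms(1) by simp
  also have "\<dots> = (\<Sum>z\<in>?Z. degree [:- z, 1:])" by (rule degree_prod_sum_eq) simp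
  also have "\<dots> = card ?Z" by simp
  finally show ?thesis by simp
qed

text \<open>The fibre form has \<open>rdeg R\<close> zeros with multiplicity, and ramification index
  1 makes all of them simple.\<close>

lemma unramified_fibre_card:
  assumes R: "is_ratmap R" and u: "\<And>z. reval R z = q \<Longrightarrow> ram_index R z = 1"
  shows "card {z. reval R z = q} = rdeg R"
proof -
  let ?F = "fibre_poly R q" and ?n = "rdeg R"
  let ?A = "{t. poly ?F t = 0}"
  note F = fibre_poly_props[OF R, of q]
  have z: "reval R z = q \<longleftrightarrow> hval ?n ?F z = 0" for z by (rule hval_fibre_poly[OF R])
  have A: "card ?A = degree ?F"
  proof (rule card_roots_simple[OF F(2)])
    fix t assume "poly ?F t = 0"
    hence t: "reval R (Pt t) = q" using z[of "Pt t"] by simp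
    from u[OF t] t show "order t ?F = 1" by (simp add: ram_index_def)
  qed
  have fin: "finite ?A" by (rule poly_roots_finite[OF F(2)])
  have cA: "card (Pt ` ?A) = degree ?F" using A by (simp add: card_image inj_on_def)
  show ?thesis
  proof (cases "degree ?F = ?n")
    case True
    have c: "coeff ?F ?n \<noteq> 0" unfolding True[symmetric] using F(2) by simp
    have "{z. reval R z = q} = Pt ` ?A"
    proof (rule Set.set_eqI)
      fix w show "w \<in> {z. reval R z = q} \<longleftrightarrow> w \<in> Pt ` ?A"
        using c by (cases w) (auto simp: z)
    qed
    hence "card {z. reval R z = q} = card (Pt ` ?A)" by simp
    also note cA
    also note True
    finally show ?thesis .
  next
    case False
    \<comment> \<open>\<open>Infty\<close> lies in this fibre; index 1 there means that the degree
      drops by exactly one.\<close>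
    hence c: "coeff ?F ?n = 0" using F(1) by (simp add: coeff_eq_0)
    hence i: "reval R Infty = q" by (simp add: z)
    have d: "degree ?F = ?n - 1" using u[OF i] i F(1) False by (simp add: ram_index_def)
    have "{z. reval R z = q} = insert Infty (Pt ` ?A)"
    proof (rule Set.set_eqI)
      fix w show "w \<in> {z. reval R z = q} \<longleftrightarrow> w \<in> insert Infty (Pt ` ?A)"
        using c by (cases w) (auto simp: z)
    qed
    hence "card {z. reval R z = q} = card (insert Infty (Pt ` ?A))" by simp
    also have "\<dots> = Suc (card (Pt ` ?A))" using fin by (subst card_insert_disjoint) auto
    also note cA
    finally show ?thesis using d False F(1) by linarith
  qed
qed

section \<open>Nodal curves of genus 0 as rooted trees\<close>

lemma node_in_points:
  assumes "genus0_curve C" "{p, q} \<in> nodes C"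
  shows "p \<in> points C" "q \<in> points C" "fst p \<in> comps C" "fst q \<in> comps C"
proof -
  have "{p, q} \<subseteq> points C" using assms by (auto simp: genus0_curve_def)
  thus "p \<in> points C" "q \<in> points C" "fst p \<in> comps C" "fst q \<in> comps C"
    by (auto simp: points_def)
qed

lemma node_obtain:
  assumes "genus0_curve C" "p \<in> sing C"
  obtains q where "{p, q} \<in> nodes C"
proof -
  obtain N where N: "N \<in> nodes C" "p \<in> N" using assms(2) by (auto simp: sing_def)
  hence "card N = 2" using assms(1) by (auto simp: genus0_curve_def)
  then obtain q where "N = {p, q}" using N(2) by (auto simp: card_2_iff)
  thus ?thesis using that N by blast
qed

text \<open>A property that passes across every node can only stop at \<open>v\<close>. This serves
  to follow a contracted tree from a marked point to the place where it meets
  \<open>v\<close>.\<close>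

lemma reach_component:
  assumes "(u, v) \<in> (adjacency C)\<^sup>*" "u \<noteq> v" "P u"
    and step: "\<forall>p q. {p, q} \<in> nodes C \<longrightarrow> P (fst p) \<longrightarrow> fst q \<noteq> v \<longrightarrow> P (fst q)"
  shows "\<exists>p q. {p, q} \<in> nodes C \<and> P (fst p) \<and> fst q = v"
proof -
  have "P x \<and> x \<noteq> v \<or> (\<exists>p q. {p, q} \<in> nodes C \<and> P (fst p) \<and> fst q = v)"
    if "(u, x) \<in> (adjacency C)\<^sup>*" for x
    using that
  proof (induction rule: rtrancl_induct)
    case base
    show ?case using assms(2,3) by blast
  next
    case (step y z)
    obtain p q where "{p, q} \<in> nodes C" "fst p = y" "fst q = z"
      using step(2) by (auto simp: adjacency_def)
    thus ?case using step(3) assms(4) by blast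
  qed
  from this[OF assms(1)] show ?thesis by blast
qed

text \<open>\<open>a u\<close> and \<open>b u\<close> are the two branches of the edge from
  \<open>u\<close> towards the root, with \<open>a u\<close> on \<open>u\<close> itself;
  \<open>height\<close> only has to decrease along these edges.\<close>

definition rooted_tree :: "nodal_curve \<Rightarrow> nat \<Rightarrow> (nat \<Rightarrow> nat) \<Rightarrow> (nat \<Rightarrow> point) \<Rightarrow> (nat \<Rightarrow> point) \<Rightarrow> bool"
  where "rooted_tree D w height a b \<longleftrightarrow>
    (\<forall>u\<in>comps D - {w}. {a u, b u} \<in> nodes D \<and> fst (a u) = u \<and> height (fst (b u)) < height u) \<and>
    (\<forall>p q. {p, q} \<in> nodes D \<longrightarrow>
      (\<exists>u\<in>comps D - {w}. p = a u \<and> q = b u \<or> p = b u \<and> q = a u)) \<and>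
    nodes D = (\<lambda>u. {a u, b u}) ` (comps D - {w})"

lemma rooted_treeD:
  assumes "rooted_tree D w height a b"
  shows "u \<in> comps D - {w} \<Longrightarrow> {a u, b u} \<in> nodes D"
    "u \<in> comps D - {w} \<Longrightarrow> fst (a u) = u"
    "u \<in> comps D - {w} \<Longrightarrow> height (fst (b u)) < height u"
    "{p, q} \<in> nodes D \<Longrightarrow> \<exists>u\<in>comps D - {w}. p = a u \<and> q = b u \<or> p = b u \<and> q = a u"
    "comps D = {w} \<Longrightarrow> nodes D = {}"
  using assms unfolding rooted_tree_def by (blast, blast, blast, blast, simp)

text \<open>The first edge of a shortest path to \<open>w\<close> determines its starting point, and genus 0 means that
  there are no edges besides these.\<close>

lemma genus0_rooted_tree:
  assumes g: "genus0_curve D" and w: "w \<in> comps D"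
  obtains height a b where "rooted_tree D w height a b"
proof -
  let ?A = "adjacency D"
  have fin: "finite (comps D)" "finite (nodes D)"
    and con: "\<And>u v. u \<in> comps D \<Longrightarrow> v \<in> comps D \<Longrightarrow> (u, v) \<in> ?A\<^sup>*"
    and ar: "arithmetic_genus D = 0"
    using g by (auto simp: genus0_curve_def)
  define height where "height u = (LEAST n. (w, u) \<in> ?A ^^ n)" for u
  have "\<exists>p q. {p, q} \<in> nodes D \<and> fst p = u \<and> height (fst q) < height u" if u: "u \<in> comps D - {w}" for u
  proof -
    have "\<exists>n. (w, u) \<in> ?A ^^ n" using con[OF w, of u] u by (auto simp: rtrancl_power)
    hence du: "(w, u) \<in> ?A ^^ height u" unfolding height_def by (rule LeastI_ex)
    then obtain m where m: "height u = Suc m" using u by (cases "height u") auto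
    then obtain v where v: "(w, v) \<in> ?A ^^ m" "(v, u) \<in> ?A" using du by auto
    have "height v \<le> m" unfolding height_def using v(1) by (rule Least_le)
    moreover obtain q p where "{q, p} \<in> nodes D" "fst q = v" "fst p = u"
      using v(2) by (auto simp: adjacency_def)
    ultimately show ?thesis using m by (intro exI[of _ p] exI[of _ q]) (auto simp: insert_commute)
  qed
  hence "\<forall>u\<in>comps D - {w}. \<exists>pq. {fst pq, snd pq} \<in> nodes D \<and> fst (fst pq) = u \<and>
      height (fst (snd pq)) < height u" by fastforce
  from bchoice[OF this] obtain ab' where ab': "\<forall>u\<in>comps D - {w}. {fst (ab' u), snd (ab' u)} \<in> nodes D \<and>
      fst (fst (ab' u)) = u \<and> height (fst (snd (ab' u))) < height u" ..
  define a b where "a u = fst (ab' u)" and "b u = snd (ab' u)" for u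
  have ab: "\<And>u. u \<in> comps D - {w} \<Longrightarrow> {a u, b u} \<in> nodes D"
    "\<And>u. u \<in> comps D - {w} \<Longrightarrow> fst (a u) = u"
    "\<And>u. u \<in> comps D - {w} \<Longrightarrow> height (fst (b u)) < height u" for u
    using ab' by (auto simp: a_def b_def)
  let ?E = "\<lambda>u. {a u, b u}"
  have inj: "inj_on ?E (comps D - {w})"
  proof (rule inj_onI)
    fix u v assume u: "u \<in> comps D - {w}" and v: "v \<in> comps D - {w}" and eq: "?E u = ?E v"
    show "u = v"
    \<comment> \<open>Two components with the same edge would be parents of each other, against the
      decrease of \<open>height\<close>.\<close>
    proof (rule ccontr)
      assume "u \<noteq> v"
      hence "a u = b v" "b u = a v" using eq ab(2)[OF u] ab(2)[OF v] by (auto simp: doubleton_eq_iff)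
      thus False using ab(2,3)[OF u] ab(2,3)[OF v] by auto
    qed
  qed
  have "card (?E ` (comps D - {w})) = card (comps D) - 1"
    using card_image[OF inj] w fin by simp
  also have "\<dots> = card (nodes D)" using ar w fin
    by (auto simp: arithmetic_genus_def)
  finally have "?E ` (comps D - {w}) = nodes D"
    using ab(1) fin by (intro card_subset_eq) auto
  hence img: "nodes D = ?E ` (comps D - {w})" ..
  have "\<exists>u\<in>comps D - {w}. p = a u \<and> q = b u \<or> p = b u \<and> q = a u" if "{p, q} \<in> nodes D" for p q
    using that unfolding img by (auto simp: doubleton_eq_iff)
  hence "rooted_tree D w height a b" using ab img unfolding rooted_tree_def by blast
  thus ?thesis by (rule that)
qed

lemma single_component_smooth:
  assumes "genus0_curve D" "comps D = {w}"
  shows "nodes D = {}"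
proof -
  have "w \<in> comps D" using assms(2) by simp
  then obtain height a b where "rooted_tree D w height a b" by (rule genus0_rooted_tree[OF assms(1)])
  thus ?thesis using assms(2) by (rule rooted_treeD(5))
qed

text \<open>Among the components that \<open>e\<close> contracts to the same point, one farthest from \<open>w\<close> is
  attached by a single node, hence carries two of the marked points.\<close>

lemma stable_two_marks:
  assumes st: "stable_curve m D s" and w: "w \<in> comps D"
    and e_const: "\<And>u z z'. u \<in> comps D - {w} \<Longrightarrow> e (u, z) = e (u, z')"
    and e_node: "\<And>p q. {p, q} \<in> nodes D \<Longrightarrow> e p = e q"
    and u: "u \<in> comps D - {w}"
  obtains i j where "i < m" "j < m" "i \<noteq> j" "e (s i) = e (u, Infty)" "e (s j) = e (u, Infty)"
proof -
  have g: "genus0_curve D" and pc: "pointed_curve m D s"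
    using st by (auto simp: stable_curve_def pointed_curve_def)
  obtain height a b where rt: "rooted_tree D w height a b" using genus0_rooted_tree[OF g w] .
  note t = rooted_treeD[OF rt]
  let ?S = "{v \<in> comps D - {w}. e (v, Infty) = e (u, Infty)}"
  have finS: "finite ?S" using g by (auto simp: genus0_curve_def)
  have "u \<in> ?S" using u by auto
  hence "Max (height ` ?S) \<in> height ` ?S" using finS by (intro Max_in) auto
  then obtain v where v: "v \<in> ?S" "height v = Max (height ` ?S)" by auto
  have vmax: "height v' \<le> height v" if "v' \<in> ?S" for v'
    unfolding v(2) using that finS by (intro Max_ge) auto
  have v': "v \<in> comps D - {w}" using v by auto
  have e1: "e p = e (fst p, Infty)" if "fst p \<in> comps D - {w}" for p
    using e_const[OF that, of "snd p"] by simp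
  \<comment> \<open>A further node of \<open>v\<close> would lead to a child that is contracted to
    the same point and is higher than \<open>v\<close>.\<close>
  have sing: "p = a v" if "p \<in> sing D" "fst p = v" for p
  proof -
    from node_obtain[OF g that(1)] obtain q where q: "{p, q} \<in> nodes D" .
    from t(4)[OF q] obtain v'' where v'': "v'' \<in> comps D - {w}"
      "p = a v'' \<and> q = b v'' \<or> p = b v'' \<and> q = a v''" by blast
    show ?thesis
    proof (cases "p = a v''")
      case True
      thus ?thesis using t(2)[OF v''(1)] that by simp
    next
      case False
      hence pq: "p = b v''" "q = a v''" using v'' by auto
      have "e (v'', Infty) = e q" using e1[of q] v'' pq t(2) by simp
      also have "\<dots> = e p" using e_node[OF q] by simp
      also have "\<dots> = e (v, Infty)" using e1[of p] that v' by simp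
      finally have "v'' \<in> ?S" using v v'' by auto
      thus ?thesis using vmax[of v''] t(3)[OF v''(1)] pq that by auto
    qed
  qed
  let ?M = "{p \<in> s ` {..<m}. fst p = v}"
  \<comment> \<open>At most one of the three special points required by stability is a node.\<close>
  have "{p \<in> s ` {..<m} \<union> sing D. fst p = v} \<subseteq> insert (a v) ?M" using sing by auto
  hence "card {p \<in> s ` {..<m} \<union> sing D. fst p = v} \<le> card (insert (a v) ?M)"
    by (intro card_mono) auto
  also have "\<dots> \<le> Suc (card ?M)" by (rule card_insert_le_m1) auto
  finally have "3 \<le> Suc (card ?M)" using st v' by (auto simp: stable_curve_def)
  hence "\<not> card ?M \<le> Suc 0" by simp
  moreover have "finite ?M" by simp
  ultimately have "\<not> (\<forall>p\<in>?M. \<forall>p'\<in>?M. p = p')" by (simp only: card_le_Suc0_iff_eq) simp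
  then obtain p p' where "p \<in> ?M" "p' \<in> ?M" "p \<noteq> p'" by blast
  then obtain i j where ij: "i < m" "j < m" "s i = p" "s j = p'" "fst p = v" "fst p' = v" "p \<noteq> p'" by auto
  have "e p = e (u, Infty)" "e p' = e (u, Infty)"
    using e1[of p] e1[of p'] ij v by auto
  thus ?thesis using that[of i j] ij by auto
qed

section \<open>Admissible covers with generic stabilization\<close>

text \<open>\<open>R0\<close> is the map that interpolates the marks and \<open>V\<close> its set of
  branch values. All that general position contributes is collected here, so the analysis of a fibre
  is free of determinants and resultants.\<close>

locale branch_data =
  fixes d n k :: nat and \<mu>s :: "nat list list" and x y :: "nat \<Rightarrow> complex"
    and R0 :: ratmap and V :: "proj1 set"
  assumes d: "d \<ge> 1" and n: "n = 2 * d + 1"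
    and length_prof: "length (flat_profile \<mu>s) = n" and k: "k = length \<mu>s" "k \<ge> 3"
    and prof: "\<And>i. i < n \<Longrightarrow> fst (flat_profile \<mu>s ! i) < k"
      "\<And>i. i < n \<Longrightarrow> snd (flat_profile \<mu>s ! i) = 1"
    and card_class: "\<And>h. card {i. i < n \<and> fst (flat_profile \<mu>s ! i) = h} \<le> d"
    and inj_x: "inj_on x {..<n}" and inj_y: "inj_on y {..<k}"
    and R0: "is_ratmap R0" "rdeg R0 = d"
    and R0_marks: "\<And>i. i < n \<Longrightarrow> reval R0 (Pt (x i)) = Pt (y (fst (flat_profile \<mu>s ! i)))"
    and V: "finite V" "\<And>h. h < k \<Longrightarrow> Pt (y h) \<notin> V"
    and card_V_fibre: "\<And>q. q \<in> V \<Longrightarrow> card {z. reval R0 z = q} < d"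
    and unramified: "\<And>z. reval R0 z \<notin> V \<Longrightarrow> ram_index R0 z = 1"
    and simply_ramified: "\<And>z. ram_index R0 z = 1 \<or> ram_index R0 z = 2"
      "\<And>q. q \<in> V \<Longrightarrow> \<exists>!z. reval R0 z = q \<and> ram_index R0 z = 2"
begin

abbreviation "hh i \<equiv> fst (flat_profile \<mu>s ! i)"
abbreviation "b \<equiv> card V"

end

text \<open>\<open>v\<close>, \<open>c\<close> and \<open>w\<close>, \<open>e\<close> are witnesses
  for \<open>stabilizes_to\<close> on source and target: \<open>c\<close> and \<open>e\<close>
  contract every component except \<open>v\<close> and \<open>w\<close>.\<close>

locale fibre_cover = branch_data +
  fixes X :: cover and v w :: nat and c e :: "point \<Rightarrow> proj1"
  assumes adm: "admissible_cover d b \<mu>s X"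
    and v: "v \<in> comps (src X)" and c_moebius: "moebius (\<lambda>z. c (v, z))"
    and c_const: "\<And>u z z'. u \<in> comps (src X) - {v} \<Longrightarrow> c (u, z) = c (u, z')"
    and c_node: "\<And>p q. {p, q} \<in> nodes (src X) \<Longrightarrow> c p = c q"
    and c_mark: "\<And>i. i < n \<Longrightarrow> c (src_pts X i) = Pt (x i)"
    and w: "w \<in> comps (tgt X)" and e_moebius: "moebius (\<lambda>z. e (w, z))"
    and e_const: "\<And>u z z'. u \<in> comps (tgt X) - {w} \<Longrightarrow> e (u, z) = e (u, z')"
    and e_node: "\<And>p q. {p, q} \<in> nodes (tgt X) \<Longrightarrow> e p = e q"
    and e_mark: "\<And>h. h < k \<Longrightarrow> e (tgt_pts X h) = Pt (y h)"
begin

section \<open>Covers over a general point are smooth\<close>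

lemma adm_unfold:
  "pointed_curve n (src X) (src_pts X)"
  "stable_curve (k + b) (tgt X) (tgt_pts X)"
  "\<And>u. u \<in> comps (src X) \<Longrightarrow> comp_map X u \<in> comps (tgt X)"
  "\<And>u. u \<in> comps (src X) \<Longrightarrow> is_ratmap (rat_map X u)"
  "\<And>u. u \<in> comps (tgt X) \<Longrightarrow>
     (\<Sum>u'\<in>{u'\<in>comps (src X). comp_map X u' = u}. rdeg (rat_map X u')) = d"
  "\<And>p. p \<in> points (src X) \<Longrightarrow> cover_map X p \<in> sing (tgt X) \<longleftrightarrow> p \<in> sing (src X)"
  "\<And>p q. {p, q} \<in> nodes (src X) \<Longrightarrow> {cover_map X p, cover_map X q} \<in> nodes (tgt X)"
  "\<And>i. i < n \<Longrightarrow> cover_map X (src_pts X i) = tgt_pts X (hh i)"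
  "\<And>i. i < n \<Longrightarrow> ram X (src_pts X i) = 1"
  "\<And>p. p \<in> points (src X) - sing (src X) - src_pts X ` {..<n} \<Longrightarrow>
     ram X p = 1 \<or> (\<exists>t<b. cover_map X p = tgt_pts X (k + t) \<and> ram X p = 2)"
  using adm prof unfolding admissible_cover_def Let_def length_prof k(1)[symmetric] by auto

lemma genus0: "genus0_curve (src X)" "genus0_curve (tgt X)"
  using adm_unfold(1,2) by (auto simp: pointed_curve_def stable_curve_def)

lemma e_const': "fst p \<in> comps (tgt X) \<Longrightarrow> fst p \<noteq> w \<Longrightarrow> e p = e (fst p, z)"
  using e_const[of "fst p" "snd p" z] by simp

lemma c_const': "fst p \<in> comps (src X) \<Longrightarrow> fst p \<noteq> v \<Longrightarrow> c p = c (fst p, z)"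
  using c_const[of "fst p" "snd p" z] by simp

lemma mark_comps: "i < n \<Longrightarrow> fst (src_pts X i) \<in> comps (src X)" "j < k + b \<Longrightarrow> fst (tgt_pts X j) \<in> comps (tgt X)"
  using adm_unfold(1,2) by (auto simp: pointed_curve_def stable_curve_def points_def)

text \<open>Every bad mark costs the component \<open>v\<close> one of the \<open>d\<close> sheets over \<open>comp_map X v\<close>.\<close>

definition "others = {u \<in> comps (src X). comp_map X u = comp_map X v \<and> u \<noteq> v}"
definition "bad i \<longleftrightarrow> (\<exists>u\<in>others. c (u, Infty) = Pt (x i))"

lemma card_others: "card others + rdeg (rat_map X v) \<le> d" "finite others"
proof -
  let ?U = "{u \<in> comps (src X). comp_map X u = comp_map X v}"
  have fin: "finite ?U" using genus0 by (auto simp: genus0_curve_def)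
  show "finite others" unfolding others_def by (rule finite_subset[OF _ fin]) auto
  have "rdeg (rat_map X u) \<ge> 1" if "u \<in> others" for u
    using that adm_unfold(4) by (auto simp: others_def is_ratmap_def)
  hence "card others \<le> (\<Sum>u\<in>others. rdeg (rat_map X u))"
    using sum_mono[of others "\<lambda>_. 1" "\<lambda>u. rdeg (rat_map X u)"] by simp
  moreover have "?U = insert v others" using v by (auto simp: others_def)
  hence "(\<Sum>u\<in>?U. rdeg (rat_map X u)) = rdeg (rat_map X v) + (\<Sum>u\<in>others. rdeg (rat_map X u))"
    using \<open>finite others\<close> by (simp add: others_def)
  moreover have "(\<Sum>u\<in>?U. rdeg (rat_map X u)) = d" using adm_unfold(3,5) v by blast
  ultimately show "card others + rdeg (rat_map X v) \<le> d" by linarith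
qed

text \<open>Different bad marks need different members of \<open>others\<close>, since
  \<open>c\<close> contracts each of these to a single point.\<close>

lemma card_bad: "card {i. i < n \<and> bad i} + rdeg (rat_map X v) \<le> d"
proof -
  let ?B = "{i. i < n \<and> bad i}"
  have "\<forall>i\<in>?B. \<exists>u. u \<in> others \<and> c (u, Infty) = Pt (x i)" by (auto simp: bad_def)
  from bchoice[OF this] obtain g where g: "\<forall>i\<in>?B. g i \<in> others \<and> c (g i, Infty) = Pt (x i)" ..
  have "inj_on g ?B"
  proof (rule inj_onI)
    fix i j assume i: "i \<in> ?B" and j: "j \<in> ?B" and "g i = g j"
    hence "Pt (x i) = Pt (x j)" using g by metis
    thus "i = j" using inj_x i j by (auto dest: inj_onD)
  qed
  hence "card ?B \<le> card others" using g card_others(2) by (intro card_inj_on_le) auto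
  thus ?thesis using card_others(1) by linarith
qed

definition "ci = inv_into UNIV (\<lambda>z. c (v, z))"

lemma ci: "moebius ci" "c (v, ci z) = z" "ci (c (v, z)) = z"
  using moebius_inv[OF c_moebius] moebius_bij[OF c_moebius]
    surj_f_inv_f[of "\<lambda>z. c (v, z)" z] inv_into_f_f[of "\<lambda>z. c (v, z)" UNIV z]
  by (auto simp: ci_def bij_def)

lemma ei: "\<exists>z'. e (w, z') = z"
  using moebius_bij[OF e_moebius] by (metis bij_pointE)

text \<open>If the distinguished component of the source did not lie over that of the target, then more
  than \<open>rdeg (rat_map X v)\<close> points of \<open>v\<close> would be mapped to the point where \<open>comp_map X v\<close> is
  attached towards \<open>w\<close>.\<close>

lemma comp_map_v: "comp_map X v = w"
proof (rule ccontr)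
  define w' where "w' = comp_map X v"
  assume "comp_map X v \<noteq> w"
  hence w': "w' \<in> comps (tgt X) - {w}" using adm_unfold(3)[OF v] by (auto simp: w'_def)
  obtain height a a' where rt: "rooted_tree (tgt X) w height a a'" using genus0_rooted_tree[OF genus0(2) w] .
  note t = rooted_treeD[OF rt]
  define E where "E = {(u, fst (a' u)) | u. u \<in> comps (tgt X) - {w}}"
  \<comment> \<open>The proper descendants of \<open>w'\<close> in the tree rooted at
    \<open>w\<close>. Together with \<open>w'\<close> they form a branch that \<open>e\<close>
    contracts to one point.\<close>
  define Desc where "Desc = {u. (u, w') \<in> E\<^sup>+}"
  have E_e: "e (u, Infty) = e (u', Infty)" if "(u, u') \<in> E" "u' \<noteq> w" for u u'
  proof -
    have u: "u \<in> comps (tgt X) - {w}" "u' = fst (a' u)" using that by (auto simp: E_def)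
    have "e (u, Infty) = e (a u)" using e_const'[of "a u" Infty] t(2)[OF u(1)] u by simp
    also have "\<dots> = e (a' u)" using e_node t(1)[OF u(1)] by blast
    also have "\<dots> = e (u', Infty)"
      using e_const'[of "a' u" Infty] node_in_points(4)[OF genus0(2) t(1)[OF u(1)]] u that by simp
    finally show ?thesis .
  qed
  have Desc: "u \<in> comps (tgt X) - {w} \<and> e (u, Infty) = e (w', Infty)" if "u \<in> Desc" for u
  proof -
    have "(u, w') \<in> E\<^sup>+" using that by (simp add: Desc_def)
    thus ?thesis
    proof (induction rule: converse_trancl_induct)
      case (base u)
      thus ?case using E_e[of u w'] w' by (auto simp: E_def)
    next
      case (step u u')
      thus ?case using E_e[of u u'] by (auto simp: E_def)
    qed
  qed
  \<comment> \<open>From outside, this branch can only be entered at the point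
    \<open>a w'\<close>.\<close>
  have Desc_node: "fst q \<notin> Desc \<and> (fst q = w' \<longrightarrow> q = a w')"
    if pq: "{p, q} \<in> nodes (tgt X)" and p: "fst p \<notin> Desc" "fst p \<noteq> w'" for p q
  proof -
    obtain u where u: "u \<in> comps (tgt X) - {w}" "p = a u \<and> q = a' u \<or> p = a' u \<and> q = a u"
      using t(4)[OF pq] by blast
    have uE: "(u, fst (a' u)) \<in> E" using u by (auto simp: E_def)
    from u(2) show ?thesis
    proof
      assume q: "p = a u \<and> q = a' u"
      hence "u \<notin> Desc" using p t(2)[OF u(1)] by simp
      hence "fst q \<noteq> w'" "(fst q, w') \<notin> E\<^sup>+" using uE q by (auto simp: Desc_def intro: trancl_into_trancl2)
      thus ?thesis by (auto simp: Desc_def)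
    next
      assume q: "p = a' u \<and> q = a u"
      hence fq: "fst q = u" using t(2)[OF u(1)] by simp
      have "u \<notin> Desc"
      proof
        assume "u \<in> Desc"
        hence "(u, w') \<in> E\<^sup>+" by (simp add: Desc_def)
        then obtain z where z: "(u, z) \<in> E" "(z, w') \<in> E\<^sup>*" by (meson tranclD)
        hence "z = fst p" using q by (auto simp: E_def)
        thus False using z(2) p by (auto simp: Desc_def rtrancl_eq_or_trancl)
      qed
      thus ?thesis using fq q by auto
    qed
  qed
  \<comment> \<open>The marks whose value differs from the point to which the branch is contracted;
    they lie over components outside it.\<close>
  define J where "J = {i. i < n \<and> Pt (y (hh i)) \<noteq> e (w', Infty)}"
  have eq_mark: "e (tgt_pts X (hh i)) = Pt (y (hh i))" if "i < n" for i
    using e_mark prof(1) that by blast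
  \<comment> \<open>On the way from the mark to \<open>v\<close> every component is contracted to
    \<open>Pt (x i)\<close>. As the mark is not bad, none of them lies over \<open>w'\<close>, so
    the image stays outside the branch until the way reaches \<open>v\<close>, and there it enters
    at \<open>a w'\<close>.\<close>
  have hit: "cover_map X (v, ci (Pt (x i))) = a w'" if i: "i \<in> J" "\<not> bad i" for i
  proof -
    have iN: "i < n" using i by (simp add: J_def)
    let ?u = "fst (src_pts X i)"
    have fq: "comp_map X ?u = fst (tgt_pts X (hh i))"
      using adm_unfold(8)[OF iN] by (auto simp: cover_map_def dest: arg_cong[of _ _ fst])
    have hk: "hh i < k + b" using prof(1)[OF iN] by simp
    have not: "fst (tgt_pts X (hh i)) \<noteq> w' \<and> fst (tgt_pts X (hh i)) \<notin> Desc"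
    proof (rule ccontr)
      assume H: "\<not> ?thesis"
      hence "fst (tgt_pts X (hh i)) \<noteq> w \<and> e (fst (tgt_pts X (hh i)), Infty) = e (w', Infty)"
        using Desc w' by auto
      hence "e (tgt_pts X (hh i)) = e (w', Infty)"
        using e_const'[OF mark_comps(2)[OF hk], of Infty] by simp
      thus False using eq_mark[OF iN] i by (simp add: J_def)
    qed
    have uv: "?u \<noteq> v" using not fq by (auto simp: w'_def)
    define P where "P u \<longleftrightarrow> u \<in> comps (src X) \<and> u \<noteq> v \<and> c (u, Infty) = Pt (x i) \<and>
      comp_map X u \<noteq> w' \<and> comp_map X u \<notin> Desc" for u
    have Pu: "P ?u"
      using mark_comps(1)[OF iN] uv not fq c_const'[of "src_pts X i" Infty] c_mark[OF iN]
      by (auto simp: P_def)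
    have reach: "(?u, v) \<in> (adjacency (src X))\<^sup>*"
      using genus0(1) mark_comps(1)[OF iN] v by (auto simp: genus0_curve_def)
    have step: "P (fst q)" if pq: "{p, q} \<in> nodes (src X)" and Pp: "P (fst p)" and qv: "fst q \<noteq> v" for p q
    proof -
      have q: "fst q \<in> comps (src X)" using node_in_points[OF genus0(1) pq] by blast
      have "c q = Pt (x i)" using c_node[OF pq] Pp c_const'[of p Infty] by (auto simp: P_def)
      hence cq: "c (fst q, Infty) = Pt (x i)" using c_const'[OF q qv, of Infty] by simp
      hence "comp_map X (fst q) \<noteq> w'" using i(2) q qv by (auto simp: bad_def others_def w'_def)
      moreover have "comp_map X (fst q) \<notin> Desc"
        using Desc_node[OF adm_unfold(7)[OF pq]] Pp by (auto simp: P_def cover_map_def)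
      ultimately show ?thesis using q qv cq by (simp add: P_def)
    qed
    obtain p q where pq: "{p, q} \<in> nodes (src X)" "P (fst p)" "fst q = v"
      using reach_component[of ?u v "src X" P, OF reach uv Pu] step by blast
    have "c q = Pt (x i)" using c_node[OF pq(1)] pq(2) c_const'[of p Infty] by (auto simp: P_def)
    hence "q = (v, ci (Pt (x i)))" using ci(3)[of "snd q"] pq(3) by (cases q) auto
    moreover have "cover_map X q = a w'"
      using Desc_node[OF adm_unfold(7)[OF pq(1)]] pq by (auto simp: P_def cover_map_def w'_def)
    ultimately show ?thesis by simp
  qed
  have finN: "finite {i. i < n \<and> Q i}" for Q by simp
  \<comment> \<open>The values \<open>y\<close> are distinct, so all marks outside \<open>J\<close>
    belong to one index \<open>h\<close>.\<close>
  have "card {i. i < n \<and> i \<notin> J} \<le> d"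
  proof (cases "\<exists>i<n. i \<notin> J")
    case True
    then obtain i0 where i0: "i0 < n" "i0 \<notin> J" by blast
    have "hh i = hh i0" if "i < n" "i \<notin> J" for i
    proof -
      have "Pt (y (hh i)) = e (w', Infty)" "Pt (y (hh i0)) = e (w', Infty)"
        using that i0 by (auto simp: J_def)
      hence "y (hh i) = y (hh i0)" by (metis proj1.inject)
      thus ?thesis using inj_y prof(1) that i0 by (auto dest: inj_onD)
    qed
    hence "card {i. i < n \<and> i \<notin> J} \<le> card {i. i < n \<and> hh i = hh i0}"
      by (intro card_mono) auto
    thus ?thesis by (rule order_trans[OF _ card_class])
  next
    case False
    hence "{i. i < n \<and> i \<notin> J} = {}" by auto
    thus ?thesis by (simp only: card.empty)
  qed
  moreover have "n = card {i. i < n \<and> i \<notin> J} + card {i. i < n \<and> i \<in> J}"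
  proof -
    have "{..<n} = {i. i < n \<and> i \<notin> J} \<union> {i. i < n \<and> i \<in> J}" by auto
    hence "card {..<n} = card {i. i < n \<and> i \<notin> J} + card {i. i < n \<and> i \<in> J}"
      by (simp only:) (rule card_Un_disjoint, auto)
    thus ?thesis by simp
  qed
  moreover have "card {i. i < n \<and> i \<in> J} \<le> card {i. i < n \<and> bad i} + card {i. i \<in> J \<and> \<not> bad i}"
  proof -
    have "{i. i < n \<and> i \<in> J} \<subseteq> {i. i < n \<and> bad i} \<union> {i. i \<in> J \<and> \<not> bad i}" by (auto simp: J_def)
    hence "card {i. i < n \<and> i \<in> J} \<le> card ({i. i < n \<and> bad i} \<union> {i. i \<in> J \<and> \<not> bad i})"
      by (intro card_mono) (auto simp: J_def)
    thus ?thesis by (rule order_trans[OF _ card_Un_le])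
  qed
  moreover have "card {i. i \<in> J \<and> \<not> bad i} \<le> rdeg (rat_map X v)"
  proof -
    let ?G = "{i. i \<in> J \<and> \<not> bad i}" and ?Z = "{z. reval (rat_map X v) z = snd (a w')}"
    have "inj_on (\<lambda>i. ci (Pt (x i))) ?G"
    proof (rule inj_onI)
      fix i j assume ij: "i \<in> ?G" "j \<in> ?G" "ci (Pt (x i)) = ci (Pt (x j))"
      hence "Pt (x i) = Pt (x j)" by (metis ci(2))
      thus "i = j" using inj_x ij by (auto simp: J_def dest: inj_onD)
    qed
    moreover have "(\<lambda>i. ci (Pt (x i))) ` ?G \<subseteq> ?Z"
    proof safe
      fix i assume "i \<in> J" "\<not> bad i"
      from hit[OF this] show "reval (rat_map X v) (ci (Pt (x i))) = snd (a w')"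
        by (auto simp: cover_map_def dest: arg_cong[of _ _ snd])
    qed
    ultimately have "card ?G \<le> card ?Z"
      using fibre_finite_card(1)[OF adm_unfold(4)[OF v]] by (intro card_inj_on_le)
    thus ?thesis by (rule order_trans[OF _ fibre_finite_card(2)[OF adm_unfold(4)[OF v]]])
  qed
  \<comment> \<open>Outside \<open>J\<close> there are at most \<open>d\<close> marks, and the bad
    ones together with those in one fibre of \<open>v\<close> number at most \<open>d\<close>; but
    \<open>n = 2 * d + 1\<close>.\<close>
  ultimately show False using card_bad n by linarith
qed

text \<open>Unless the mark lies on \<open>v\<close>, the components between it and \<open>v\<close>
  are contracted by \<open>c\<close> to \<open>Pt (x i)\<close>. As the mark is not bad, none of
  them lies over \<open>w\<close>, so \<open>e\<close> is constant along the image of this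
  path.\<close>

lemma good_mark:
  assumes iN: "i < n" and nb: "\<not> bad i"
  shows "e (w, reval (rat_map X v) (ci (Pt (x i)))) = Pt (y (hh i))"
proof -
  let ?u = "fst (src_pts X i)"
  have e1: "e (cover_map X (src_pts X i)) = Pt (y (hh i))"
    using adm_unfold(8)[OF iN] e_mark prof(1)[OF iN] by simp
  have cm: "cover_map X (v, z) = (w, reval (rat_map X v) z)" for z
    using comp_map_v by (simp add: cover_map_def)
  show ?thesis
  proof (cases "?u = v")
    case True
    hence "src_pts X i = (v, ci (Pt (x i)))"
      using ci(3)[of "snd (src_pts X i)"] c_mark[OF iN] by (cases "src_pts X i") auto
    thus ?thesis using e1 cm by simp
  next
    case False
    define P where "P u \<longleftrightarrow> u \<in> comps (src X) \<and> u \<noteq> v \<and> c (u, Infty) = Pt (x i) \<and>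
      comp_map X u \<noteq> w \<and> e (comp_map X u, Infty) = Pt (y (hh i))" for u
    have ec: "e (cover_map X p) = e (comp_map X (fst p), Infty)"
      if "fst p \<in> comps (src X)" "comp_map X (fst p) \<noteq> w" for p
      using e_const'[of "cover_map X p" Infty] adm_unfold(3)[OF that(1)] that(2)
      by (simp add: cover_map_def)
    have uc: "?u \<in> comps (src X)" by (rule mark_comps(1)[OF iN])
    have cu: "c (?u, Infty) = Pt (x i)" using c_const'[OF uc False, of Infty] c_mark[OF iN] by simp
    have notw: "comp_map X u \<noteq> w" if "u \<in> comps (src X)" "u \<noteq> v" "c (u, Infty) = Pt (x i)" for u
      using nb that comp_map_v by (auto simp: bad_def others_def)
    have Pu: "P ?u" using uc False cu notw[OF uc False cu] ec[OF uc] e1 by (simp add: P_def)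
    have reach: "(?u, v) \<in> (adjacency (src X))\<^sup>*"
      using genus0(1) uc v by (auto simp: genus0_curve_def)
    have ep: "e (cover_map X p) = Pt (y (hh i)) \<and> c p = Pt (x i)" if "P (fst p)" for p
      using ec[of p] c_const'[of p Infty] that by (auto simp: P_def)
    have step: "P (fst q)" if pq: "{p, q} \<in> nodes (src X)" and Pp: "P (fst p)" and qv: "fst q \<noteq> v" for p q
    proof -
      have q: "fst q \<in> comps (src X)" using node_in_points[OF genus0(1) pq] by blast
      have "c q = Pt (x i)" using c_node[OF pq] ep[OF Pp] by simp
      hence cq: "c (fst q, Infty) = Pt (x i)" using c_const'[OF q qv, of Infty] by simp
      have nw: "comp_map X (fst q) \<noteq> w" by (rule notw[OF q qv cq])
      have "e (cover_map X q) = Pt (y (hh i))" using e_node[OF adm_unfold(7)[OF pq]] ep[OF Pp] by simp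
      thus ?thesis using q qv cq nw ec[OF q nw] by (simp add: P_def)
    qed
    obtain p q where pq: "{p, q} \<in> nodes (src X)" "P (fst p)" "fst q = v"
      using reach_component[of ?u v "src X" P, OF reach False Pu] step by blast
    have "c q = Pt (x i)" using c_node[OF pq(1)] ep[OF pq(2)] by simp
    hence "q = (v, ci (Pt (x i)))" using ci(3)[of "snd q"] pq(3) by (cases q) auto
    moreover have "e (cover_map X q) = Pt (y (hh i))"
      using e_node[OF adm_unfold(7)[OF pq(1)]] ep[OF pq(2)] by simp
    ultimately show ?thesis using cm by simp
  qed
qed

text \<open>By \<open>card_bad\<close> at least \<open>d + rdeg (rat_map X v) + 1\<close> marks are
  good, one more than two different maps of these degrees can have in common. Agreement then also
  gives the degree.\<close>

lemma map_eq_R0: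
  "e (w, reval (rat_map X v) z) = reval R0 (c (v, z))" "rdeg (rat_map X v) = d"
proof -
  let ?R = "rat_map X v"
  obtain S1 where S1: "is_ratmap S1" "rdeg S1 = rdeg ?R" "reval S1 = reval ?R \<circ> ci"
    using ratmap_comp_moebius[OF adm_unfold(4)[OF v] ci(1)] by blast
  obtain S where S: "is_ratmap S" "rdeg S = rdeg ?R" "reval S = (\<lambda>z. e (w, z)) \<circ> reval S1"
    using moebius_comp_ratmap[OF S1(1) e_moebius] S1(2) by metis
  let ?I = "{i. i < n \<and> \<not> bad i}"
  have "{..<n} = {i. i < n \<and> bad i} \<union> ?I" by auto
  hence "card {..<n} = card {i. i < n \<and> bad i} + card ?I"
    by (simp only:) (rule card_Un_disjoint, auto)
  hence cI: "card ?I > rdeg S + d" using card_bad n S(2) by simp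
  have "inj_on (\<lambda>i. Pt (x i)) ?I" using inj_x by (auto simp: inj_on_def)
  hence "card ((\<lambda>i. Pt (x i)) ` ?I) > rdeg S + rdeg R0" using cI R0 by (simp add: card_image)
  moreover have "reval S q = reval R0 q" if q: "q \<in> (\<lambda>i. Pt (x i)) ` ?I" for q
  proof -
    obtain i where i: "i < n" "\<not> bad i" "q = Pt (x i)" using q by auto
    thus ?thesis using good_mark[OF i(1,2)] R0_marks[OF i(1)] by (simp add: S(3) S1(3))
  qed
  ultimately have eq: "reval S = reval R0" "rdeg S = rdeg R0"
    using ratmaps_agree[OF S(1) R0(1), of "(\<lambda>i. Pt (x i)) ` ?I"] by auto
  show "rdeg (rat_map X v) = d" using eq(2) S(2) R0(2) by simp
  have "reval S (c (v, z)) = reval R0 (c (v, z))" using eq(1) by simp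
  thus "e (w, reval (rat_map X v) z) = reval R0 (c (v, z))" by (simp add: S(3) S1(3) ci)
qed

text \<open>\<open>v\<close> already takes up all \<open>d\<close> sheets over
  \<open>w\<close>.\<close>

lemma others_empty: "u \<in> comps (src X) \<Longrightarrow> comp_map X u = w \<Longrightarrow> u = v"
  using card_others map_eq_R0(2) comp_map_v by (auto simp: others_def)

text \<open>Over a branch value \<open>v\<close> has a ramified point. If it is smooth,
  admissibility permits it only over one of the last \<open>b\<close> marked points of the
  target.\<close>

lemma V_marks: "V \<subseteq> (\<lambda>t. e (tgt_pts X (k + t))) ` {..<b}"
proof
  fix q assume q: "q \<in> V"
  obtain q' where q': "e (w, q') = q" using ei by blast
  have e_inj: "e (w, z) = e (w, z') \<Longrightarrow> z = z'" for z z'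
    using moebius_bij[OF e_moebius] by (auto dest: bij_is_inj injD)
  let ?R = "rat_map X v"
  have "{z. reval ?R z = q'} = ci ` {z. reval R0 z = q}"
  proof (rule Set.set_eqI)
    fix z
    have "reval ?R z = q' \<longleftrightarrow> e (w, reval ?R z) = q" using e_inj q' by auto
    also have "\<dots> \<longleftrightarrow> reval R0 (c (v, z)) = q" by (simp add: map_eq_R0)
    also have "\<dots> \<longleftrightarrow> z \<in> ci ` {z. reval R0 z = q}"
      using ci(2,3) by (auto simp: image_iff intro: exI[of _ "c (v, z)"])
    finally show "z \<in> {z. reval ?R z = q'} \<longleftrightarrow> z \<in> ci ` {z. reval R0 z = q}" by simp
  qed
  hence "card {z. reval ?R z = q'} < d"
    using card_image_le[OF fibre_finite_card(1)[OF R0(1)], of ci q] card_V_fibre[OF q] by simp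
  \<comment> \<open>An unramified fibre would have \<open>d\<close> points.\<close>
  then obtain z where z: "reval ?R z = q'" "ram_index ?R z \<noteq> 1"
    using unramified_fibre_card[OF adm_unfold(4)[OF v], of q'] map_eq_R0(2) by force
  have cm: "cover_map X (v, z) = (w, q')" using z comp_map_v by (simp add: cover_map_def)
  have pt: "(v, z) \<in> points (src X)" using v by (simp add: points_def)
  have rz: "ram X (v, z) \<noteq> 1" using z by (simp add: ram_def)
  show "q \<in> (\<lambda>t. e (tgt_pts X (k + t))) ` {..<b}"
  proof (cases "(v, z) \<in> sing (src X)")
    case False
    have "(v, z) \<notin> src_pts X ` {..<n}" using adm_unfold(9) rz by auto
    then obtain t where "t < b" "cover_map X (v, z) = tgt_pts X (k + t)"
      using adm_unfold(10)[of "(v, z)"] pt False rz by auto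
    thus ?thesis using cm q' by (intro image_eqI[of _ _ t]) auto
  next
    case True
    \<comment> \<open>The branch of the target attached at this node is contracted to
      \<open>q\<close> and carries a marked point, which is none of the first \<open>k\<close>
      because their values avoid \<open>V\<close>.\<close>
    hence "(w, q') \<in> sing (tgt X)" using adm_unfold(6)[OF pt] cm by simp
    from node_obtain[OF genus0(2) this] obtain p where p: "{(w, q'), p} \<in> nodes (tgt X)" .
    obtain height a a' where rt: "rooted_tree (tgt X) w height a a'" using genus0_rooted_tree[OF genus0(2) w] .
    note t = rooted_treeD[OF rt]
    obtain u where u: "u \<in> comps (tgt X) - {w}" "(w, q') = a u \<and> p = a' u \<or> (w, q') = a' u \<and> p = a u"
      using t(4)[OF p] by blast
    hence pu: "p = a u" using t(2)[OF u(1)] by (metis DiffD2 fst_conv singletonI)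
    have "e (u, Infty) = e p" using e_const'[of p Infty] pu u t(2)[OF u(1)] by simp
    also have "\<dots> = q" using e_node[OF p] q' by simp
    finally have eu: "e (u, Infty) = q" .
    obtain i where i: "i < k + b" "e (tgt_pts X i) = q"
      using stable_two_marks[OF adm_unfold(2) w, of e u] e_const e_node u(1) eu by metis
    hence "\<not> i < k" using e_mark V(2) q by metis
    thus ?thesis using i by (intro image_eqI[of _ _ "i - k"]) auto
  qed
qed

text \<open>There are only as many labels as elements of \<open>V\<close>, so covering
  \<open>V\<close> leaves no repetition and no label to spare.\<close>

lemma branch_marks_bij: "bij_betw (\<lambda>t. e (tgt_pts X (k + t))) {..<b} V"
proof -
  let ?f = "\<lambda>t. e (tgt_pts X (k + t))"
  have le: "card (?f ` {..<b}) \<le> b" using card_image_le[of "{..<b}" ?f] by simp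
  hence "V = ?f ` {..<b}" using V_marks by (intro card_seteq) auto
  moreover from this have "inj_on ?f {..<b}" by (intro eq_card_imp_inj_on) auto
  ultimately show ?thesis by (simp add: bij_betw_def)
qed

text \<open>All \<open>k + b\<close> marked points have different images under \<open>e\<close>,
  whereas a second component would yield two with the same image.\<close>

lemma target_smooth: "comps (tgt X) = {w}" "nodes (tgt X) = {}"
proof -
  have "u = w" if "u \<in> comps (tgt X)" for u
  proof (rule ccontr)
    assume "u \<noteq> w"
    hence u: "u \<in> comps (tgt X) - {w}" using that by simp
    obtain i j where ij: "i < k + b" "j < k + b" "i \<noteq> j" "e (tgt_pts X i) = e (tgt_pts X j)"
      using stable_two_marks[OF adm_unfold(2) w, of e u] e_const e_node u by metis
    have inV: "e (tgt_pts X i) \<in> V" if "k \<le> i" "i < k + b" for i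
      using bij_betwE[OF branch_marks_bij] that by (auto dest: bspec[of _ _ "i - k"])
    have False if ij: "i < k + b" "j < k + b" "i < j" "e (tgt_pts X i) = e (tgt_pts X j)" for i j
    proof -
      consider "j < k" | "i < k" "k \<le> j" | "k \<le> i" "k \<le> j" by linarith
      thus False
      proof cases
        case 1
        hence "y i = y j" using ij e_mark[of i] e_mark[of j] by simp
        thus False using inj_y ij 1 by (auto dest: inj_onD)
      next
        case 2
        thus False using inV[of j] ij e_mark[of i] V(2)[of i] by simp
      next
        case 3
        hence "i - k = j - k" using ij
          by (intro inj_onD[OF bij_betw_imp_inj_on[OF branch_marks_bij]]) auto
        thus False using 3 ij by simp
      qed
    qed
    thus False using ij by (metis linorder_neqE_nat)
  qed
  thus "comps (tgt X) = {w}" using w by blast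
  thus "nodes (tgt X) = {}" by (rule single_component_smooth[OF genus0(2)])
qed

lemma source_smooth: "comps (src X) = {v}" "nodes (src X) = {}"
proof -
  have "u = v" if "u \<in> comps (src X)" for u
    using others_empty[OF that] adm_unfold(3)[OF that] target_smooth(1) by simp
  thus "comps (src X) = {v}" using v by blast
  thus "nodes (src X) = {}" by (rule single_component_smooth[OF genus0(1)])
qed

end

section \<open>Isomorphism classes in a fibre\<close>

lemma quotient_by_function:
  fixes F :: "'a set" and f :: "'a \<Rightarrow> 'b"
  defines "r \<equiv> {(X, Y). X \<in> F \<and> Y \<in> F \<and> f X = f Y}"
  shows "bij_betw (\<lambda>s. {X \<in> F. f X = s}) (f ` F) (F // r)"
  unfolding bij_betw_def
proof
  show "inj_on (\<lambda>s. {X \<in> F. f X = s}) (f ` F)" by (rule inj_onI) blast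
  have cl: "r `` {X} = {Y \<in> F. f Y = f X}" if "X \<in> F" for X using that by (auto simp: r_def)
  show "(\<lambda>s. {X \<in> F. f X = s}) ` f ` F = F // r"
    by (auto simp: quotient_def cl)
qed

context branch_data
begin

text \<open>\<open>c\<close> and \<open>e\<close> identify the single components of source and target with the projective line so
  that the cover becomes \<open>R0\<close>.\<close>

definition smooth_model :: "cover \<Rightarrow> nat \<Rightarrow> nat \<Rightarrow> (proj1 \<Rightarrow> proj1) \<Rightarrow> (proj1 \<Rightarrow> proj1) \<Rightarrow> bool" where
  "smooth_model X v w c e \<longleftrightarrow>
     comps (src X) = {v} \<and> nodes (src X) = {} \<and> comps (tgt X) = {w} \<and> nodes (tgt X) = {} \<and>
     comp_map X v = w \<and> moebius c \<and> moebius e \<and>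
     (\<forall>z. e (reval (rat_map X v) z) = reval R0 (c z)) \<and>
     (\<forall>i<n. fst (src_pts X i) = v \<and> c (snd (src_pts X i)) = Pt (x i)) \<and>
     (\<forall>h<k. e (snd (tgt_pts X h)) = Pt (y h)) \<and>
     (\<forall>j<k + b. fst (tgt_pts X j) = w) \<and>
     bij_betw (\<lambda>t. e (snd (tgt_pts X (k + t)))) {..<b} V"

lemma smooth_modelD:
  assumes "smooth_model X v w c e"
  shows "comps (src X) = {v}" "nodes (src X) = {}" "comps (tgt X) = {w}" "nodes (tgt X) = {}"
    "comp_map X v = w" "moebius c" "moebius e"
    "\<And>z. e (reval (rat_map X v) z) = reval R0 (c z)"
    "\<And>i. i < n \<Longrightarrow> fst (src_pts X i) = v" "\<And>i. i < n \<Longrightarrow> c (snd (src_pts X i)) = Pt (x i)"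
    "\<And>h. h < k \<Longrightarrow> e (snd (tgt_pts X h)) = Pt (y h)"
    "\<And>j. j < k + b \<Longrightarrow> fst (tgt_pts X j) = w"
    "bij_betw (\<lambda>t. e (snd (tgt_pts X (k + t)))) {..<b} V"
  using assms unfolding smooth_model_def by blast+

abbreviation "F \<equiv> fibre d b \<mu>s x y"

lemma fibre_smooth_model:
  assumes "X \<in> F"
  shows "\<exists>v w c e. smooth_model X v w c e"
proof -
  have X: "admissible_cover d b \<mu>s X" "stabilizes_to n (src X) (src_pts X) x"
    "stabilizes_to k (tgt X) (tgt_pts X) y"
    using assms by (auto simp: fibre_def length_prof k(1))
  obtain c v where c: "v \<in> comps (src X)" "moebius (\<lambda>z. c (v, z))"
      "\<forall>u\<in>comps (src X) - {v}. \<forall>z z'. c (u, z) = c (u, z')"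
      "\<forall>p q. {p, q} \<in> nodes (src X) \<longrightarrow> c p = c q" "\<forall>i<n. c (src_pts X i) = Pt (x i)"
    using X(2) unfolding stabilizes_to_def by blast
  obtain e w where e: "w \<in> comps (tgt X)" "moebius (\<lambda>z. e (w, z))"
      "\<forall>u\<in>comps (tgt X) - {w}. \<forall>z z'. e (u, z) = e (u, z')"
      "\<forall>p q. {p, q} \<in> nodes (tgt X) \<longrightarrow> e p = e q" "\<forall>i<k. e (tgt_pts X i) = Pt (y i)"
    using X(3) unfolding stabilizes_to_def by blast
  interpret fibre_cover d n k \<mu>s x y R0 V X v w c e
    by unfold_locales (use X(1) c e in \<open>blast+\<close>)
  have fs: "fst (src_pts X i) = v" if "i < n" for i
    using mark_comps(1)[OF that] source_smooth by simp
  have ft: "fst (tgt_pts X j) = w" if "j < k + b" for j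
    using mark_comps(2)[OF that] target_smooth by simp
  have es: "e (tgt_pts X j) = e (w, snd (tgt_pts X j))" if "j < k + b" for j
    using ft[OF that] by (cases "tgt_pts X j") simp
  have cs: "c (src_pts X i) = c (v, snd (src_pts X i))" if "i < n" for i
    using fs[OF that] by (cases "src_pts X i") simp
  have "bij_betw (\<lambda>t. e (w, snd (tgt_pts X (k + t)))) {..<b} V"
    using branch_marks_bij es by (subst bij_betw_cong[of _ _ "\<lambda>t. e (tgt_pts X (k + t))"]) auto
  hence "smooth_model X v w (\<lambda>z. c (v, z)) (\<lambda>z. e (w, z))"
    unfolding smooth_model_def
    using source_smooth target_smooth comp_map_v c(2) e(2) map_eq_R0(1) fs ft es cs c_mark e_mark
    by (simp flip: es cs)
  thus ?thesis by blast
qed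

text \<open>Read through the identifications with the projective line, an isomorphism fixes at least
  three points on source and target, so it is the identity on both.\<close>

lemma iso_unique:
  assumes X: "smooth_model X v w c e" and Y: "smooth_model Y v' w' c' e'"
    and iso: "(\<Phi>, \<Psi>) \<in> cover_isos n (k + b) X Y"
  shows "\<Phi> = restrict (\<lambda>p. (v', inv_into UNIV c' (c (snd p)))) (points (src X))"
    "\<Psi> = restrict (\<lambda>p. (w', inv_into UNIV e' (e (snd p)))) (points (tgt X))"
    "j < k + b \<Longrightarrow> e (snd (tgt_pts X j)) = e' (snd (tgt_pts Y j))"
proof -
  note XD = smooth_modelD[OF X] and YD = smooth_modelD[OF Y]
  have i: "curve_iso (src X) (src Y) \<Phi>" "curve_iso (tgt X) (tgt Y) \<Psi>"
    "\<And>i. i < n \<Longrightarrow> \<Phi> (src_pts X i) = src_pts Y i"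
    "\<And>j. j < k + b \<Longrightarrow> \<Psi> (tgt_pts X j) = tgt_pts Y j"
    using iso by (auto simp: cover_isos_def)
  obtain \<phi> where phi: "\<Phi> \<in> extensional (points (src X))" "moebius \<phi>" "\<And>z. \<Phi> (v, z) = (v', \<phi> z)"
    using i(1) XD(1) YD(1) unfolding curve_iso_def by (auto simp: bij_betw_def)
  obtain \<psi> where psi: "\<Psi> \<in> extensional (points (tgt X))" "moebius \<psi>" "\<And>z. \<Psi> (w, z) = (w', \<psi> z)"
    using i(2) XD(3) YD(3) unfolding curve_iso_def by (auto simp: bij_betw_def)
  have p: "\<phi> (snd (src_pts X i)) = snd (src_pts Y i)" if "i < n" for i
    using i(3)[OF that] phi(3)[of "snd (src_pts X i)"] XD(9)[OF that] by (metis prod.collapse snd_conv)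
  have q: "\<psi> (snd (tgt_pts X j)) = snd (tgt_pts Y j)" if "j < k + b" for j
    using i(4)[OF that] psi(3)[of "snd (tgt_pts X j)"] XD(12)[OF that] by (metis prod.collapse snd_conv)
  have c_phi: "c' \<circ> \<phi> = c"
  proof (rule moebius_agree[OF moebius_comp[OF YD(6) phi(2)] XD(6)])
    let ?Z = "(\<lambda>i. snd (src_pts X i)) ` {..<n}"
    show "finite ?Z" by simp
    have "inj_on (\<lambda>i. snd (src_pts X i)) {..<n}"
    proof (rule inj_onI)
      fix i j assume ij: "i \<in> {..<n}" "j \<in> {..<n}" "snd (src_pts X i) = snd (src_pts X j)"
      hence "Pt (x i) = Pt (x j)" using XD(10)[of i] XD(10)[of j] by auto
      thus "i = j" using inj_x ij by (auto dest: inj_onD)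
    qed
    thus "card ?Z \<ge> 3" using d n by (simp add: card_image)
    show "(c' \<circ> \<phi>) z = c z" if "z \<in> ?Z" for z
      using that p XD(10) YD(10) by auto
  qed
  have e_psi: "e' \<circ> \<psi> = e"
  proof (rule moebius_agree[OF moebius_comp[OF YD(7) psi(2)] XD(7)])
    let ?Z = "(\<lambda>i. snd (tgt_pts X i)) ` {..<k}"
    show "finite ?Z" by simp
    have "inj_on (\<lambda>i. snd (tgt_pts X i)) {..<k}"
    proof (rule inj_onI)
      fix i j assume ij: "i \<in> {..<k}" "j \<in> {..<k}" "snd (tgt_pts X i) = snd (tgt_pts X j)"
      hence "Pt (y i) = Pt (y j)" using XD(11)[of i] XD(11)[of j] by auto
      thus "i = j" using inj_y ij by (auto dest: inj_onD)
    qed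
    thus "card ?Z \<ge> 3" using k by (simp add: card_image)
    show "(e' \<circ> \<psi>) z = e z" if "z \<in> ?Z" for z
      using that q XD(11) YD(11) by auto
  qed
  have "inv_into UNIV c' (c z) = \<phi> z" for z
    using moebius_bij[OF YD(6)] by (simp flip: c_phi add: bij_is_inj inv_into_f_f)
  thus "\<Phi> = restrict (\<lambda>p. (v', inv_into UNIV c' (c (snd p)))) (points (src X))"
    using phi XD(1) by (intro extensionalityI[OF phi(1) restrict_extensional]) (auto simp: points_def)
  have "inv_into UNIV e' (e z) = \<psi> z" for z
    using moebius_bij[OF YD(7)] by (simp flip: e_psi add: bij_is_inj inv_into_f_f)
  thus "\<Psi> = restrict (\<lambda>p. (w', inv_into UNIV e' (e (snd p)))) (points (tgt X))"
    using psi XD(3) by (intro extensionalityI[OF psi(1) restrict_extensional]) (auto simp: points_def)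
  show "e (snd (tgt_pts X j)) = e' (snd (tgt_pts Y j))" if "j < k + b"
    using q[OF that] by (simp flip: e_psi)
qed

text \<open>The identifications leave only one candidate, \<open>c' \<circ> \<phi> = c\<close> and
  \<open>e' \<circ> \<psi> = e\<close>; it respects the covers because both become
  \<open>R0\<close>.\<close>

lemma iso_exists:
  assumes X: "smooth_model X v w c e" and Y: "smooth_model Y v' w' c' e'"
    and eq: "\<And>t. t < b \<Longrightarrow> e (snd (tgt_pts X (k + t))) = e' (snd (tgt_pts Y (k + t)))"
  shows "cover_isos n (k + b) X Y \<noteq> {}"
proof -
  note XD = smooth_modelD[OF X] and YD = smooth_modelD[OF Y]
  define \<phi> where "\<phi> = inv_into UNIV c' \<circ> c"
  define \<psi> where "\<psi> = inv_into UNIV e' \<circ> e"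
  have m: "moebius \<phi>" "moebius \<psi>"
    using XD(6,7) YD(6,7) by (auto simp: \<phi>_def \<psi>_def intro!: moebius_comp moebius_inv)
  have c_phi: "c' (\<phi> z) = c z" and phi_c: "c' u = c z \<Longrightarrow> \<phi> z = u" for z u
    using moebius_bij[OF YD(6)] surj_f_inv_f[of c' "c z"] inv_into_f_f[of c' UNIV u]
    by (auto simp: \<phi>_def bij_def)
  have e_psi: "e' (\<psi> z) = e z" and psi_e: "e' u = e z \<Longrightarrow> \<psi> z = u" for z u
    using moebius_bij[OF YD(7)] surj_f_inv_f[of e' "e z"] inv_into_f_f[of e' UNIV u]
    by (auto simp: \<psi>_def bij_def)
  define \<Phi> where "\<Phi> = restrict (\<lambda>p. (v', \<phi> (snd p))) (points (src X))"
  define \<Psi> where "\<Psi> = restrict (\<lambda>p. (w', \<psi> (snd p))) (points (tgt X))"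
  have Phi: "\<Phi> (v, z) = (v', \<phi> z)" for z using XD(1) by (simp add: \<Phi>_def points_def)
  have Psi: "\<Psi> (w, z) = (w', \<psi> z)" for z using XD(3) by (simp add: \<Psi>_def points_def)
  have "curve_iso (src X) (src Y) \<Phi>"
    unfolding curve_iso_def
  proof (intro conjI exI)
    show "\<Phi> \<in> extensional (points (src X))" by (simp add: \<Phi>_def)
    show "bij_betw (\<lambda>_. v') (comps (src X)) (comps (src Y))" using XD(1) YD(1) by simp
    show "\<forall>u\<in>comps (src X). moebius \<phi> \<and> (\<forall>z. \<Phi> (u, z) = (v', \<phi> z))" using XD(1) m Phi by simp
    show "(`) \<Phi> ` nodes (src X) = nodes (src Y)" using XD(2) YD(2) by simp
  qed
  moreover have "curve_iso (tgt X) (tgt Y) \<Psi>"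
    unfolding curve_iso_def
  proof (intro conjI exI)
    show "\<Psi> \<in> extensional (points (tgt X))" by (simp add: \<Psi>_def)
    show "bij_betw (\<lambda>_. w') (comps (tgt X)) (comps (tgt Y))" using XD(3) YD(3) by simp
    show "\<forall>u\<in>comps (tgt X). moebius \<psi> \<and> (\<forall>z. \<Psi> (u, z) = (w', \<psi> z))" using XD(3) m Psi by simp
    show "(`) \<Psi> ` nodes (tgt X) = nodes (tgt Y)" using XD(4) YD(4) by simp
  qed
  moreover have "\<Psi> (cover_map X p) = cover_map Y (\<Phi> p)" if "p \<in> points (src X)" for p
  proof -
    from that XD(1) obtain z where p: "p = (v, z)" by (auto simp: points_def)
    have "e' (reval (rat_map Y v') (\<phi> z)) = e (reval (rat_map X v) z)"
      using XD(8) YD(8) c_phi by simp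
    hence "\<psi> (reval (rat_map X v) z) = reval (rat_map Y v') (\<phi> z)" by (rule psi_e)
    thus ?thesis using XD(5) YD(5) by (simp add: p cover_map_def Phi Psi)
  qed
  moreover have "\<Phi> (src_pts X i) = src_pts Y i" if "i < n" for i
  proof -
    have "\<phi> (snd (src_pts X i)) = snd (src_pts Y i)" using XD(10) YD(10) that by (intro phi_c) simp
    thus ?thesis using XD(9)[OF that] YD(9)[OF that] Phi by (metis prod.collapse)
  qed
  moreover have "\<Psi> (tgt_pts X j) = tgt_pts Y j" if "j < k + b" for j
  proof -
    have "e' (snd (tgt_pts Y j)) = e (snd (tgt_pts X j))"
    proof (cases "j < k")
      case True
      thus ?thesis using XD(11) YD(11) by simp
    next
      case False
      thus ?thesis using eq[of "j - k"] that by simp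
    qed
    hence "\<psi> (snd (tgt_pts X j)) = snd (tgt_pts Y j)" by (rule psi_e)
    thus ?thesis using XD(12)[OF that] YD(12)[OF that] Psi by (metis prod.collapse)
  qed
  ultimately have "(\<Phi>, \<Psi>) \<in> cover_isos n (k + b) X Y" by (simp add: cover_isos_def)
  thus ?thesis by blast
qed

lemma card_automorphisms:
  assumes "smooth_model X v w c e"
  shows "card (cover_isos n (k + b) X X) = 1"
proof -
  obtain I where I: "I \<in> cover_isos n (k + b) X X" using iso_exists[OF assms assms] by blast
  have "J = I" if J: "J \<in> cover_isos n (k + b) X X" for J
  proof -
    have "(fst I, snd I) \<in> cover_isos n (k + b) X X" "(fst J, snd J) \<in> cover_isos n (k + b) X X"
      using I J by simp_all
    note u = iso_unique(1,2)[OF assms assms this(1)] iso_unique(1,2)[OF assms assms this(2)]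
    show ?thesis by (rule prod_eqI; simp only: u)
  qed
  hence "cover_isos n (k + b) X X = {I}" using I by blast
  thus ?thesis by simp
qed

definition "labelings = {\<sigma> \<in> {..<b} \<rightarrow>\<^sub>E V. inj_on \<sigma> {..<b}}"

lemma card_labelings: "card labelings = fact b" "finite labelings"
proof -
  have "card labelings = b ^ 0 * prod ((-) b) {0..<b}"
    unfolding labelings_def using V(1) card_inj_on_subset_funcset[of "{..<b}" V "{..<b}"] by simp
  also have "\<dots> = fact b" by (simp add: fact_prod_rev)
  finally show "card labelings = fact b" .
  thus "finite labelings" by (metis card.infinite fact_nonzero)
qed

lemma labelings_bij: "\<sigma> \<in> labelings \<Longrightarrow> bij_betw \<sigma> {..<b} V"
  using V(1) card_image[of \<sigma> "{..<b}"] card_subset_eq[of V "\<sigma> ` {..<b}"]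
  by (auto simp: labelings_def bij_betw_def)

definition std_cover :: "(nat \<Rightarrow> proj1) \<Rightarrow> cover" where
  "std_cover \<sigma> = \<lparr>src = \<lparr>comps = {0}, nodes = {}\<rparr>, src_pts = (\<lambda>i. (0, Pt (x i))),
     tgt = \<lparr>comps = {0}, nodes = {}\<rparr>,
     tgt_pts = (\<lambda>j. (0, if j < k then Pt (y j) else \<sigma> (j - k))),
     comp_map = (\<lambda>_. 0), rat_map = (\<lambda>_. R0)\<rparr>"

lemma std_cover_sel [simp]:
  "src (std_cover \<sigma>) = \<lparr>comps = {0}, nodes = {}\<rparr>" "src_pts (std_cover \<sigma>) = (\<lambda>i. (0, Pt (x i)))"
  "tgt (std_cover \<sigma>) = \<lparr>comps = {0}, nodes = {}\<rparr>"
  "tgt_pts (std_cover \<sigma>) = (\<lambda>j. (0, if j < k then Pt (y j) else \<sigma> (j - k)))"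
  "comp_map (std_cover \<sigma>) = (\<lambda>_. 0)" "rat_map (std_cover \<sigma>) = (\<lambda>_. R0)"
  by (simp_all add: std_cover_def)

lemma genus0_line: "genus0_curve \<lparr>comps = {0}, nodes = {}\<rparr>"
  by (simp add: genus0_curve_def arithmetic_genus_def disjoint_def)

lemma std_cover_fibre:
  assumes "bij_betw \<sigma> {..<b} V"
  shows "std_cover \<sigma> \<in> F" "smooth_model (std_cover \<sigma>) 0 0 id id"
proof -
  let ?L = "\<lparr>comps = {0}, nodes = {}\<rparr> :: nodal_curve"
  let ?q = "\<lambda>j. (0, if j < k then Pt (y j) else \<sigma> (j - k)) :: point"
  have sing: "sing ?L = {}" by (simp add: sing_def)
  have pts: "points ?L = {0} \<times> UNIV" by (simp add: points_def)
  have sV: "\<sigma> t \<in> V" if "t < b" for t using bij_betwE[OF assms] that by auto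
  have inj_q: "inj_on ?q {..<k + b}"
  proof (rule inj_onI)
    fix i j assume ij: "i \<in> {..<k + b}" "j \<in> {..<k + b}" "?q i = ?q j"
    show "i = j"
    proof (cases "i < k")
      case True
      show ?thesis
      proof (cases "j < k")
        case True
        thus ?thesis using \<open>i < k\<close> ij inj_y by (auto dest: inj_onD)
      next
        case False
        hence "j - k < b" using ij by auto
        thus ?thesis using True False ij sV[of "j - k"] V(2)[of i] by auto
      qed
    next
      case False
      hence i: "i - k < b" using ij by auto
      show ?thesis
      proof (cases "j < k")
        case True
        thus ?thesis using False i ij sV[of "i - k"] V(2)[of j] by auto
      next
        case jk: False
        hence "j - k < b" using ij by auto
        hence "i - k = j - k"
          using i ij False jk by (intro inj_onD[OF bij_betw_imp_inj_on[OF assms]]) auto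
        thus ?thesis using False jk by simp
      qed
    qed
  qed
  have "inj_on (\<lambda>i. (0, Pt (x i)) :: point) {..<n}" using inj_x by (auto simp: inj_on_def)
  hence ps: "pointed_curve n ?L (\<lambda>i. (0, Pt (x i)))"
    by (auto simp: pointed_curve_def genus0_line sing pts)
  have pt: "pointed_curve (k + b) ?L ?q"
    using inj_q by (auto simp: pointed_curve_def genus0_line sing pts)
  have "{a \<in> ?q ` {..<k + b} \<union> sing ?L. fst a = 0} = ?q ` {..<k + b}" by (auto simp: sing)
  hence "card {a \<in> ?q ` {..<k + b} \<union> sing ?L. fst a = 0} = k + b" using inj_q by (simp only: card_image) simp
  hence st: "stable_curve (k + b) ?L ?q" using pt k by (simp add: stable_curve_def)
  have cm: "cover_map (std_cover \<sigma>) p = (0, reval R0 (snd p))" for p by (simp add: cover_map_def)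
  have rm: "ram (std_cover \<sigma>) p = ram_index R0 (snd p)" for p by (simp add: ram_def)
  have m1: "cover_map (std_cover \<sigma>) (0, Pt (x i)) = ?q (hh i) \<and> ram (std_cover \<sigma>) (0, Pt (x i)) = 1" if "i < n" for i
    using R0_marks[OF that] unramified[of "Pt (x i)"] V(2)[OF prof(1)[OF that]] prof(1)[OF that]
    by (simp add: cm rm)
  have m2: "\<exists>!p. p \<in> points ?L - sing ?L \<and> cover_map (std_cover \<sigma>) p = ?q (k + t) \<and> ram (std_cover \<sigma>) p = 2"
    if "t < b" for t
  proof -
    from simply_ramified(2)[OF sV[OF that]] obtain z where z: "reval R0 z = \<sigma> t" "ram_index R0 z = 2"
      "\<And>z'. reval R0 z' = \<sigma> t \<Longrightarrow> ram_index R0 z' = 2 \<Longrightarrow> z' = z"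
      by blast
    show ?thesis
    proof (rule ex1I[of _ "(0, z)"])
      show "(0, z) \<in> points ?L - sing ?L \<and> cover_map (std_cover \<sigma>) (0, z) = ?q (k + t) \<and>
          ram (std_cover \<sigma>) (0, z) = 2"
        using z(1,2) by (simp add: cm rm sing pts)
      fix p assume p: "p \<in> points ?L - sing ?L \<and> cover_map (std_cover \<sigma>) p = ?q (k + t) \<and>
          ram (std_cover \<sigma>) p = 2"
      hence "snd p = z" by (intro z(3)) (simp_all add: cm rm)
      moreover have "fst p = 0" using p by (auto simp: pts)
      ultimately show "p = (0, z)" by (simp add: prod_eq_iff)
    qed
  qed
  have m3: "ram (std_cover \<sigma>) p = 1 \<or>
      (\<exists>t<b. cover_map (std_cover \<sigma>) p = ?q (k + t) \<and> ram (std_cover \<sigma>) p = 2)" for p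
  proof (cases "ram (std_cover \<sigma>) p = 1")
    case False
    hence "reval R0 (snd p) \<in> V" using unramified by (auto simp: rm)
    hence "reval R0 (snd p) \<in> \<sigma> ` {..<b}" unfolding bij_betw_imp_surj_on[OF assms] .
    then obtain t where "t < b" "reval R0 (snd p) = \<sigma> t" by auto
    thus ?thesis using False simply_ramified(1)[of "snd p"] by (auto simp: cm rm intro!: exI[of _ t])
  qed simp
  have adm: "admissible_cover d b \<mu>s (std_cover \<sigma>)"
    unfolding admissible_cover_def Let_def length_prof k(1)[symmetric] std_cover_sel
    using ps st m1 m2 m3 prof(2) R0 sing by simp
  have "stabilizes_to n ?L (\<lambda>i. (0, Pt (x i))) x" "stabilizes_to k ?L ?q y"
    unfolding stabilizes_to_def using moebius_id
    by (auto intro!: exI[of _ snd] simp: id_def)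
  thus "std_cover \<sigma> \<in> F" using adm by (simp add: fibre_def length_prof flip: k(1))
  show "smooth_model (std_cover \<sigma>) 0 0 id id"
    using assms moebius_id by (simp add: smooth_model_def)
qed

definition is_labeling :: "cover \<Rightarrow> (nat \<Rightarrow> proj1) \<Rightarrow> bool" where
  "is_labeling X \<sigma> \<longleftrightarrow> (\<exists>v w c e. smooth_model X v w c e \<and>
     \<sigma> = restrict (\<lambda>t. e (snd (tgt_pts X (k + t)))) {..<b})"

definition "labeling X = (SOME \<sigma>. is_labeling X \<sigma>)"

lemma is_labeling_labeling:
  assumes "X \<in> F"
  shows "is_labeling X (labeling X)"
proof -
  have "\<exists>\<sigma>. is_labeling X \<sigma>"
    using fibre_smooth_model[OF assms] unfolding is_labeling_def by blast
  thus ?thesis unfolding labeling_def by (rule someI_ex)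
qed

text \<open>With \<open>X = Y\<close> this also shows that the labeling of a cover does not depend
  on the smooth model from which it is read off.\<close>

lemma iso_iff_labeling:
  assumes "is_labeling X \<sigma>" "is_labeling Y \<tau>"
  shows "cover_isos n (k + b) X Y \<noteq> {} \<longleftrightarrow> \<sigma> = \<tau>"
proof -
  obtain v w c e where X: "smooth_model X v w c e"
    and s: "\<sigma> = restrict (\<lambda>t. e (snd (tgt_pts X (k + t)))) {..<b}"
    using assms(1) by (auto simp: is_labeling_def)
  obtain v' w' c' e' where Y: "smooth_model Y v' w' c' e'"
    and t: "\<tau> = restrict (\<lambda>t. e' (snd (tgt_pts Y (k + t)))) {..<b}"
    using assms(2) by (auto simp: is_labeling_def)
  show ?thesis
  proof
    assume "cover_isos n (k + b) X Y \<noteq> {}"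
    then obtain \<Phi> \<Psi> where "(\<Phi>, \<Psi>) \<in> cover_isos n (k + b) X Y" by fastforce
    from iso_unique(3)[OF X Y this] show "\<sigma> = \<tau>" unfolding s t by (intro restrict_ext) simp
  next
    assume eq: "\<sigma> = \<tau>"
    have "e (snd (tgt_pts X (k + i))) = e' (snd (tgt_pts Y (k + i)))" if "i < b" for i
    proof -
      have "\<sigma> i = \<tau> i" using eq by simp
      thus ?thesis using that by (simp only: s t restrict_apply lessThan_iff if_True)
    qed
    thus "cover_isos n (k + b) X Y \<noteq> {}" by (rule iso_exists[OF X Y])
  qed
qed

lemma labeling_image: "labeling ` F = labelings"
proof
  show "labeling ` F \<subseteq> labelings"
  proof
    fix \<sigma> assume "\<sigma> \<in> labeling ` F"
    then obtain X where "is_labeling X \<sigma>" using is_labeling_labeling by blast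
    then obtain v w c e where X: "smooth_model X v w c e"
      and s: "\<sigma> = restrict (\<lambda>t. e (snd (tgt_pts X (k + t)))) {..<b}"
      by (auto simp: is_labeling_def)
    show "\<sigma> \<in> labelings"
      using smooth_modelD(13)[OF X] unfolding s labelings_def
      by (auto simp: bij_betw_def inj_on_restrict_eq)
  qed
  show "labelings \<subseteq> labeling ` F"
  proof
    fix \<sigma> assume \<sigma>: "\<sigma> \<in> labelings"
    note S = std_cover_fibre[OF labelings_bij[OF \<sigma>]]
    have "\<sigma> \<in> extensional {..<b}" using \<sigma> by (auto simp: labelings_def PiE_def)
    hence "\<sigma> = restrict (\<lambda>t. id (snd (tgt_pts (std_cover \<sigma>) (k + t)))) {..<b}"
      by (intro extensionalityI[of _ "{..<b}"]) auto
    hence il: "is_labeling (std_cover \<sigma>) \<sigma>" using S(2) unfolding is_labeling_def by blast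
    \<comment> \<open>\<open>labeling\<close> may have been chosen from another model of this cover;
      the existence of an automorphism identifies the two labelings.\<close>
    have "cover_isos n (k + b) (std_cover \<sigma>) (std_cover \<sigma>) \<noteq> {}"
      using iso_iff_labeling[OF il il] by simp
    hence "\<sigma> = labeling (std_cover \<sigma>)" using iso_iff_labeling[OF il is_labeling_labeling[OF S(1)]] by simp
    thus "\<sigma> \<in> labeling ` F" using S(1) by blast
  qed
qed

text \<open>\<open>labeling\<close> is a complete invariant with image \<open>labelings\<close>, and
  every class has weight 1.\<close>

lemma fibre_count_fact: "finite (fibre_classes d b \<mu>s x y)" "fibre_count d b \<mu>s x y = fact b"
proof -
  have "{(X, Y). X \<in> F \<and> Y \<in> F \<and> cover_isos (length (flat_profile \<mu>s)) (length \<mu>s + b) X Y \<noteq> {}} =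
      {(X, Y). X \<in> F \<and> Y \<in> F \<and> labeling X = labeling Y}"
    unfolding length_prof k(1)[symmetric] using iso_iff_labeling is_labeling_labeling by blast
  hence cls: "fibre_classes d b \<mu>s x y = F // {(X, Y). X \<in> F \<and> Y \<in> F \<and> labeling X = labeling Y}"
    unfolding fibre_classes_def by simp
  have bij: "bij_betw (\<lambda>s. {X \<in> F. labeling X = s}) labelings (fibre_classes d b \<mu>s x y)"
    using quotient_by_function[of F labeling] unfolding cls labeling_image .
  show "finite (fibre_classes d b \<mu>s x y)" using bij card_labelings(2) bij_betw_finite by blast
  have "fibre_count d b \<mu>s x y = (\<Sum>c\<in>fibre_classes d b \<mu>s x y. 1)"
    unfolding fibre_count_def
  proof (rule sum.cong[OF refl])
    fix c assume "c \<in> fibre_classes d b \<mu>s x y"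
    then obtain s where s: "s \<in> labelings" "c = {X \<in> F. labeling X = s}"
      using bij by (auto simp: bij_betw_def)
    have "s \<in> labeling ` F" using s(1) labeling_image by simp
    hence "\<exists>X. X \<in> c" using s(2) by blast
    hence "(SOME X. X \<in> c) \<in> c" by (rule someI_ex)
    hence "(SOME X. X \<in> c) \<in> F" using s(2) by blast
    from fibre_smooth_model[OF this]
    obtain v w c' e where "smooth_model (SOME X. X \<in> c) v w c' e" by (elim exE)
    from card_automorphisms[OF this]
    show "(let X = SOME X. X \<in> c in
        1 / real (card (cover_isos (length (flat_profile \<mu>s)) (length \<mu>s + b) X X))) = 1"
      unfolding length_prof k(1)[symmetric] Let_def by simp
  qed
  also have "\<dots> = real (card (fibre_classes d b \<mu>s x y))" by simp
  also have "card (fibre_classes d b \<mu>s x y) = fact b"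
    using bij_betw_same_card[OF bij] card_labelings(1) by simp
  finally show "fibre_count d b \<mu>s x y = fact b" by simp
qed

end

section \<open>Simply branched rational functions\<close>

lemma double_root_card:
  fixes p :: "complex poly"
  assumes "p \<noteq> 0" "[:-t, 1:] ^ 2 dvd p"
  shows "card {z. poly p z = 0} < degree p"
proof -
  obtain u where u: "p = [:-t, 1:] ^ 2 * u" using assms(2) by (elim dvdE)
  hence u0: "u \<noteq> 0" using assms(1) by auto
  have "degree p = degree ([:-t, 1:] ^ 2) + degree u" unfolding u using u0 by (intro degree_mult_eq) auto
  hence deg: "degree p = 2 + degree u" by (simp add: degree_linear_power)
  have "{z. poly p z = 0} \<subseteq> insert t {z. poly u z = 0}" by (auto simp: u)
  hence "card {z. poly p z = 0} \<le> card (insert t {z. poly u z = 0})"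
    using poly_roots_finite[OF u0] by (intro card_mono) auto
  also have "\<dots> \<le> Suc (card {z. poly u z = 0})" by (rule card_insert_le_m1) auto
  also have "card {z. poly u z = 0} \<le> degree u" by (rule card_poly_roots_bound[OF u0])
  finally show ?thesis using deg by linarith
qed

lemma double_root_iff:
  fixes p :: "complex poly"
  shows "[:-t, 1:] ^ 2 dvd p \<longleftrightarrow> poly p t = 0 \<and> poly (pderiv p) t = 0"
proof (cases "poly p t = 0")
  case True
  then obtain u where u: "p = [:-t, 1:] * u" by (auto simp: poly_eq_0_iff_dvd elim: dvdE)
  have "poly (pderiv p) t = poly u t"
    unfolding u pderiv_mult poly_add poly_mult by (simp add: pderiv_pCons)
  moreover have "[:-t, 1:] ^ 2 dvd p \<longleftrightarrow> [:-t, 1:] dvd u"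
    unfolding u power2_eq_square by (subst dvd_mult_cancel_left) auto
  ultimately show ?thesis using True by (simp add: poly_eq_0_iff_dvd)
next
  case False
  hence "\<not> [:-t, 1:] dvd p" by (simp add: poly_eq_0_iff_dvd)
  hence "\<not> [:-t, 1:] ^ 2 dvd p" unfolding power2_eq_square using dvd_mult_left by blast
  thus ?thesis using False by simp
qed

text \<open>The numerator of the derivative of \<open>A / B\<close>. Another basis of the pencil
  spanned by \<open>A\<close> and \<open>B\<close> only rescales it, which allows passing to the
  fibre polynomial of any point.\<close>

definition wronskian :: "complex poly \<Rightarrow> complex poly \<Rightarrow> complex poly" where
  "wronskian A B = pderiv A * B - A * pderiv B"

lemma degree_pderiv_le: "degree p \<le> n \<Longrightarrow> degree (pderiv p) \<le> n - 1" for p :: "complex poly"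
  by (simp add: degree_pderiv)

lemma degree_wronskian_le:
  assumes "degree A \<le> m" "degree B \<le> n"
  shows "degree (wronskian A B) \<le> m + n - 1"
proof -
  have "degree (pderiv A * B) \<le> m + n - 1"
  proof (cases "m = 0")
    case True
    hence "pderiv A = 0" using assms(1) by (simp add: pderiv_eq_0_iff)
    thus ?thesis by simp
  next
    case False
    thus ?thesis using order_trans[OF degree_mult_le add_mono[OF degree_pderiv_le[OF assms(1)] assms(2)]] by simp
  qed
  moreover have "degree (A * pderiv B) \<le> m + n - 1"
  proof (cases "n = 0")
    case True
    hence "pderiv B = 0" using assms(2) by (simp add: pderiv_eq_0_iff)
    thus ?thesis by simp
  next
    case False
    thus ?thesis using order_trans[OF degree_mult_le add_mono[OF assms(1) degree_pderiv_le[OF assms(2)]]] by simp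
  qed
  ultimately show ?thesis unfolding wronskian_def by (rule degree_diff_le)
qed

lemma wronskian_simps:
  "wronskian (A - smult c B) B = wronskian A B"
  "wronskian A (B - smult c A) = wronskian A B"
  "wronskian (smult c A) (smult c B) = smult (c ^ 2) (wronskian A B)"
  by (simp_all add: wronskian_def pderiv_diff pderiv_smult algebra_simps power2_eq_square smult_diff_right)

lemma wronskian_commute: "wronskian B A = - wronskian A B"
  by (simp add: wronskian_def algebra_simps)

text \<open>Subtracting a multiple of \<open>A\<close> removes the top coefficient of
  \<open>B\<close> without changing the Wronskian, which gains one degree over the obvious
  bound.\<close>

lemma degree_wronskian_le2:
  assumes "degree A \<le> d" "degree B \<le> d" "coeff A d \<noteq> 0" "d \<ge> 1"
  shows "degree (wronskian A B) \<le> 2 * d - 2"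
proof -
  let ?G = "B - smult (coeff B d / coeff A d) A"
  have c: "coeff ?G d = 0" using assms by simp
  have dG: "degree ?G \<le> d" using assms by (intro degree_diff_le order_trans[OF degree_smult_le])
  have "degree ?G \<le> d - 1"
  proof (rule degree_le, intro allI impI)
    fix i assume "d - 1 < i"
    hence "i = d \<or> i > d" using assms(4) by linarith
    thus "coeff ?G i = 0"
    proof
      assume "i = d"
      thus ?thesis using c by simp
    next
      assume "i > d"
      thus ?thesis using dG by (intro coeff_eq_0) linarith
    qed
  qed
  from degree_wronskian_le[OF assms(1) this] show ?thesis
    unfolding wronskian_simps using assms(4) by simp
qed

text \<open>\<open>2 * d - 2\<close> is the Riemann-Hurwitz number. The degree of the Wronskian
  keeps infinity from being critical, the number of its zeros makes the critical points simple, and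
  the last two conditions make their values finite and distinct.\<close>

definition simply_branched :: "nat \<Rightarrow> complex poly \<Rightarrow> complex poly \<Rightarrow> bool" where
  "simply_branched d A B \<longleftrightarrow> d \<ge> 1 \<and> degree A \<le> d \<and> degree B \<le> d \<and> coeff A d \<noteq> 0 \<and>
     wronskian A B \<noteq> 0 \<and> degree (wronskian A B) = 2 * d - 2 \<and>
     card {z. poly (wronskian A B) z = 0} = 2 * d - 2 \<and>
     (\<forall>z. poly (wronskian A B) z = 0 \<longrightarrow> poly B z \<noteq> 0) \<and>
     inj_on (\<lambda>z. poly A z / poly B z) {z. poly (wronskian A B) z = 0}"

definition branch_values :: "complex poly \<Rightarrow> complex poly \<Rightarrow> complex set" where
  "branch_values A B = (\<lambda>z. poly A z / poly B z) ` {z. poly (wronskian A B) z = 0}"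

section \<open>Ramification of a simply branched map\<close>

context
  fixes d :: nat and A B :: "complex poly"
  assumes sb: "simply_branched d A B"
begin

lemma sbD: "d \<ge> 1" "degree A \<le> d" "degree B \<le> d" "coeff A d \<noteq> 0"
    "wronskian A B \<noteq> 0" "degree (wronskian A B) = 2 * d - 2"
    "card {z. poly (wronskian A B) z = 0} = 2 * d - 2"
    "\<And>z. poly (wronskian A B) z = 0 \<Longrightarrow> poly B z \<noteq> 0"
    "inj_on (\<lambda>z. poly A z / poly B z) {z. poly (wronskian A B) z = 0}"
  using sb unfolding simply_branched_def by blast+

lemma sb_degree_A: "degree A = d"
  using sbD(2,4) le_degree le_antisym by blast

lemma sb_common_root: "poly A z \<noteq> 0 \<or> poly B z \<noteq> 0"
  using sbD(8)[of z] by (auto simp: wronskian_def)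

lemma sb_ratmap: "is_ratmap (A, B)" "rdeg (A, B) = d"
proof -
  have "hval d A z \<noteq> 0 \<or> hval d B z \<noteq> 0" for z
    using sb_common_root sbD(4) by (cases z) auto
  from ratmapI[OF sbD(2,3,1) this] show "is_ratmap (A, B)" "rdeg (A, B) = d" .
qed

lemma sb_finite: "finite {z. poly (wronskian A B) z = 0}"
  by (rule poly_roots_finite[OF sbD(5)])

lemma card_branch_values: "finite (branch_values A B)" "card (branch_values A B) = 2 * d - 2"
  using sb_finite card_image[OF sbD(9)] sbD(7) by (auto simp: branch_values_def)

text \<open>\<open>G\<close> completes the fibre polynomial to a basis of the pencil and has no zero
  on the fibre. Finite and infinite values \<open>q\<close> can thus be treated alike.\<close>

lemma wronskian_fibre_poly:
  obtains G where "wronskian A B = wronskian (fibre_poly (A, B) q) G \<or>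
      wronskian A B = - wronskian (fibre_poly (A, B) q) G" "degree G \<le> d"
    "\<And>t. poly (fibre_poly (A, B) q) t = 0 \<Longrightarrow> poly G t \<noteq> 0"
proof (cases q)
  case (Pt c)
  show ?thesis
    by (rule that[of B])
      (use sb_common_root sbD(3) in \<open>auto simp: fibre_poly_def Pt wronskian_simps\<close>)
next
  case Infty
  show ?thesis
    by (rule that[of A])
      (use sb_common_root sbD(2) in \<open>auto simp: fibre_poly_def Infty wronskian_commute[of A B]\<close>)
qed

lemma ram_index_finite:
  "ram_index (A, B) (Pt t) = (if poly (wronskian A B) t = 0 then 2 else 1)"
proof -
  let ?F = "fibre_poly (A, B) (reval (A, B) (Pt t))"
  have F0: "?F \<noteq> 0" by (rule fibre_poly_props(2)[OF sb_ratmap(1)])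
  have Ft: "poly ?F t = 0"
    using hval_fibre_poly[OF sb_ratmap(1), of "Pt t" "reval (A, B) (Pt t)"] by simp
  obtain G where G: "wronskian A B = wronskian ?F G \<or> wronskian A B = - wronskian ?F G"
      "\<And>t. poly ?F t = 0 \<Longrightarrow> poly G t \<noteq> 0"
    using wronskian_fibre_poly[of "reval (A, B) (Pt t)"] by metis
  have W: "poly (wronskian A B) t = 0 \<longleftrightarrow> poly (pderiv ?F) t = 0"
  proof -
    have "poly (wronskian A B) t = 0 \<longleftrightarrow> poly (wronskian ?F G) t = 0"
      using G(1) by (elim disjE) simp_all
    also have "poly (wronskian ?F G) t = poly (pderiv ?F) t * poly G t"
      using Ft by (simp add: wronskian_def)
    finally show ?thesis using G(2)[OF Ft] by simp
  qed
  have ri: "ram_index (A, B) (Pt t) = order t ?F" by (simp add: ram_index_def Let_def)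
  have o1: "order t ?F \<ge> 1" using Ft F0 by (simp add: order_root Suc_le_eq)
  have o2: "order t ?F \<ge> 2 \<longleftrightarrow> poly (wronskian A B) t = 0"
    unfolding W using double_root_iff[of t ?F] order_divides[of t 2 ?F] F0 Ft by simp
  \<comment> \<open>A triple zero of the fibre polynomial would be a double zero of the Wronskian,
    which has as many distinct zeros as its degree.\<close>
  have o3: "\<not> order t ?F \<ge> 3"
  proof
    assume "order t ?F \<ge> 3"
    hence d3: "[:-t, 1:] ^ 3 dvd ?F" using order_divides by blast
    then obtain u where u: "?F = [:-t, 1:] ^ 3 * u" by (elim dvdE)
    define L where "L = [:-t, 1:]"
    have pL: "pderiv L = 1" by (simp add: L_def pderiv_pCons)
    have F: "?F = L * L * L * u" by (simp add: u L_def power3_eq_cube)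
    have "pderiv ?F = (L * L) * (u + u + u + L * pderiv u)"
      unfolding F by (simp add: pderiv_mult pL algebra_simps)
    hence "[:-t, 1:] ^ 2 dvd pderiv ?F" unfolding L_def power2_eq_square by (metis dvd_triv_left)
    moreover have "[:-t, 1:] ^ 2 dvd ?F" using d3 by (rule power_le_dvd) simp
    ultimately have "[:-t, 1:] ^ 2 dvd wronskian ?F G" unfolding wronskian_def by (intro dvd_diff dvd_mult2)
    hence "[:-t, 1:] ^ 2 dvd wronskian A B" using G(1) by auto
    from double_root_card[OF sbD(5) this] show False using sbD(6,7) by simp
  qed
  show ?thesis unfolding ri using o1 o2 o3 by auto
qed

text \<open>If the degree of the fibre polynomial dropped by two or more, the Wronskian could not
  reach degree \<open>2 * d - 2\<close>.\<close>

lemma ram_index_infinity: "ram_index (A, B) Infty = 1"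
proof -
  let ?F = "fibre_poly (A, B) (reval (A, B) Infty)"
  have c: "coeff ?F d = 0"
    using hval_fibre_poly[OF sb_ratmap(1), of Infty "reval (A, B) Infty"] sb_ratmap(2) by simp
  have F: "degree ?F \<le> d" "?F \<noteq> 0"
    using fibre_poly_props[OF sb_ratmap(1), of "reval (A, B) Infty"] sb_ratmap(2) by auto
  hence lt: "degree ?F < d" using c by (metis leading_coeff_0_iff le_neq_implies_less)
  obtain G where G: "wronskian A B = wronskian ?F G \<or> wronskian A B = - wronskian ?F G" "degree G \<le> d"
    using wronskian_fibre_poly[of "reval (A, B) Infty"] by metis
  have "degree (wronskian A B) = degree (wronskian ?F G)" using G(1) by auto
  hence "2 * d - 2 \<le> degree ?F + d - 1" using degree_wronskian_le[OF order_refl G(2), of ?F] sbD(6) by simp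
  thus ?thesis using lt sb_ratmap(2) by (simp add: ram_index_def Let_def)
qed

lemma reval_critical:
  assumes "poly (wronskian A B) z = 0"
  shows "reval (A, B) (Pt z) = Pt (poly A z / poly B z)"
  using sbD(8)[OF assms] by (simp add: reval_def)

lemma sb_unramified: "reval (A, B) z \<notin> Pt ` branch_values A B \<Longrightarrow> ram_index (A, B) z = 1"
  using reval_critical ram_index_infinity ram_index_finite
  by (cases z) (auto simp: branch_values_def)

lemma sb_simply_ramified:
  "ram_index (A, B) z = 1 \<or> ram_index (A, B) z = 2"
  "q \<in> Pt ` branch_values A B \<Longrightarrow> \<exists>!z. reval (A, B) z = q \<and> ram_index (A, B) z = 2"
proof -
  show "ram_index (A, B) z = 1 \<or> ram_index (A, B) z = 2"
    using ram_index_infinity ram_index_finite by (cases z) auto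
  assume "q \<in> Pt ` branch_values A B"
  then obtain s where s: "poly (wronskian A B) s = 0" "q = Pt (poly A s / poly B s)"
    by (auto simp: branch_values_def)
  show "\<exists>!z. reval (A, B) z = q \<and> ram_index (A, B) z = 2"
  proof (rule ex1I[of _ "Pt s"])
    show "reval (A, B) (Pt s) = q \<and> ram_index (A, B) (Pt s) = 2"
      using reval_critical[OF s(1)] ram_index_finite[of s] s by simp
    fix z assume z: "reval (A, B) z = q \<and> ram_index (A, B) z = 2"
    then obtain t where t: "z = Pt t" using ram_index_infinity by (cases z) auto
    have W: "poly (wronskian A B) t = 0" using z ram_index_finite[of t] by (auto simp: t split: if_splits)
    have "poly A t / poly B t = poly A s / poly B s" using z reval_critical[OF W] s by (simp add: t)
    from inj_onD[OF sbD(9) this] have "t = s" using W s(1) by blast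
    thus "z = Pt s" by (simp add: t)
  qed
qed

text \<open>The double zero at the critical point leaves a form of degree \<open>d - 2\<close>,
  hence at most \<open>1 + (d - 2)\<close> points.\<close>

lemma sb_card_fibre:
  assumes "q \<in> Pt ` branch_values A B"
  shows "card {z. reval (A, B) z = q} < d"
proof -
  let ?F = "fibre_poly (A, B) q"
  obtain s where s: "poly (wronskian A B) s = 0" "q = Pt (poly A s / poly B s)"
    using assms by (auto simp: branch_values_def)
  have q: "reval (A, B) (Pt s) = q" using reval_critical s by simp
  have F: "degree ?F \<le> d" "?F \<noteq> 0"
    using fibre_poly_props[OF sb_ratmap(1), of q] sb_ratmap(2) by auto
  have "order s ?F = 2" using ram_index_finite[of s] s(1) by (simp add: ram_index_def Let_def q)
  hence "[:-s, 1:] ^ 2 dvd ?F" using order_1 by metis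
  then obtain u where u: "?F = [:-s, 1:] ^ 2 * u" by (elim dvdE)
  hence u0: "u \<noteq> 0" using F by auto
  have "degree ?F = degree ([:-s, 1:] ^ 2) + degree u" unfolding u using u0 by (intro degree_mult_eq) auto
  hence deg: "2 + degree u \<le> d" using F by (simp add: degree_linear_power)
  have du: "degree u \<le> d - 2" "2 + (d - 2) = d" "degree ([:-s, 1:] ^ 2) \<le> 2"
    using deg by (auto simp: degree_linear_power)
  have "hval d ?F z = hval 2 ([:-s, 1:] ^ 2) z * hval (d - 2) u z" for z
    unfolding u using hval_mult[OF du(3,1), of z] unfolding du(2) .
  moreover have "hval 2 ([:-s, 1:] ^ 2) z = 0 \<longleftrightarrow> z = Pt s" for z
    using hval_power(2)[of "[:-s, 1:]" 1 2 z] by (cases z) auto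
  ultimately have "{z. reval (A, B) z = q} = insert (Pt s) {z. hval (d - 2) u z = 0}"
    using hval_fibre_poly[OF sb_ratmap(1), of _ q] sb_ratmap(2) by auto
  moreover have "card (insert (Pt s) {z. hval (d - 2) u z = 0}) \<le> Suc (card {z. hval (d - 2) u z = 0})"
    by (rule card_insert_le_m1) auto
  moreover have "card {z. hval (d - 2) u z = 0} \<le> d - 2"
    using hval_zeros(2)[of u "d - 2"] u0 deg by simp
  ultimately show ?thesis using deg by simp
qed

end

lemma simply_branched_smult:
  assumes sb: "simply_branched d A B" and "c \<noteq> 0"
  shows "simply_branched d (smult c A) (smult c B)"
    "branch_values (smult c A) (smult c B) = branch_values A B"
  using assms by (auto simp: simply_branched_def branch_values_def wronskian_simps)

section \<open>Resultants\<close>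

text \<open>\<open>p\<close> and \<open>q\<close> are the coefficient sequences of polynomials of formal degrees \<open>m\<close> and \<open>n\<close>; the
  columns are the coefficients of \<open>p\<close> shifted \<open>n\<close> times and of \<open>q\<close> shifted \<open>m\<close> times.\<close>

definition sylvester :: "nat \<Rightarrow> nat \<Rightarrow> (nat \<Rightarrow> 'a) \<Rightarrow> (nat \<Rightarrow> 'a) \<Rightarrow> 'a :: comm_ring_1 mat" where
  "sylvester m n p q = mat (m + n) (m + n) (\<lambda>(i, j).
     if j < n then (if j \<le> i then p (i - j) else 0) else (if j - n \<le> i then q (i - (j - n)) else 0))"

definition res :: "nat \<Rightarrow> nat \<Rightarrow> (nat \<Rightarrow> 'a) \<Rightarrow> (nat \<Rightarrow> 'a) \<Rightarrow> 'a :: comm_ring_1" where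
  "res m n p q = det (sylvester m n p q)"

lemma sylvester_carrier [simp]: "sylvester m n p q \<in> carrier_mat (m + n) (m + n)"
  by (simp add: sylvester_def)

lemma coeff_sum_monom: "coeff (\<Sum>j<n. monom (a j) j) i = (if i < n then a i else 0)"
proof -
  have "coeff (\<Sum>j<n. monom (a j) j) i = (\<Sum>j<n. if j = i then a j else 0)"
    by (simp add: coeff_sum)
  thus ?thesis by simp
qed

lemma degree_sum_monom: "n > 0 \<Longrightarrow> degree (\<Sum>j<n. monom (a j) j) < n"
  by (rule degree_lessI) (simp_all add: coeff_sum_monom)

lemma coeff_sum_monom_mult:
  fixes P :: "complex poly"
  shows "coeff ((\<Sum>j<n. monom (a j) j) * P) i = (\<Sum>j<n. (if j \<le> i then coeff P (i - j) else 0) * a j)"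
  by (simp add: sum_distrib_right coeff_sum coeff_monom_mult, intro sum.cong) auto

lemma sylvester_mult_vec:
  fixes P Q :: "complex poly"
  assumes "i < m + n" "v \<in> carrier_vec (m + n)"
  shows "(sylvester m n (coeff P) (coeff Q) *\<^sub>v v) $ i =
    coeff ((\<Sum>j<n. monom (v $ j) j) * P + (\<Sum>j<m. monom (v $ (n + j)) j) * Q) i"
proof -
  let ?M = "sylvester m n (coeff P) (coeff Q)"
  have "(?M *\<^sub>v v) $ i = (\<Sum>j\<in>{0..<m + n}. ?M $$ (i, j) * v $ j)"
    using assms by (simp add: sylvester_def scalar_prod_def)
  also have "{0..<m + n} = {..<n} \<union> {n..<n + m}" by auto
  also have "(\<Sum>j\<in>{..<n} \<union> {n..<n + m}. ?M $$ (i, j) * v $ j) =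
      (\<Sum>j<n. ?M $$ (i, j) * v $ j) + (\<Sum>j\<in>{n..<n + m}. ?M $$ (i, j) * v $ j)"
    by (rule sum.union_disjoint) auto
  also have "(\<Sum>j\<in>{n..<n + m}. ?M $$ (i, j) * v $ j) = (\<Sum>j<m. ?M $$ (i, n + j) * v $ (n + j))"
    by (rule sum.reindex_bij_witness[of _ "\<lambda>j. n + j" "\<lambda>j. j - n"]) auto
  also have "(\<Sum>j<n. ?M $$ (i, j) * v $ j) = coeff ((\<Sum>j<n. monom (v $ j) j) * P) i"
    unfolding coeff_sum_monom_mult using assms(1) by (intro sum.cong) (auto simp: sylvester_def)
  also have "(\<Sum>j<m. ?M $$ (i, n + j) * v $ (n + j)) = coeff ((\<Sum>j<m. monom (v $ (n + j)) j) * Q) i"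
    unfolding coeff_sum_monom_mult using assms(1) by (intro sum.cong) (auto simp: sylvester_def)
  finally show ?thesis by simp
qed

text \<open>\<open>P\<close> divides \<open>w * Q\<close>, hence \<open>w\<close>, whose degree is
  too small.\<close>

lemma coprime_comb_zero:
  fixes P Q u w :: "complex poly"
  assumes "\<And>z. poly P z \<noteq> 0 \<or> poly Q z \<noteq> 0" "P \<noteq> 0" "u * P + w * Q = 0" "w = 0 \<or> degree w < degree P"
  shows "u = 0" "w = 0"
proof -
  have "w * Q = P * (- u)" using assms(3) by (simp add: algebra_simps eq_neg_iff_add_eq_0)
  hence "P dvd w * Q" by (metis dvd_triv_left)
  hence "P dvd w" by (rule poly_coprime_dvd_mult[OF coprime_no_common_root[OF assms(1)]])
  hence "w = 0 \<or> degree P \<le> degree w" using dvd_imp_degree_le by blast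
  thus w: "w = 0" using assms(4) by (metis not_le)
  show "u = 0" using assms(2,3) w by simp
qed

text \<open>Kernel vectors of the Sylvester matrix are pairs \<open>u\<close>, \<open>w\<close> with
  \<open>u * P + w * Q = 0\<close>, of degrees below \<open>n\<close> and \<open>m\<close>. Only
  \<open>m\<close> is an exact degree; \<open>n\<close> is an upper bound, so \<open>Q\<close> may
  lose its top coefficients, as \<open>A - t * B\<close> does for special \<open>t\<close>.\<close>

lemma res_eq_0_iff:
  fixes P Q :: "complex poly"
  assumes P: "degree P = m" "P \<noteq> 0" and Q: "degree Q \<le> n"
  shows "res m n (coeff P) (coeff Q) = 0 \<longleftrightarrow> (\<exists>z. poly P z = 0 \<and> poly Q z = 0)"
proof -
  let ?M = "sylvester m n (coeff P) (coeff Q)"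
  have iff: "res m n (coeff P) (coeff Q) = 0 \<longleftrightarrow>
      (\<exists>v. v \<in> carrier_vec (m + n) \<and> v \<noteq> 0\<^sub>v (m + n) \<and> ?M *\<^sub>v v = 0\<^sub>v (m + n))"
    unfolding res_def by (rule det_0_iff_vec_prod_zero[OF sylvester_carrier])
  show ?thesis
  proof
    assume "res m n (coeff P) (coeff Q) = 0"
    then obtain v where v: "v \<in> carrier_vec (m + n)" "v \<noteq> 0\<^sub>v (m + n)" "?M *\<^sub>v v = 0\<^sub>v (m + n)"
      using iff by blast
    define u where "u = (\<Sum>j<n. monom (v $ j) j)"
    define w where "w = (\<Sum>j<m. monom (v $ (n + j)) j)"
    have "coeff (u * P + w * Q) i = 0" for i
    proof (cases "i < m + n")
      case True
      thus ?thesis using sylvester_mult_vec[OF True v(1), of P Q] v(3) by (simp add: u_def w_def)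
    next
      case False
      have "coeff (u * P) i = 0"
      proof (cases "n = 0")
        case False
        hence "degree u < n" unfolding u_def by (intro degree_sum_monom) simp
        hence "degree (u * P) < m + n" using degree_mult_le[of u P] P by linarith
        thus ?thesis using \<open>\<not> i < m + n\<close> by (intro coeff_eq_0) linarith
      qed (simp add: u_def)
      moreover have "coeff (w * Q) i = 0"
      proof (cases "m = 0")
        case False
        hence "degree w < m" unfolding w_def by (intro degree_sum_monom) simp
        hence "degree (w * Q) < m + n" using degree_mult_le[of w Q] Q by linarith
        thus ?thesis using \<open>\<not> i < m + n\<close> by (intro coeff_eq_0) linarith
      qed (simp add: w_def)
      ultimately show ?thesis by simp
    qed
    hence 0: "u * P + w * Q = 0" by (intro poly_eqI) simp
    have dw: "w = 0 \<or> degree w < degree P"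
    proof (cases "m = 0")
      case False
      thus ?thesis using P degree_sum_monom[of m "\<lambda>j. v $ (n + j)"] by (simp add: w_def)
    qed (simp add: w_def)
    show "\<exists>z. poly P z = 0 \<and> poly Q z = 0"
    proof (rule ccontr)
      assume H: "\<not> ?thesis"
      hence "poly P z \<noteq> 0 \<or> poly Q z \<noteq> 0" for z by blast
      note uw = coprime_comb_zero[OF this P(2) 0 dw]
      have "v = 0\<^sub>v (m + n)"
      proof (rule eq_vecI)
        fix i assume "i < dim_vec (0\<^sub>v (m + n) :: complex vec)"
        hence i: "i < m + n" by simp
        show "v $ i = 0\<^sub>v (m + n) $ i"
        proof (cases "i < n")
          case True
          hence "v $ i = coeff u i" by (simp add: u_def coeff_sum_monom)
          thus ?thesis using uw i by simp
        next
          case False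
          hence "v $ i = coeff w (i - n)" using i by (simp add: w_def coeff_sum_monom)
          thus ?thesis using uw i by simp
        qed
      qed (use v(1) in simp)
      thus False using v(2) by simp
    qed
  next
    assume "\<exists>z. poly P z = 0 \<and> poly Q z = 0"
    then obtain z where z: "poly P z = 0" "poly Q z = 0" by blast
    obtain P1 where P1: "P = [:-z, 1:] * P1" using z by (auto simp: poly_eq_0_iff_dvd elim: dvdE)
    obtain Q1 where Q1: "Q = [:-z, 1:] * Q1" using z by (auto simp: poly_eq_0_iff_dvd elim: dvdE)
    have P10: "P1 \<noteq> 0" using P P1 by auto
    have "degree P = degree [:-z, 1:] + degree P1" unfolding P1 using P10 by (intro degree_mult_eq) auto
    hence dP: "degree P1 < m" using P by simp
    have dQ: "Q1 = 0 \<or> degree Q1 < n"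
    proof (cases "Q1 = 0")
      case False
      hence "degree Q = degree [:-z, 1:] + degree Q1" unfolding Q1 by (intro degree_mult_eq) auto
      thus ?thesis using Q by simp
    qed simp
    \<comment> \<open>The relation \<open>Q1 * P - P1 * Q = 0\<close> left after removing the common
      factor.\<close>
    define v where "v = vec (m + n) (\<lambda>j. if j < n then coeff Q1 j else - coeff P1 (j - n))"
    have vc: "v \<in> carrier_vec (m + n)" by (simp add: v_def)
    have u: "(\<Sum>j<n. monom (v $ j) j) = Q1"
      by (rule poly_eqI) (use dQ in \<open>auto simp: coeff_sum_monom v_def coeff_eq_0\<close>)
    have w: "(\<Sum>j<m. monom (v $ (n + j)) j) = - P1"
      by (rule poly_eqI) (use dP in \<open>auto simp: coeff_sum_monom v_def coeff_eq_0\<close>)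
    have "?M *\<^sub>v v = 0\<^sub>v (m + n)"
    proof (rule eq_vecI)
      fix i assume "i < dim_vec (0\<^sub>v (m + n) :: complex vec)"
      hence i: "i < m + n" by simp
      have "Q1 * P + - P1 * Q = 0" unfolding P1 Q1 by (simp add: algebra_simps)
      thus "(?M *\<^sub>v v) $ i = 0\<^sub>v (m + n) $ i"
        using sylvester_mult_vec[OF i vc, of P Q] i unfolding u w by simp
    qed (simp add: sylvester_def)
    moreover have "v \<noteq> 0\<^sub>v (m + n)"
    proof
      assume v0: "v = 0\<^sub>v (m + n)"
      \<comment> \<open>The leading coefficient of \<open>P1\<close> shows that the vector is
        nonzero even if \<open>Q1 = 0\<close>.\<close>
      have "v $ (n + degree P1) = - lead_coeff P1" using dP by (simp add: v_def)
      moreover have "v $ (n + degree P1) = 0" unfolding v0 using dP by simp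
      ultimately show False using P10 by simp
    qed
    ultimately show "res m n (coeff P) (coeff Q) = 0" using iff vc by blast
  qed
qed

text \<open>Applied to the evaluation at \<open>t\<close>, which turns \<open>branch_poly\<close>
  into a resultant over the complex numbers.\<close>

lemma res_hom:
  assumes "comm_ring_hom f"
  shows "f (res m n p q) = res m n (f \<circ> p) (f \<circ> q)"
proof -
  interpret comm_ring_hom f by fact
  have "map_mat f (sylvester m n p q) = sylvester m n (f \<circ> p) (f \<circ> q)"
    by (rule eq_matI) (auto simp: sylvester_def)
  thus ?thesis unfolding res_def by (metis hom_det)
qed

text \<open>Every term of the determinant takes one entry from each column, and only the
  \<open>m\<close> columns made of \<open>q\<close> contain entries of degree 1.\<close>

lemma degree_res_le:
  fixes p q :: "nat \<Rightarrow> complex poly"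
  assumes "\<And>i. degree (p i) = 0" "\<And>i. degree (q i) \<le> 1"
  shows "degree (res m n p q) \<le> m"
proof -
  let ?M = "sylvester m n p q" and ?g = "\<lambda>j. if j < n then 0 else 1 :: nat"
  have "degree (signof \<pi> * (\<Prod>i = 0..<m + n. ?M $$ (i, \<pi> i))) \<le> m" if "\<pi> permutes {0..<m + n}" for \<pi>
  proof -
    have "degree (signof \<pi> :: complex poly) = 0" by (simp add: sign_def)
    hence "degree (signof \<pi> * (\<Prod>i = 0..<m + n. ?M $$ (i, \<pi> i))) \<le> degree (\<Prod>i = 0..<m + n. ?M $$ (i, \<pi> i))"
      using degree_mult_le[of "signof \<pi>" "\<Prod>i = 0..<m + n. ?M $$ (i, \<pi> i)"] by simp
    also have "\<dots> \<le> (\<Sum>i = 0..<m + n. degree (?M $$ (i, \<pi> i)))"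
      using degree_prod_sum_le[of "{0..<m + n}" "\<lambda>i. ?M $$ (i, \<pi> i)"] by (simp add: o_def)
    also have "\<dots> \<le> (\<Sum>i = 0..<m + n. ?g (\<pi> i))"
    proof (rule sum_mono)
      fix i assume "i \<in> {0..<m + n}"
      moreover from this have "\<pi> i \<in> {0..<m + n}" using permutes_in_image[OF that] by blast
      ultimately show "degree (?M $$ (i, \<pi> i)) \<le> ?g (\<pi> i)"
        using assms by (auto simp: sylvester_def)
    qed
    also have "\<dots> = (\<Sum>i = 0..<m + n. ?g i)" using sum.permute[OF that, of ?g] by (simp add: o_def)
    also have "\<dots> = (\<Sum>i\<in>{n..<m + n}. 1)"
      by (rule sum.mono_neutral_cong_right) auto
    also have "\<dots> = m" by simp
    finally show ?thesis .
  qed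
  thus ?thesis unfolding res_def det_def'[OF sylvester_carrier]
    by (intro degree_sum_le) (auto simp: finite_permutations)
qed

text \<open>The polynomial in \<open>t\<close> that is, up to a factor, the product of \<open>A z - t * B z\<close> over the zeros \<open>z\<close>
  of the Wronskian; its zeros are the branch values.\<close>

definition branch_poly :: "nat \<Rightarrow> complex poly \<Rightarrow> complex poly \<Rightarrow> complex poly" where
  "branch_poly d A B = res (2 * d - 2) d (\<lambda>i. [:coeff (wronskian A B) i:]) (\<lambda>i. [:coeff A i, - coeff B i:])"

lemma degree_branch_poly: "degree (branch_poly d A B) \<le> 2 * d - 2"
  unfolding branch_poly_def by (rule degree_res_le) auto

lemma comm_ring_hom_poly: "comm_ring_hom (\<lambda>p. poly p (t :: complex))"
  by unfold_locales auto

lemma poly_branch_poly: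
  assumes "wronskian A B \<noteq> 0" "degree (wronskian A B) = 2 * d - 2" "degree A \<le> d" "degree B \<le> d"
  shows "poly (branch_poly d A B) t = 0 \<longleftrightarrow> (\<exists>z. poly (wronskian A B) z = 0 \<and> poly A z = t * poly B z)"
proof -
  have "poly (branch_poly d A B) t = res (2 * d - 2) d (coeff (wronskian A B)) (coeff (A - smult t B))"
    unfolding branch_poly_def res_hom[OF comm_ring_hom_poly]
    by (intro arg_cong2[where f = "res (2 * d - 2) d"]) (auto simp: o_def)
  also have "\<dots> = 0 \<longleftrightarrow> (\<exists>z. poly (wronskian A B) z = 0 \<and> poly (A - smult t B) z = 0)"
    using assms by (intro res_eq_0_iff degree_diff_le order_trans[OF degree_smult_le]) auto
  finally show ?thesis by simp
qed

text \<open>The derivative has formal degree \<open>n\<close> instead of \<open>n - 1\<close>. For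
  \<open>p\<close> of exact degree \<open>n\<close> this is harmless, because
  \<open>res_eq_0_iff\<close> asks only for an upper bound on the second degree.\<close>

definition discriminant :: "nat \<Rightarrow> complex poly \<Rightarrow> complex" where
  "discriminant n p = res n n (coeff p) (coeff (pderiv p))"

lemma discriminant_nonzero_iff:
  assumes "degree p = n" "p \<noteq> 0"
  shows "discriminant n p \<noteq> 0 \<longleftrightarrow> card {z. poly p z = 0} = n"
proof -
  have dd: "degree (pderiv p) \<le> n" using assms by (simp add: degree_pderiv)
  have "discriminant n p \<noteq> 0 \<longleftrightarrow> (\<forall>z. \<not> (poly p z = 0 \<and> poly (pderiv p) z = 0))"
    unfolding discriminant_def using res_eq_0_iff[OF assms dd] by blast
  also have "\<dots> \<longleftrightarrow> card {z. poly p z = 0} = n"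
  proof
    assume H: "\<forall>z. \<not> (poly p z = 0 \<and> poly (pderiv p) z = 0)"
    have "order z p = 1" if "poly p z = 0" for z
      using H that assms(2) rsquarefree_roots[of p] rsquarefree_root_order by blast
    from card_roots_simple[OF assms(2) this] show "card {z. poly p z = 0} = n" using assms(1) by simp
  next
    assume c: "card {z. poly p z = 0} = n"
    show "\<forall>z. \<not> (poly p z = 0 \<and> poly (pderiv p) z = 0)"
    proof (intro allI notI)
      fix z assume "poly p z = 0 \<and> poly (pderiv p) z = 0"
      from double_root_card[OF assms(2) double_root_iff[THEN iffD2, OF this]]
      show False using c assms(1) by simp
    qed
  qed
  finally show ?thesis .
qed

text \<open>Each of the \<open>2 * d - 2\<close> distinct zeros of \<open>branch_poly\<close> is the
  value at some critical point, and different zeros need different points. As there are at most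
  \<open>2 * d - 2\<close> critical points, all are simple, with distinct finite values.\<close>

lemma branch_poly_simply_branched:
  assumes d: "d \<ge> 1" and deg: "degree A \<le> d" "degree B \<le> d" and A: "coeff A d \<noteq> 0"
    and W: "coeff (wronskian A B) (2 * d - 2) \<noteq> 0"
    and lc: "coeff (branch_poly d A B) (2 * d - 2) \<noteq> 0"
    and disc: "discriminant (2 * d - 2) (branch_poly d A B) \<noteq> 0"
  shows "simply_branched d A B" "branch_values A B = {t. poly (branch_poly d A B) t = 0}"
proof -
  let ?W = "wronskian A B" and ?D = "branch_poly d A B" and ?N = "2 * d - 2"
  have W0: "?W \<noteq> 0" and D0: "?D \<noteq> 0" using W lc by auto
  have dW: "degree ?W = ?N" using degree_wronskian_le2[OF deg A d] le_degree[OF W] by simp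
  have dD: "degree ?D = ?N" using degree_branch_poly[of d A B] le_degree[OF lc] by simp
  let ?T = "{t. poly ?D t = 0}" and ?Z = "{z. poly ?W z = 0}"
  note D = poly_branch_poly[OF W0 dW deg]
  have cT: "card ?T = ?N" using discriminant_nonzero_iff[OF dD D0] disc by simp
  have finZ: "finite ?Z" by (rule poly_roots_finite[OF W0])
  have cZ: "card ?Z \<le> ?N" using card_poly_roots_bound[OF W0] dW by simp
  have "\<forall>t\<in>?T. \<exists>z. z \<in> ?Z \<and> poly A z = t * poly B z" using D by simp
  from bchoice[OF this] obtain \<zeta> where z: "\<forall>t\<in>?T. \<zeta> t \<in> ?Z \<and> poly A (\<zeta> t) = t * poly B (\<zeta> t)" ..
  have B: "poly B z \<noteq> 0" if "z \<in> ?Z" "poly A z = t * poly B z" for z t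
  proof
    \<comment> \<open>Then \<open>A\<close> vanishes at \<open>z\<close> too, and such a common zero
      would make \<open>branch_poly\<close> vanish identically.\<close>
    assume B0: "poly B z = 0"
    have "poly ?D s = 0" for s using D that B0 by auto
    hence "?D = 0" using poly_all_0_iff_0 by blast
    thus False using D0 by simp
  qed
  have t: "t = poly A (\<zeta> t) / poly B (\<zeta> t)" if "t \<in> ?T" for t
    using z that B by auto
  have "inj_on \<zeta> ?T" by (rule inj_onI) (metis t)
  hence "card (\<zeta> ` ?T) = ?N" using cT by (simp add: card_image)
  moreover have sub: "\<zeta> ` ?T \<subseteq> ?Z" using z by blast
  ultimately have img: "\<zeta> ` ?T = ?Z" and cZ': "card ?Z = ?N"
    using card_seteq[OF finZ sub] card_mono[OF finZ sub] cZ by auto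
  have B': "poly B z \<noteq> 0" if "poly ?W z = 0" for z
  proof -
    have "z \<in> \<zeta> ` ?T" using that img by simp
    thus ?thesis using z B by blast
  qed
  have inj: "inj_on (\<lambda>z. poly A z / poly B z) ?Z"
  proof (rule inj_onI)
    fix z w assume zw: "z \<in> ?Z" "w \<in> ?Z" "poly A z / poly B z = poly A w / poly B w"
    have "z \<in> \<zeta> ` ?T" "w \<in> \<zeta> ` ?T" using zw(1,2) img by simp_all
    then obtain s s' where s: "s \<in> ?T" "z = \<zeta> s" "s' \<in> ?T" "w = \<zeta> s'" by blast
    have "s = s'" using t[OF s(1)] t[OF s(3)] zw(3) by (simp only: s(2,4))
    thus "z = w" using s by simp
  qed
  show "simply_branched d A B"
    unfolding simply_branched_def using d deg A W0 dW cZ' B' inj by blast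
  show "branch_values A B = ?T"
  proof
    show "branch_values A B \<subseteq> ?T" using B' D by (auto simp: branch_values_def)
    show "?T \<subseteq> branch_values A B" using t z unfolding branch_values_def by blast
  qed
qed

text \<open>The converse direction, by which a single example shows that the polynomial conditions
  do not vanish identically.\<close>

lemma simply_branched_branch_poly:
  assumes sb: "simply_branched d A B"
  shows "coeff (wronskian A B) (2 * d - 2) \<noteq> 0" "coeff (branch_poly d A B) (2 * d - 2) \<noteq> 0"
    "discriminant (2 * d - 2) (branch_poly d A B) \<noteq> 0"
    "poly (branch_poly d A B) t = 0 \<Longrightarrow> t \<in> branch_values A B"
proof -
  note S = sbD[OF sb]
  let ?D = "branch_poly d A B" and ?N = "2 * d - 2"
  show "coeff (wronskian A B) ?N \<noteq> 0" using S(5,6) by (metis leading_coeff_0_iff)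
  note D = poly_branch_poly[OF S(5,6,2,3)]
  have T: "{t. poly ?D t = 0} = branch_values A B"
  proof (rule Set.set_eqI)
    fix t
    have "poly ?D t = 0 \<longleftrightarrow> (\<exists>z. poly (wronskian A B) z = 0 \<and> t = poly A z / poly B z)"
      unfolding D using S(8) by (metis eq_divide_eq)
    thus "t \<in> {t. poly ?D t = 0} \<longleftrightarrow> t \<in> branch_values A B" by (auto simp: branch_values_def)
  qed
  thus "poly ?D t = 0 \<Longrightarrow> t \<in> branch_values A B" by blast
  \<comment> \<open>The zeros of \<open>?D\<close> are the branch values, finite in number, so
    \<open>?D\<close> is not the zero polynomial.\<close>
  have "\<exists>t. t \<notin> branch_values A B"
    by (rule ex_new_if_finite[OF infinite_UNIV_char_0 card_branch_values(1)[OF sb]])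
  then obtain t0 where "poly ?D t0 \<noteq> 0" unfolding T[symmetric] by blast
  hence D0: "?D \<noteq> 0" by (intro notI) simp
  have "?N \<le> degree ?D" using card_poly_roots_bound[OF D0] T card_branch_values(2)[OF sb] by simp
  hence dD: "degree ?D = ?N" using degree_branch_poly[of d A B] by simp
  thus "coeff ?D ?N \<noteq> 0" using D0 by (metis leading_coeff_0_iff)
  show "discriminant ?N ?D \<noteq> 0"
    using discriminant_nonzero_iff[OF dD D0] T card_branch_values(2)[OF sb] by simp
qed

section \<open>Polynomial dependence on the marked points\<close>

text \<open>Instantiated both for complex values and for polynomial values, so that determinants and
  resultants are treated once.\<close>

locale function_ring =
  fixes S :: "('p \<Rightarrow> 'q \<Rightarrow> 'a :: comm_ring_1) set"
  assumes const: "(\<lambda>x y. c) \<in> S"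
    and add: "P \<in> S \<Longrightarrow> Q \<in> S \<Longrightarrow> (\<lambda>x y. P x y + Q x y) \<in> S"
    and mult: "P \<in> S \<Longrightarrow> Q \<in> S \<Longrightarrow> (\<lambda>x y. P x y * Q x y) \<in> S"
begin

lemma uminus: "P \<in> S \<Longrightarrow> (\<lambda>x y. - P x y) \<in> S"
  using mult[OF const[of "-1"], of P] by simp

lemma diff: "P \<in> S \<Longrightarrow> Q \<in> S \<Longrightarrow> (\<lambda>x y. P x y - Q x y) \<in> S"
  using add[OF _ uminus, of P Q] by simp

lemma sum: "(\<And>i. i \<in> I \<Longrightarrow> (\<lambda>x y. P i x y) \<in> S) \<Longrightarrow> (\<lambda>x y. \<Sum>i\<in>I. P i x y) \<in> S"
  by (induction I rule: infinite_finite_induct) (auto intro: const add)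

lemma prod: "(\<And>i. i \<in> I \<Longrightarrow> (\<lambda>x y. P i x y) \<in> S) \<Longrightarrow> (\<lambda>x y. \<Prod>i\<in>I. P i x y) \<in> S"
  by (induction I rule: infinite_finite_induct) (auto intro: const mult)

lemma power: "P \<in> S \<Longrightarrow> (\<lambda>x y. P x y ^ m) \<in> S"
  by (induction m) (auto intro: const mult)

lemma det:
  assumes "\<And>x y. M x y \<in> carrier_mat m m"
    and "\<And>i j. i < m \<Longrightarrow> j < m \<Longrightarrow> (\<lambda>x y. M x y $$ (i, j)) \<in> S"
  shows "(\<lambda>x y. det (M x y)) \<in> S"
proof -
  have "(\<lambda>x y. \<Sum>p\<in>{p. p permutes {0..<m}}. signof p * (\<Prod>i = 0..<m. M x y $$ (i, p i))) \<in> S"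
  proof (rule sum)
    fix p assume "p \<in> {p. p permutes {0..<m}}"
    hence "p i < m" if "i < m" for i using that permutes_in_image[of p "{0..<m}" i] by auto
    thus "(\<lambda>x y. signof p * (\<Prod>i = 0..<m. M x y $$ (i, p i))) \<in> S"
      using assms(2) by (intro mult const prod) auto
  qed
  thus ?thesis by (simp add: det_def'[OF assms(1)])
qed

lemma res:
  assumes "\<And>i. (\<lambda>x y. p x y i) \<in> S" "\<And>i. (\<lambda>x y. q x y i) \<in> S"
  shows "(\<lambda>x y. res m n (p x y) (q x y)) \<in> S"
  unfolding res_def
proof (rule det[of _ "m + n"])
  fix i j assume ij: "i < m + n" "j < m + n"
  have "(\<lambda>x y. if j < n then if j \<le> i then p x y (i - j) else 0
      else if j - n \<le> i then q x y (i - (j - n)) else 0) \<in> S"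
    by (cases "j < n"; cases "j \<le> i"; cases "j - n \<le> i") (simp_all add: assms const)
  thus "(\<lambda>x y. sylvester m n (p x y) (q x y) $$ (i, j)) \<in> S"
    using ij by (simp add: sylvester_def)
qed simp

end

lemma function_ring_poly_funs: "function_ring (poly_funs n k)"
  by unfold_locales (rule poly_funs.intros; assumption)+

definition poly_fun_polys :: "nat \<Rightarrow> nat \<Rightarrow> ((nat \<Rightarrow> complex) \<Rightarrow> (nat \<Rightarrow> complex) \<Rightarrow> complex poly) set" where
  "poly_fun_polys n k = {F. \<forall>j. (\<lambda>x y. coeff (F x y) j) \<in> poly_funs n k}"

lemma function_ring_poly_fun_polys: "function_ring (poly_fun_polys n k)"
proof -
  interpret function_ring "poly_funs n k" by (rule function_ring_poly_funs)
  show ?thesis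
  proof
    fix c show "(\<lambda>x y. c) \<in> poly_fun_polys n k" by (simp add: poly_fun_polys_def const)
  next
    fix P Q assume PQ: "P \<in> poly_fun_polys n k" "Q \<in> poly_fun_polys n k"
    show "(\<lambda>x y. P x y + Q x y) \<in> poly_fun_polys n k"
      using PQ by (simp add: poly_fun_polys_def add)
    have "(\<lambda>x y. \<Sum>i\<le>j. coeff (P x y) i * coeff (Q x y) (j - i)) \<in> poly_funs n k" for j
      using PQ by (intro sum mult) (auto simp: poly_fun_polys_def)
    thus "(\<lambda>x y. P x y * Q x y) \<in> poly_fun_polys n k"
      by (simp add: poly_fun_polys_def coeff_mult)
  qed
qed

lemma poly_fun_polys_coeff: "F \<in> poly_fun_polys n k \<Longrightarrow> (\<lambda>x y. coeff (F x y) j) \<in> poly_funs n k"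
  by (simp add: poly_fun_polys_def)

lemma poly_fun_polys_pderiv: "F \<in> poly_fun_polys n k \<Longrightarrow> (\<lambda>x y. pderiv (F x y)) \<in> poly_fun_polys n k"
  by (auto simp: poly_fun_polys_def coeff_pderiv intro: poly_funs.const poly_funs.mult)

lemma poly_fun_polys_pCons:
  assumes "c \<in> poly_funs n k" "F \<in> poly_fun_polys n k"
  shows "(\<lambda>x y. pCons (c x y) (F x y)) \<in> poly_fun_polys n k"
proof -
  have "(\<lambda>x y. coeff (pCons (c x y) (F x y)) j) \<in> poly_funs n k" for j
    using assms by (cases j) (auto simp: poly_fun_polys_def)
  thus ?thesis by (simp add: poly_fun_polys_def)
qed

lemma poly_fun_polys_wronskian:
  assumes "A \<in> poly_fun_polys n k" "B \<in> poly_fun_polys n k"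
  shows "(\<lambda>x y. wronskian (A x y) (B x y)) \<in> poly_fun_polys n k"
proof -
  interpret function_ring "poly_fun_polys n k" by (rule function_ring_poly_fun_polys)
  show ?thesis unfolding wronskian_def by (intro diff mult poly_fun_polys_pderiv assms)
qed

lemma poly_fun_polys_branch_poly:
  assumes "A \<in> poly_fun_polys n k" "B \<in> poly_fun_polys n k"
  shows "(\<lambda>x y. branch_poly d (A x y) (B x y)) \<in> poly_fun_polys n k"
proof -
  interpret PP: function_ring "poly_fun_polys n k" by (rule function_ring_poly_fun_polys)
  interpret P: function_ring "poly_funs n k" by (rule function_ring_poly_funs)
  show ?thesis unfolding branch_poly_def
    by (intro PP.res poly_fun_polys_pCons poly_fun_polys_coeff poly_fun_polys_wronskian assms P.uminus PP.const)
qed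

lemma poly_funs_discriminant:
  assumes "F \<in> poly_fun_polys n k"
  shows "(\<lambda>x y. discriminant m (F x y)) \<in> poly_funs n k"
proof -
  interpret P: function_ring "poly_funs n k" by (rule function_ring_poly_funs)
  show ?thesis unfolding discriminant_def
    by (intro P.res poly_fun_polys_coeff poly_fun_polys_pderiv assms)
qed

text \<open>The uniform bound \<open>m\<close> turns the evaluation into a sum of fixed
  length.\<close>

lemma poly_funs_poly:
  assumes "F \<in> poly_fun_polys n k" "\<And>x y. degree (F x y) \<le> m" "c \<in> poly_funs n k"
  shows "(\<lambda>x y. poly (F x y) (c x y)) \<in> poly_funs n k"
proof -
  interpret P: function_ring "poly_funs n k" by (rule function_ring_poly_funs)
  have "poly (F x y) (c x y) = (\<Sum>i\<le>m. coeff (F x y) i * c x y ^ i)" for x y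
    unfolding poly_altdef using assms(2) by (intro sum.mono_neutral_left) (auto simp: coeff_eq_0)
  thus ?thesis by (simp, intro P.sum P.mult P.power poly_fun_polys_coeff assms(1,3))
qed

section \<open>The interpolation problem\<close>

text \<open>The unknowns are the coefficients of \<open>A\<close> and \<open>B\<close>; row \<open>i < n\<close> is the equation
  \<open>A (x i) = y (h i) * B (x i)\<close> and the last row is the coefficient of \<open>A\<close> in degree \<open>d\<close>.\<close>

definition sysmat :: "nat \<Rightarrow> nat \<Rightarrow> (nat \<Rightarrow> nat) \<Rightarrow> (nat \<Rightarrow> complex) \<Rightarrow> (nat \<Rightarrow> complex) \<Rightarrow> complex mat" where
  "sysmat d n h x y = mat (Suc n) (Suc n) (\<lambda>(i, j).
     if i < n then (if j < Suc d then x i ^ j else - (y (h i) * x i ^ (j - Suc d)))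
     else (if j = d then 1 else 0))"

definition num_poly :: "nat \<Rightarrow> (nat \<Rightarrow> complex) \<Rightarrow> complex poly" where
  "num_poly d v = (\<Sum>j<Suc d. monom (v j) j)"

definition den_poly :: "nat \<Rightarrow> (nat \<Rightarrow> complex) \<Rightarrow> complex poly" where
  "den_poly d v = (\<Sum>j<Suc d. monom (v (Suc d + j)) j)"

lemma num_den_poly_coeff:
  "coeff (num_poly d v) j = (if j < Suc d then v j else 0)"
  "coeff (den_poly d v) j = (if j < Suc d then v (Suc d + j) else 0)"
  unfolding num_poly_def den_poly_def coeff_sum_monom by simp_all

lemma degree_num_den_poly: "degree (num_poly d v) \<le> d" "degree (den_poly d v) \<le> d"
  by (rule degree_le; simp add: num_den_poly_coeff)+

lemma sysmat_mult_vec: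
  assumes n: "n = 2 * d + 1" and v: "v \<in> carrier_vec (Suc n)"
  shows "i < n \<Longrightarrow> (sysmat d n h x y *\<^sub>v v) $ i =
      poly (num_poly d (($) v)) (x i) - y (h i) * poly (den_poly d (($) v)) (x i)"
    "(sysmat d n h x y *\<^sub>v v) $ n = v $ d"
proof -
  let ?M = "sysmat d n h x y"
  have row: "(?M *\<^sub>v v) $ i = (\<Sum>j\<in>{0..<Suc n}. ?M $$ (i, j) * v $ j)" if "i < Suc n" for i
    using that v by (simp add: sysmat_def scalar_prod_def)
  assume i: "i < n"
  have "(?M *\<^sub>v v) $ i = (\<Sum>j\<in>{0..<Suc n}. ?M $$ (i, j) * v $ j)" using i row by simp
  also have "{0..<Suc n} = {..<Suc d} \<union> {Suc d..<Suc d + Suc d}" using n by auto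
  also have "(\<Sum>j\<in>{..<Suc d} \<union> {Suc d..<Suc d + Suc d}. ?M $$ (i, j) * v $ j) =
      (\<Sum>j<Suc d. ?M $$ (i, j) * v $ j) + (\<Sum>j\<in>{Suc d..<Suc d + Suc d}. ?M $$ (i, j) * v $ j)"
    by (rule sum.union_disjoint) auto
  also have "(\<Sum>j\<in>{Suc d..<Suc d + Suc d}. ?M $$ (i, j) * v $ j) =
      (\<Sum>j<Suc d. ?M $$ (i, Suc d + j) * v $ (Suc d + j))"
    by (rule sum.reindex_bij_witness[of _ "\<lambda>j. Suc d + j" "\<lambda>j. j - Suc d"]) auto
  also have "(\<Sum>j<Suc d. ?M $$ (i, j) * v $ j) = poly (num_poly d (($) v)) (x i)"
    unfolding num_poly_def poly_sum using i n by (intro sum.cong) (auto simp: sysmat_def poly_monom)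
  also have "(\<Sum>j<Suc d. ?M $$ (i, Suc d + j) * v $ (Suc d + j)) =
      (\<Sum>j<Suc d. - y (h i) * (v $ (Suc d + j) * x i ^ j))"
    using i n by (intro sum.cong) (auto simp: sysmat_def)
  also have "\<dots> = - y (h i) * poly (den_poly d (($) v)) (x i)"
    unfolding den_poly_def poly_sum poly_monom sum_distrib_left[symmetric] ..
  finally show "(?M *\<^sub>v v) $ i =
      poly (num_poly d (($) v)) (x i) - y (h i) * poly (den_poly d (($) v)) (x i)" by simp
next
  let ?M = "sysmat d n h x y"
  have "(?M *\<^sub>v v) $ n = (\<Sum>j\<in>{0..<Suc n}. ?M $$ (n, j) * v $ j)"
    using v by (simp add: sysmat_def scalar_prod_def)
  also have "\<dots> = (\<Sum>j\<in>{0..<Suc n}. if j = d then v $ j else 0)"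
    by (intro sum.cong) (auto simp: sysmat_def)
  also have "\<dots> = v $ d" using n by simp
  finally show "(?M *\<^sub>v v) $ n = v $ d" .
qed

text \<open>The last column of the adjugate. It solves the system with right-hand side
  \<open>det (sysmat d n h x y)\<close> in the last row and 0 elsewhere, and it is polynomial in
  \<open>x\<close> and \<open>y\<close> because nothing is divided.\<close>

definition solution :: "nat \<Rightarrow> nat \<Rightarrow> (nat \<Rightarrow> nat) \<Rightarrow> (nat \<Rightarrow> complex) \<Rightarrow> (nat \<Rightarrow> complex) \<Rightarrow> nat \<Rightarrow> complex" where
  "solution d n h x y j = cofactor (sysmat d n h x y) n j"

lemma sysmat_carrier: "sysmat d n h x y \<in> carrier_mat (Suc n) (Suc n)"
  by (simp add: sysmat_def)

lemma solution_props:
  fixes x y :: "nat \<Rightarrow> complex" and h :: "nat \<Rightarrow> nat"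
  assumes n: "n = 2 * d + 1"
  defines "A \<equiv> num_poly d (solution d n h x y)" and "B \<equiv> den_poly d (solution d n h x y)"
  shows "i < n \<Longrightarrow> poly A (x i) = y (h i) * poly B (x i)"
    "coeff A d = det (sysmat d n h x y)"
proof -
  let ?M = "sysmat d n h x y"
  define v where "v = vec (Suc n) (solution d n h x y)"
  have vc: "v \<in> carrier_vec (Suc n)" by (simp add: v_def)
  have A: "A = num_poly d (($) v)" and B: "B = den_poly d (($) v)"
    unfolding A_def B_def by (intro poly_eqI; simp add: num_den_poly_coeff v_def n)+
  note adj = adj_mat[OF sysmat_carrier[of d n h x y]]
  have v: "v = col (adj_mat ?M) n"
    using adj(1) by (intro eq_vecI) (auto simp: v_def solution_def adj_mat_def sysmat_def)
  have Mv: "(?M *\<^sub>v v) $ i = (if i = n then det ?M else 0)" if "i < Suc n" for i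
  proof -
    have "(?M *\<^sub>v v) $ i = (?M * adj_mat ?M) $$ (i, n)"
      using that adj(1) sysmat_carrier[of d n h x y] by (auto simp: v)
    thus ?thesis using that by (simp add: adj(2))
  qed
  show "poly A (x i) = y (h i) * poly B (x i)" if "i < n"
    using sysmat_mult_vec(1)[OF n vc that, of h x y] Mv[of i] that by (simp add: A B)
  have "coeff A d = v $ d" by (simp add: A num_den_poly_coeff)
  thus "coeff A d = det ?M" using sysmat_mult_vec(2)[OF n vc, of h x y] Mv[of n] by simp
qed

text \<open>\<open>A * B0 - A0 * B\<close> has degree at most \<open>2 * d\<close> and \<open>2 * d + 1\<close> zeros.\<close>

lemma interpolation_unique:
  assumes n: "n = 2 * d + 1" and sb: "simply_branched d A0 B0" and inj: "inj_on x {..<n}"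
    and 0: "\<forall>i<n. poly A0 (x i) = q i * poly B0 (x i)"
    and 1: "\<forall>i<n. poly A (x i) = q i * poly B (x i)"
    and deg: "degree A \<le> d" "degree B \<le> d"
  shows "\<exists>c. A = smult c A0 \<and> B = smult c B0"
proof -
  let ?p = "A * B0 - A0 * B"
  note S = sbD[OF sb]
  have p0: "?p = 0"
  proof (rule ccontr)
    assume p: "?p \<noteq> 0"
    have "degree ?p \<le> 2 * d"
      using order_trans[OF degree_mult_le add_mono[OF deg(1) S(3)]]
        order_trans[OF degree_mult_le add_mono[OF S(2) deg(2)]] by (intro degree_diff_le) simp_all
    moreover have "x ` {..<n} \<subseteq> {z. poly ?p z = 0}" using 0 1 by auto
    hence "card (x ` {..<n}) \<le> card {z. poly ?p z = 0}"
      by (intro card_mono poly_roots_finite[OF p])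
    moreover have "card (x ` {..<n}) = n" using card_image[OF inj] by simp
    ultimately show False using card_poly_roots_bound[OF p] n by linarith
  qed
  have A0: "A0 \<noteq> 0" using S(4) by auto
  have "A0 dvd A * B0" using p0 by (metis dvd_triv_left eq_iff_diff_eq_0)
  hence "A0 dvd A" by (rule poly_coprime_dvd_mult[OF coprime_no_common_root[OF sb_common_root[OF sb]]])
  then obtain u where u: "A = A0 * u" by (elim dvdE)
  \<comment> \<open>\<open>A0\<close> has the exact degree \<open>d\<close>, which leaves no room
    for a nonconstant quotient.\<close>
  have "degree u = 0"
  proof (cases "u = 0")
    case False
    have "degree A = degree A0 + degree u" unfolding u using A0 False by (rule degree_mult_eq)
    thus ?thesis using deg(1) sb_degree_A[OF sb] by simp
  qed simp
  then obtain c where c: "u = [:c:]" by (rule degree_eq_zeroE)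
  have "A0 * (smult c B0) = A0 * B" using p0 by (simp add: u c algebra_simps)
  hence "smult c B0 = B" using A0 by (subst (asm) mult_left_cancel)
  moreover have "A = smult c A0" by (simp add: u c)
  ultimately show ?thesis by blast
qed

text \<open>A kernel vector is another interpolating pair, hence a multiple of
  \<open>(A0, B0)\<close>. The last row kills its coefficient in degree \<open>d\<close>, and since
  \<open>A0\<close> has exact degree \<open>d\<close> the multiple is zero.\<close>

lemma det_sysmat_nonzero:
  assumes n: "n = 2 * d + 1" and sb: "simply_branched d A0 B0" and inj: "inj_on x {..<n}"
    and 0: "\<forall>i<n. poly A0 (x i) = y (h i) * poly B0 (x i)"
  shows "det (sysmat d n h x y) \<noteq> 0"
proof
  let ?M = "sysmat d n h x y"
  assume "det ?M = 0"
  then obtain v where v: "v \<in> carrier_vec (Suc n)" "v \<noteq> 0\<^sub>v (Suc n)" "?M *\<^sub>v v = 0\<^sub>v (Suc n)"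
    using det_0_iff_vec_prod_zero[OF sysmat_carrier] by blast
  define A B where "A = num_poly d (($) v)" and "B = den_poly d (($) v)"
  have AB: "\<forall>i<n. poly A (x i) = y (h i) * poly B (x i)"
    using sysmat_mult_vec(1)[OF n v(1), of _ h x y] v(3) by (simp add: A_def B_def)
  have deg: "degree A \<le> d" "degree B \<le> d" by (simp_all add: A_def B_def degree_num_den_poly)
  obtain c where c: "A = smult c A0" "B = smult c B0"
    using interpolation_unique[of n d A0 B0 x "\<lambda>i. y (h i)", OF n sb inj 0 AB deg] by blast
  have "v $ d = 0" using sysmat_mult_vec(2)[OF n v(1), of h x y] v(3) by simp
  hence "coeff A d = 0" by (simp add: A_def num_den_poly_coeff)
  hence "c = 0" using c sbD(4)[OF sb] by simp
  hence AB: "A = 0" "B = 0" using c by auto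
  have "v = 0\<^sub>v (Suc n)"
  proof (rule eq_vecI)
    fix j assume "j < dim_vec (0\<^sub>v (Suc n) :: complex vec)"
    hence j: "j < Suc n" by simp
    show "v $ j = 0\<^sub>v (Suc n) $ j"
    proof (cases "j < Suc d")
      case True
      hence "v $ j = coeff A j" by (simp add: A_def num_den_poly_coeff)
      thus ?thesis using AB j by simp
    next
      case False
      hence "v $ j = coeff B (j - Suc d)" using j n by (simp add: B_def num_den_poly_coeff)
      thus ?thesis using AB j by simp
    qed
  qed (use v(1) in simp)
  thus False using v(2) by simp
qed

lemma poly_funs_sysmat:
  assumes "\<And>i. i < n \<Longrightarrow> h i < k" "i < Suc n" "j < Suc n"
  shows "(\<lambda>x y. sysmat d n h x y $$ (i, j)) \<in> poly_funs n k"
proof -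
  interpret P: function_ring "poly_funs n k" by (rule function_ring_poly_funs)
  show ?thesis
  proof (cases "i < n")
    case True
    have X: "(\<lambda>x y. x i) \<in> poly_funs n k" and Y: "(\<lambda>x y. y (h i)) \<in> poly_funs n k"
      using True assms by (auto intro: poly_funs.intros)
    note P.power[OF X, of j] P.uminus[OF P.mult[OF Y P.power[OF X, of "j - Suc d"]]]
    thus ?thesis using assms True by (cases "j < Suc d") (simp_all add: sysmat_def)
  qed (use assms in \<open>auto simp: sysmat_def intro: P.const\<close>)
qed

lemma poly_funs_solution:
  assumes "\<And>i. i < n \<Longrightarrow> h i < k" "j < Suc n"
  shows "(\<lambda>x y. solution d n h x y j) \<in> poly_funs n k"
proof -
  interpret P: function_ring "poly_funs n k" by (rule function_ring_poly_funs)
  let ?M = "\<lambda>x y. mat_delete (sysmat d n h x y) n j"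
  have "(\<lambda>x y. det (?M x y)) \<in> poly_funs n k"
  proof (rule P.det[of _ n])
    fix i j' assume "i < n" "j' < n"
    moreover have "dim_row (sysmat d n h x y) = Suc n" "dim_col (sysmat d n h x y) = Suc n" for x y
      by (simp_all add: sysmat_def)
    ultimately have eq: "(\<lambda>x y. ?M x y $$ (i, j')) = (\<lambda>x y. sysmat d n h x y $$ (i, if j' < j then j' else Suc j'))"
      by (simp add: mat_delete_def)
    show "(\<lambda>x y. ?M x y $$ (i, j')) \<in> poly_funs n k"
      unfolding eq using \<open>i < n\<close> \<open>j' < n\<close> by (intro poly_funs_sysmat assms(1)) auto
  next
    show "?M x y \<in> carrier_mat n n" for x y
      by (rule carrier_matI) (simp_all add: mat_delete_def sysmat_def)
  qed
  from P.mult[OF P.const this] show ?thesis unfolding solution_def cofactor_def .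
qed

lemma poly_fun_polys_solution:
  assumes "\<And>i. i < n \<Longrightarrow> h i < k" "n = 2 * d + 1"
  shows "(\<lambda>x y. num_poly d (solution d n h x y)) \<in> poly_fun_polys n k"
    "(\<lambda>x y. den_poly d (solution d n h x y)) \<in> poly_fun_polys n k"
proof -
  have "(\<lambda>x y. coeff (num_poly d (solution d n h x y)) j) \<in> poly_funs n k" for j
    using poly_funs_solution[where n = n and h = h and k = k and d = d and j = j] assms(1) poly_funs.const[of 0] assms(2)
    by (cases "j < Suc d") (simp_all add: num_den_poly_coeff)
  moreover have "(\<lambda>x y. coeff (den_poly d (solution d n h x y)) j) \<in> poly_funs n k" for j
    using poly_funs_solution[where n = n and h = h and k = k and d = d and j = "Suc d + j"] assms(1) poly_funs.const[of 0] assms(2)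
    by (cases "j < Suc d") (simp_all add: num_den_poly_coeff)
  ultimately show "(\<lambda>x y. num_poly d (solution d n h x y)) \<in> poly_fun_polys n k"
    "(\<lambda>x y. den_poly d (solution d n h x y)) \<in> poly_fun_polys n k"
    by (simp_all add: poly_fun_polys_def)
qed

lemma poly_funs_det_sysmat:
  assumes "\<And>i. i < n \<Longrightarrow> h i < k"
  shows "(\<lambda>x y. det (sysmat d n h x y)) \<in> poly_funs n k"
proof -
  interpret P: function_ring "poly_funs n k" by (rule function_ring_poly_funs)
  show ?thesis using assms by (intro P.det[OF sysmat_carrier] poly_funs_sysmat)
qed

section \<open>A simply branched map of every degree\<close>

text \<open>For \<open>d = m + 1\<close> the map is \<open>z (2 z^m - 1) / (2 - z^m)\<close>, which commutes with the \<open>m\<close>-th roots of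
  unity.  Its critical points are given by \<open>z^m = s\<close> or \<open>z^m = 1 / s\<close> for some \<open>0 < s < 1\<close>, with
  critical values inside and outside the unit circle respectively.\<close>

lemma exists_simply_branched:
  assumes "d \<ge> 1"
  shows "\<exists>A B. simply_branched d A B"
proof (cases "d = 1")
  case True
  have "wronskian [:0, 1:] 1 = 1" by (simp add: wronskian_def pderiv_pCons)
  hence "simply_branched d [:0, 1:] 1" using True by (simp add: simply_branched_def)
  thus ?thesis by blast
next
  case False
  define m where "m = d - 1"
  have m: "m \<ge> 1" "d = Suc m" using False assms by (auto simp: m_def)
  \<comment> \<open>In \<open>u = z ^ m\<close> the Wronskian is
    \<open>- 2 * (u ^ 2 - p * u + 1)\<close>; \<open>s\<close> is the smaller root and
    \<open>1 / s\<close> the other.\<close>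
  define p where "p = (3 * real m + 5) / 2"
  define s where "s = (p - sqrt (p ^ 2 - 4)) / 2"
  have p4: "p \<ge> 4" using m by (simp add: p_def)
  have p2: "p ^ 2 \<ge> 16" using power_mono[OF p4, of 2] by simp
  have sq: "sqrt (p ^ 2 - 4) ^ 2 = p ^ 2 - 4" using p2 by simp
  have sq_lt: "sqrt (p ^ 2 - 4) < p" using p2 p4 by (intro real_less_lsqrt) auto
  have "p - 2 < sqrt (p ^ 2 - 4)"
    using p4 by (intro real_less_rsqrt) (simp add: power2_eq_square algebra_simps)
  hence s: "0 < s" "s < 1" using sq_lt by (auto simp: s_def)
  have "s ^ 2 - p * s + 1 = 0"
    using sq by (simp add: s_def power2_eq_square field_simps)
  hence sp: "s + 1 / s = p" using s by (simp add: field_simps power2_eq_square)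
  \<comment> \<open>For \<open>s = 1 / 2\<close> the critical points would be zeros of
    \<open>A\<close> or of \<open>B\<close>.\<close>
  have s_half: "s \<noteq> 1 / 2"
  proof
    assume s12: "s = 1 / 2"
    have "s + 1 / s = 5 / 2" unfolding s12 by simp
    thus False using sp p4 by simp
  qed
  define A where "A = monom 2 d - monom (1 :: complex) 1"
  define B where "B = monom 2 0 - monom (1 :: complex) m"
  define c1 c2 where "c1 = complex_of_real s" and "c2 = complex_of_real (1 / s)"
  let ?W = "wronskian A B"
  let ?p1 = "monom 1 m - [:c1:]" and ?p2 = "monom 1 m - [:c2:]"
  have c12: "c1 * c2 = 1" "c1 + c2 = (3 * of_nat m + 5) / 2"
  proof -
    show "c1 * c2 = 1" using s by (simp add: c1_def c2_def flip: of_real_mult)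
    have "c1 + c2 = of_real p" unfolding c1_def c2_def of_real_add[symmetric] sp ..
    thus "c1 + c2 = (3 * of_nat m + 5) / 2" by (simp add: p_def)
  qed
  obtain m' where m': "m = Suc m'" using m by (cases m) auto
  have pA: "poly A z = z * (2 * z ^ m - 1)" and pB: "poly B z = 2 - z ^ m" for z
    by (simp_all add: A_def B_def poly_monom m algebra_simps)
  have W: "?W = smult (-2) (?p1 * ?p2)"
    \<comment> \<open>Pointwise, the identity becomes one in \<open>u = z ^ m\<close>; multiplying
      \<open>pderiv B\<close> by \<open>z\<close> avoids the exponent \<open>m - 1\<close>.\<close>
    unfolding poly_eq_poly_eq_iff[symmetric]
  proof
    fix z :: complex
    define u where "u = z ^ m"
    have dA: "poly (pderiv A) z = 2 * (of_nat m + 1) * u - 1"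
      by (simp add: A_def pderiv_diff pderiv_monom poly_monom m u_def algebra_simps)
    have dB: "z * poly (pderiv B) z = - (of_nat m * u)"
      by (simp add: B_def pderiv_diff pderiv_monom poly_monom m' u_def algebra_simps)
    have "poly ?W z = poly (pderiv A) z * poly B z - (2 * u - 1) * (z * poly (pderiv B) z)"
      by (simp add: wronskian_def pA u_def algebra_simps)
    also have "\<dots> = - 2 * (u ^ 2 - ((3 * of_nat m + 5) / 2) * u + 1)"
      unfolding dA dB pB u_def[symmetric] by (simp add: field_simps power2_eq_square)
    also have "\<dots> = - 2 * ((u - c1) * (u - c2))"
      unfolding c12(2)[symmetric] c12(1)[symmetric] by (simp add: algebra_simps power2_eq_square)
    also have "\<dots> = poly (smult (-2) (?p1 * ?p2)) z" by (simp add: poly_monom u_def)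
    finally show "poly ?W z = poly (smult (-2) (?p1 * ?p2)) z" .
  qed
  have dp: "degree (monom 1 m - [:c:]) = m" for c :: complex
  proof -
    have "degree (monom 1 m + [:- c:]) = degree (monom (1 :: complex) m)"
      using m by (intro degree_add_eq_left) (simp add: degree_monom_eq)
    moreover have "monom 1 m - [:c:] = monom 1 m + [:- c:]" by simp
    ultimately show ?thesis by (simp only: degree_monom_eq one_neq_zero not_False_eq_True)
  qed
  have p0: "?p1 \<noteq> 0" "?p2 \<noteq> 0" using dp[of c1] dp[of c2] m by auto
  have W0: "?W \<noteq> 0" using p0 by (simp add: W)
  have dW: "degree ?W = 2 * d - 2" using p0 dp by (simp add: W degree_mult_eq m)
  let ?Z1 = "{z :: complex. z ^ m = c1}" and ?Z2 = "{z :: complex. z ^ m = c2}"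
  have Z: "{z. poly ?W z = 0} = ?Z1 \<union> ?Z2" by (auto simp: W poly_monom)
  have c0: "c1 \<noteq> 0" "c2 \<noteq> 0" using s by (auto simp: c1_def c2_def)
  have c_ne: "c1 \<noteq> c2"
  proof
    assume "c1 = c2"
    hence "s = 1 / s" unfolding c1_def c2_def of_real_eq_iff .
    moreover have "1 / s > 1" using s by simp
    ultimately show False using s by linarith
  qed
  have cZ: "card {z. poly ?W z = 0} = 2 * d - 2"
  proof -
    have "finite ?Z1" "finite ?Z2" using m c0 by (auto intro!: card_ge_0_finite simp: card_nth_roots)
    moreover have "?Z1 \<inter> ?Z2 = {}" using c_ne by auto
    ultimately have "card (?Z1 \<union> ?Z2) = card ?Z1 + card ?Z2" by (rule card_Un_disjoint)
    thus ?thesis using card_nth_roots[OF c0(1), of m] card_nth_roots[OF c0(2), of m] m by (simp only: Z) simp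
  qed
  \<comment> \<open>\<open>A / B\<close> is \<open>z * \<kappa> (z ^ m)\<close>. This
    \<open>\<kappa>\<close> maps the interval from -1 to 1 to itself, and
    \<open>\<kappa> (1 / t) = 1 / \<kappa> t\<close>.\<close>
  define \<kappa> where "\<kappa> t = (2 * t - 1) / (2 - t)" for t :: real
  have val: "poly A z / poly B z = z * of_real (\<kappa> t) \<and> poly B z \<noteq> 0"
    if "z ^ m = of_real t" "t \<noteq> 2" for z t
  proof -
    have "poly B z = of_real (2 - t)" "poly A z = z * of_real (2 * t - 1)" using that by (simp_all add: pA pB)
    thus ?thesis using that(2) by (simp only: \<kappa>_def of_real_divide of_real_eq_0_iff) simp
  qed
  have s2: "s \<noteq> 2" "1 / s \<noteq> 2" using s s_half by (auto simp: field_simps)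
  have k1: "\<kappa> s \<noteq> 0" "\<bar>\<kappa> s\<bar> < 1" using s s_half by (auto simp: \<kappa>_def abs_if field_simps)
  have k2: "\<bar>\<kappa> (1 / s)\<bar> > 1"
  proof -
    have "\<kappa> (1 / s) = 1 / \<kappa> s" using s s_half by (simp add: \<kappa>_def field_simps)
    hence "\<bar>\<kappa> (1 / s)\<bar> = 1 / \<bar>\<kappa> s\<bar>" by (simp only: abs_divide abs_one)
    thus ?thesis using k1 by (simp only: less_divide_eq) simp
  qed
  have n1: "cmod z < 1" if "z ^ m = c1" for z
  proof (rule ccontr)
    assume "\<not> ?thesis"
    hence "cmod z ^ m \<ge> 1" by (intro one_le_power) simp
    moreover have "cmod z ^ m = s" unfolding norm_power[symmetric] that c1_def using s by simp
    ultimately show False using s by simp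
  qed
  have n2: "cmod z > 1" if "z ^ m = c2" for z
  proof (rule ccontr)
    assume "\<not> ?thesis"
    hence "cmod z ^ m \<le> 1" by (intro power_le_one) auto
    moreover have "cmod z ^ m = 1 / s" unfolding norm_power[symmetric] that c2_def norm_of_real using s by simp
    moreover have "1 / s > 1" using s by simp
    ultimately show False by linarith
  qed
  have v1: "poly A z / poly B z = z * of_real (\<kappa> s) \<and> poly B z \<noteq> 0" if "z \<in> ?Z1" for z
    using val[of z s] that s2 by (simp add: c1_def)
  have v2: "poly A z / poly B z = z * of_real (\<kappa> (1 / s)) \<and> poly B z \<noteq> 0" if "z \<in> ?Z2" for z
    using val[of z "1 / s"] that s2 by (simp only: c2_def mem_Collect_eq) simp
  have l1: "cmod (poly A z / poly B z) < 1" if "z \<in> ?Z1" for z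
  proof -
    have "cmod z * \<bar>\<kappa> s\<bar> < 1 * 1" using n1[of z] that k1 by (intro mult_strict_mono) auto
    thus ?thesis using v1[OF that] by (simp add: norm_mult)
  qed
  have l2: "cmod (poly A z / poly B z) > 1" if "z \<in> ?Z2" for z
  proof -
    have "1 * 1 < cmod z * \<bar>\<kappa> (1 / s)\<bar>" using n2[of z] that k2 by (intro mult_strict_mono) auto
    thus ?thesis using v2[OF that] by (simp only: norm_mult norm_of_real mult_1)
  qed
  have k20: "\<kappa> (1 / s) \<noteq> 0" using k2 by auto
  \<comment> \<open>Within each of the two groups the value is a fixed nonzero multiple of
    \<open>z\<close>; between them the absolute values differ.\<close>
  have inj: "inj_on (\<lambda>z. poly A z / poly B z) {z. poly ?W z = 0}"
  proof (rule inj_onI)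
    fix z w assume zw: "z \<in> {z. poly ?W z = 0}" "w \<in> {z. poly ?W z = 0}"
      and eq: "poly A z / poly B z = poly A w / poly B w"
    have "z \<in> ?Z1 \<union> ?Z2" "w \<in> ?Z1 \<union> ?Z2" using zw unfolding Z .
    then consider "z \<in> ?Z1" "w \<in> ?Z1" | "z \<in> ?Z1" "w \<in> ?Z2" | "z \<in> ?Z2" "w \<in> ?Z1"
      | "z \<in> ?Z2" "w \<in> ?Z2" by blast
    thus "z = w"
    proof cases
      case 1
      hence "z * of_real (\<kappa> s) = w * of_real (\<kappa> s)" using v1[OF 1(1)] v1[OF 1(2)] eq by metis
      thus ?thesis using k1(1) by simp
    next
      case 2
      thus ?thesis using l1[OF 2(1)] l2[OF 2(2)] unfolding eq by linarith
    next
      case 3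
      thus ?thesis using l2[OF 3(1)] l1[OF 3(2)] unfolding eq by linarith
    next
      case 4
      hence "z * of_real (\<kappa> (1 / s)) = w * of_real (\<kappa> (1 / s))" using v2[OF 4(1)] v2[OF 4(2)] eq by metis
      thus ?thesis using k20 by (simp only: mult_cancel_right of_real_eq_0_iff) simp
    qed
  qed
  have B0: "poly B z \<noteq> 0" if "poly ?W z = 0" for z
  proof -
    have "z \<in> ?Z1 \<union> ?Z2" using that unfolding Z[symmetric] by simp
    thus ?thesis using v1 v2 by blast
  qed
  have "degree A \<le> d" unfolding A_def using m
    by (intro degree_diff_le order_trans[OF degree_monom_le]) auto
  moreover have "degree B \<le> d" unfolding B_def using m
    by (intro degree_diff_le order_trans[OF degree_monom_le]) auto
  moreover have "coeff A d \<noteq> 0" using m by (simp add: A_def)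
  ultimately have "simply_branched d A B"
    unfolding simply_branched_def using assms W0 dW cZ B0 inj by blast
  thus ?thesis by blast
qed

text \<open>Marked points are chosen in the fibres over \<open>k\<close> values that are not branch values.\<close>

lemma exists_marked_points:
  fixes n k :: nat and h :: "nat \<Rightarrow> nat"
  assumes sb: "simply_branched d A B"
    and card: "\<And>j. card {i. i < n \<and> h i = j} \<le> d"
  obtains x y where "inj_on x {..<n}" "inj_on y {..<k}"
    "\<forall>i<n. poly A (x i) = y (h i) * poly B (x i)" "\<forall>j<k. y j \<notin> branch_values A B"
proof -
  note S = sbD[OF sb]
  \<comment> \<open>Also excluding the value at infinity puts all \<open>d\<close> points of a fibre
    into the affine line. If \<open>coeff B d = 0\<close>, that value is \<open>Infty\<close> and
    the quotient is 0 by convention, so merely one more value is avoided.\<close>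
  let ?X = "branch_values A B \<union> {coeff A d / coeff B d}"
  have "finite ?X" using card_branch_values(1)[OF sb] by simp
  hence "infinite (UNIV - ?X)" by (intro Diff_infinite_finite infinite_UNIV_char_0)
  then obtain y :: "nat \<Rightarrow> complex" where y: "inj y" "range y \<subseteq> UNIV - ?X"
    using infinite_countable_subset by blast
  have y1: "y j \<notin> branch_values A B" "y j \<noteq> coeff A d / coeff B d" for j
    using y(2) by (auto simp: subset_iff)
  let ?F = "\<lambda>j. A - smult (y j) B"
  let ?R = "\<lambda>j. {z. poly (?F j) z = 0}"
  have lc: "coeff (?F j) d \<noteq> 0" for j
    using y1(2)[of j] S(4) by (cases "coeff B d = 0") (auto simp: field_simps)
  have F0: "?F j \<noteq> 0" for j
  proof
    assume "?F j = 0"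
    thus False using lc[of j] by simp
  qed
  have dF: "degree (?F j) = d" for j
    using le_degree[OF lc[of j]] S(2,3)
    by (intro antisym degree_diff_le order_trans[OF degree_smult_le]) auto
  have finR: "finite (?R j)" for j by (rule poly_roots_finite[OF F0])
  have cR: "card (?R j) = d" for j
  proof -
    have "order z (?F j) = 1" if z: "poly (?F j) z = 0" for z
    proof -
      \<comment> \<open>A double point of the fibre would be critical, making \<open>y j\<close> a
        branch value.\<close>
      have "poly (pderiv (?F j)) z \<noteq> 0"
      proof
        assume 0: "poly (pderiv (?F j)) z = 0"
        have "poly (wronskian (?F j) B) z = 0"
          using 0 z by (simp only: wronskian_def poly_diff[of "_ * _"] poly_mult) simp
        hence W: "poly (wronskian A B) z = 0" unfolding wronskian_simps .
        have "y j = poly A z / poly B z" using S(8)[OF W] z by (simp add: field_simps)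
        thus False using y1(1)[of j] W by (auto simp: branch_values_def)
      qed
      hence "\<not> [:-z, 1:] ^ 2 dvd ?F j" by (simp only: double_root_iff) simp
      hence "\<not> 2 \<le> order z (?F j)" using F0[of j] by (simp only: order_divides) simp
      moreover have "order z (?F j) \<noteq> 0" using z F0 order_root by blast
      ultimately show ?thesis by linarith
    qed
    from card_roots_simple[OF F0 this] show ?thesis using dF by simp
  qed
  have "\<forall>j. \<exists>f. f ` {i. i < n \<and> h i = j} \<subseteq> ?R j \<and> inj_on f {i. i < n \<and> h i = j}"
  proof
    fix j
    \<comment> \<open>The marks of one index number at most \<open>d\<close>, so they fit into the
      fibre.\<close>
    have "finite {i. i < n \<and> h i = j}" "card {i. i < n \<and> h i = j} \<le> card (?R j)"
      using card[of j] cR[of j] by simp_all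
    from card_le_inj[OF this(1) finR this(2)]
    show "\<exists>f. f ` {i. i < n \<and> h i = j} \<subseteq> ?R j \<and> inj_on f {i. i < n \<and> h i = j}" .
  qed
  from choice[OF this] obtain f
    where "\<forall>j. f j ` {i. i < n \<and> h i = j} \<subseteq> ?R j \<and> inj_on (f j) {i. i < n \<and> h i = j}" ..
  hence f: "f j ` {i. i < n \<and> h i = j} \<subseteq> ?R j" "inj_on (f j) {i. i < n \<and> h i = j}" for j
    by blast+
  define x where "x i = f (h i) i" for i
  have xR: "x i \<in> ?R (h i)" if "i < n" for i
  proof -
    have "f (h i) i \<in> f (h i) ` {i'. i' < n \<and> h i' = h i}" using that by blast
    thus ?thesis using f(1)[of "h i"] unfolding x_def by blast
  qed
  hence xe: "poly A (x i) = y (h i) * poly B (x i)" if "i < n" for i using that by simp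
  have "inj_on x {..<n}"
  proof (rule inj_onI)
    fix i j assume ij: "i \<in> {..<n}" "j \<in> {..<n}" "x i = x j"
    have "h i = h j"
    \<comment> \<open>Fibres over different values are disjoint, since a point of both would be a
      common zero of \<open>A\<close> and \<open>B\<close>.\<close>
    proof (rule ccontr)
      assume "h i \<noteq> h j"
      hence "y (h i) \<noteq> y (h j)" using y(1) by (auto dest: injD)
      moreover have "y (h i) * poly B (x i) = y (h j) * poly B (x i)"
        using xe[of i] xe[of j] ij by (metis lessThan_iff)
      ultimately have "poly B (x i) = 0" by simp
      thus False using sb_common_root[OF sb, of "x i"] xe[of i] ij by simp
    qed
    moreover from this have "f (h i) i = f (h i) j" using ij(3) by (simp add: x_def)
    ultimately show "i = j" using ij by (intro inj_onD[OF f(2)[of "h i"]]) auto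
  qed
  thus ?thesis using that[of x y] y(1) y1(1) xe by (auto intro: inj_on_subset)
qed

section \<open>General position\<close>

lemma poly_funs_line:
  assumes "P \<in> poly_funs n k"
  shows "\<exists>p :: complex poly. \<forall>t. poly p t = P (\<lambda>i. x0 i + t * (x1 i - x0 i)) (\<lambda>i. y0 i + t * (y1 i - y0 i))"
  using assms
proof induction
  case (const c)
  show ?case by (rule exI[of _ "[:c:]"]) simp
next
  case (var_x i)
  show ?case by (rule exI[of _ "[:x0 i, x1 i - x0 i:]"]) simp
next
  case (var_y j)
  show ?case by (rule exI[of _ "[:y0 j, y1 j - y0 j:]"]) simp
next
  case (add P Q)
  then obtain p q :: "complex poly" where
    "\<forall>t. poly p t = P (\<lambda>i. x0 i + t * (x1 i - x0 i)) (\<lambda>i. y0 i + t * (y1 i - y0 i))"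
    "\<forall>t. poly q t = Q (\<lambda>i. x0 i + t * (x1 i - x0 i)) (\<lambda>i. y0 i + t * (y1 i - y0 i))" by blast
  thus ?case by (intro exI[of _ "p + q"]) simp
next
  case (mult P Q)
  then obtain p q :: "complex poly" where
    "\<forall>t. poly p t = P (\<lambda>i. x0 i + t * (x1 i - x0 i)) (\<lambda>i. y0 i + t * (y1 i - y0 i))"
    "\<forall>t. poly q t = Q (\<lambda>i. x0 i + t * (x1 i - x0 i)) (\<lambda>i. y0 i + t * (y1 i - y0 i))" by blast
  thus ?case by (intro exI[of _ "p * q"]) simp
qed

text \<open>On the line through the two witnesses both functions become nonzero polynomials in one
  variable, whose product has finitely many zeros.\<close>

lemma poly_funs_nonzero_mult:
  assumes P: "P \<in> poly_funs n k" "P x0 y0 \<noteq> 0" and Q: "Q \<in> poly_funs n k" "Q x1 y1 \<noteq> 0"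
  shows "\<exists>x y. P x y * Q x y \<noteq> 0"
proof -
  let ?x = "\<lambda>t i. x0 i + t * (x1 i - x0 i)" and ?y = "\<lambda>t i. y0 i + t * (y1 i - y0 i)"
  obtain p :: "complex poly" where p: "\<forall>t. poly p t = P (?x t) (?y t)"
    using poly_funs_line[OF P(1)] by blast
  obtain q :: "complex poly" where q: "\<forall>t. poly q t = Q (?x t) (?y t)"
    using poly_funs_line[OF Q(1)] by blast
  have "poly p 0 \<noteq> 0" "poly q 1 \<noteq> 0" using P(2) Q(2) p q by simp_all
  hence "p * q \<noteq> 0" by auto
  hence "finite {t. poly (p * q) t = 0}" by (rule poly_roots_finite)
  then obtain t where "t \<notin> {t. poly (p * q) t = 0}"
    using ex_new_if_finite[OF infinite_UNIV_char_0] by blast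
  hence "P (?x t) (?y t) * Q (?x t) (?y t) \<noteq> 0" using p q by simp
  thus ?thesis by blast
qed

text \<open>Two nonempty open sets meet, which makes the number in \<open>tau_degree\<close>
  unique.\<close>

lemma generally_common:
  assumes "generally n k \<Phi>" "generally n k \<Psi>"
  shows "\<exists>x y. \<Phi> x y \<and> \<Psi> x y"
proof -
  interpret P: function_ring "poly_funs n k" by (rule function_ring_poly_funs)
  obtain P xP yP where P: "P \<in> poly_funs n k" "P xP yP \<noteq> 0"
    "\<And>x y. inj_on x {..<n} \<and> inj_on y {..<k} \<and> P x y \<noteq> 0 \<Longrightarrow> \<Phi> x y"
    using assms(1) unfolding generally_def by blast
  obtain Q xQ yQ where Q: "Q \<in> poly_funs n k" "Q xQ yQ \<noteq> 0"
    "\<And>x y. inj_on x {..<n} \<and> inj_on y {..<k} \<and> Q x y \<noteq> 0 \<Longrightarrow> \<Psi> x y"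
    using assms(2) unfolding generally_def by blast
  \<comment> \<open>Vandermonde factors, included so that the common point has distinct coordinates,
    as \<open>generally\<close> requires.\<close>
  define D where "D x y = (\<Prod>i<n. \<Prod>j<i. x i - x j) * (\<Prod>i<k. \<Prod>j<i. y i - y j)"
    for x y :: "nat \<Rightarrow> complex"
  have "(\<lambda>x y. \<Prod>i<n. \<Prod>j<i. x i - x j) \<in> poly_funs n k"
    by (intro P.prod P.diff poly_funs.var_x) auto
  moreover have "(\<lambda>x y. \<Prod>i<k. \<Prod>j<i. y i - y j) \<in> poly_funs n k"
    by (intro P.prod P.diff poly_funs.var_y) auto
  ultimately have D: "D \<in> poly_funs n k" unfolding D_def by (rule P.mult)
  have D0: "D of_nat of_nat \<noteq> 0" by (auto simp: D_def)
  have inj: "inj_on z {..<m}" if "(\<Prod>i<m. \<Prod>j<i. z i - z j) \<noteq> 0" for m and z :: "nat \<Rightarrow> complex"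
  proof (rule linorder_inj_onI)
    fix i j assume ij: "i < j" "i \<in> {..<m}" "j \<in> {..<m}"
    have "\<forall>a\<in>{..<m}. \<forall>b\<in>{..<a}. z a \<noteq> z b" using that by simp
    hence "z j \<noteq> z i" using ij by blast
    thus "z i \<noteq> z j" by (rule not_sym)
  qed auto
  obtain x y where "P x y * Q x y \<noteq> 0"
    using poly_funs_nonzero_mult[OF P(1,2) Q(1,2)] by blast
  from poly_funs_nonzero_mult[OF P.mult[OF P(1) Q(1)] this D D0]
  obtain x y where xy: "P x y * Q x y * D x y \<noteq> 0" by blast
  hence "inj_on x {..<n}" "inj_on y {..<k}" by (auto simp: D_def intro!: inj)
  thus ?thesis using P(3)[of x y] Q(3)[of x y] xy by auto
qed

lemma generallyI:
  assumes "P \<in> poly_funs n k" "P x y \<noteq> 0"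
    "\<And>x y. inj_on x {..<n} \<Longrightarrow> inj_on y {..<k} \<Longrightarrow> P x y \<noteq> 0 \<Longrightarrow> \<Phi> x y"
  shows "generally n k \<Phi>"
  using assms unfolding generally_def by blast

text \<open>Where one suitable polynomial does not vanish, the cofactor solution satisfies all
  assumptions of \<open>branch_data\<close>.\<close>

lemma generally_fibre_count:
  fixes d n k :: nat and \<mu>s :: "nat list list"
  defines "N \<equiv> 2 * d - 2"
  assumes d: "d \<ge> 1" and n: "n = 2 * d + 1"
    and length_prof: "length (flat_profile \<mu>s) = n" and k: "k = length \<mu>s" "k \<ge> 3"
    and prof: "\<And>i. i < n \<Longrightarrow> fst (flat_profile \<mu>s ! i) < k"
      "\<And>i. i < n \<Longrightarrow> snd (flat_profile \<mu>s ! i) = 1"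
    and card_class: "\<And>h. card {i. i < n \<and> fst (flat_profile \<mu>s ! i) = h} \<le> d"
  shows "generally n k (\<lambda>x y. finite (fibre_classes d N \<mu>s x y) \<and> fibre_count d N \<mu>s x y = fact N)"
proof -
  interpret P: function_ring "poly_funs n k" by (rule function_ring_poly_funs)
  define h where "h i = fst (flat_profile \<mu>s ! i)" for i
  define A where "A x y = num_poly d (solution d n h x y)" for x y
  define B where "B x y = den_poly d (solution d n h x y)" for x y
  define D where "D x y = branch_poly d (A x y) (B x y)" for x y
  have hk: "h i < k" if "i < n" for i using prof(1)[OF that] by (simp add: h_def)
  have deg: "degree (A x y) \<le> d" "degree (B x y) \<le> d" for x y
    by (simp_all add: A_def B_def degree_num_den_poly)
  have AB: "A \<in> poly_fun_polys n k" "B \<in> poly_fun_polys n k"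
    unfolding A_def B_def using poly_fun_polys_solution[of n h k d] hk n by simp_all
  have D: "D \<in> poly_fun_polys n k" unfolding D_def by (rule poly_fun_polys_branch_poly[OF AB])
  have degD: "degree (D x y) \<le> N" for x y by (simp add: D_def N_def degree_branch_poly)
  \<comment> \<open>In order, the factors ensure that \<open>A\<close> has degree \<open>d\<close>,
    that infinity is not critical, that critical values are finite, that they are distinct, and that
    they avoid the \<open>y j\<close>.\<close>
  define F where "F x y = det (sysmat d n h x y) * coeff (wronskian (A x y) (B x y)) N * coeff (D x y) N *
      discriminant N (D x y) * (\<Prod>j<k. poly (D x y) (y j))" for x y
  have "(\<lambda>x y. \<Prod>j<k. poly (D x y) (y j)) \<in> poly_funs n k"
  proof (rule P.prod)
    fix j assume "j \<in> {..<k}"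
    hence "(\<lambda>x y. y j) \<in> poly_funs n k" by (intro poly_funs.var_y) simp
    from poly_funs_poly[OF D degD this]
    show "(\<lambda>x y. poly (D x y) (y j)) \<in> poly_funs n k" .
  qed
  moreover have "(\<lambda>x y. discriminant N (D x y)) \<in> poly_funs n k" by (rule poly_funs_discriminant[OF D])
  moreover have "(\<lambda>x y. coeff (D x y) N) \<in> poly_funs n k" by (rule poly_fun_polys_coeff[OF D])
  moreover have "(\<lambda>x y. coeff (wronskian (A x y) (B x y)) N) \<in> poly_funs n k"
    by (rule poly_fun_polys_coeff[OF poly_fun_polys_wronskian[OF AB]])
  moreover have "(\<lambda>x y. det (sysmat d n h x y)) \<in> poly_funs n k" by (rule poly_funs_det_sysmat[OF hk])
  ultimately have F: "F \<in> poly_funs n k" unfolding F_def by (intro P.mult)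
  obtain A0 B0 where sb: "simply_branched d A0 B0" using exists_simply_branched[OF d] by blast
  have "card {i. i < n \<and> h i = j} \<le> d" for j using card_class by (simp add: h_def)
  from exists_marked_points[OF sb this]
  obtain x0 y0 where xy0: "inj_on x0 {..<n}" "inj_on y0 {..<k}"
    "\<forall>i<n. poly A0 (x0 i) = y0 (h i) * poly B0 (x0 i)" "\<forall>j<k. y0 j \<notin> branch_values A0 B0" .
  have F0: "F x0 y0 \<noteq> 0"
  proof -
    have det: "det (sysmat d n h x0 y0) \<noteq> 0" by (rule det_sysmat_nonzero[where h = h and y = y0, OF n sb xy0(1,3)])
    have e: "\<forall>i<n. poly (A x0 y0) (x0 i) = y0 (h i) * poly (B x0 y0) (x0 i)"
      unfolding A_def B_def using solution_props(1)[OF n] by simp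
    \<comment> \<open>At the example the cofactor solution is a multiple of the known map, and the
      nonzero determinant makes the factor nonzero.\<close>
    obtain c where c: "A x0 y0 = smult c A0" "B x0 y0 = smult c B0"
      using interpolation_unique[of n d A0 B0 x0 "\<lambda>i. y0 (h i)", OF n sb xy0(1,3) e deg] by blast
    have "coeff (A x0 y0) d = det (sysmat d n h x0 y0)" unfolding A_def by (rule solution_props(2)[OF n])
    hence c0: "c \<noteq> 0" using det c by auto
    have sb': "simply_branched d (A x0 y0) (B x0 y0)"
      and bv: "branch_values (A x0 y0) (B x0 y0) = branch_values A0 B0"
      unfolding c by (rule simply_branched_smult[OF sb c0])+
    note S = simply_branched_branch_poly[OF sb', folded D_def N_def]
    have "poly (D x0 y0) (y0 j) \<noteq> 0" if "j < k" for j
      using S(4)[of "y0 j"] xy0(4) that bv by auto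
    thus ?thesis using det S(1-3) by (simp add: F_def)
  qed
  show ?thesis
  proof (rule generallyI[OF F F0])
    fix x y assume inj: "inj_on x {..<n}" "inj_on y {..<k}" and "F x y \<noteq> 0"
    hence nz: "det (sysmat d n h x y) \<noteq> 0" "coeff (wronskian (A x y) (B x y)) N \<noteq> 0"
      "coeff (D x y) N \<noteq> 0" "discriminant N (D x y) \<noteq> 0" "\<And>j. j < k \<Longrightarrow> poly (D x y) (y j) \<noteq> 0"
      by (auto simp: F_def)
    have lcA: "coeff (A x y) d = det (sysmat d n h x y)" unfolding A_def by (rule solution_props(2)[OF n])
    hence "coeff (A x y) d \<noteq> 0" using nz(1) by simp
    note S = branch_poly_simply_branched[OF d deg(1) deg(2)[of x y] this nz(2)[unfolded N_def]
        nz(3)[unfolded D_def N_def] nz(4)[unfolded D_def N_def], folded D_def]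
    let ?V = "Pt ` branch_values (A x y) (B x y)"
    have cV: "card ?V = N"
      using card_branch_values(2)[OF S(1)] by (simp add: card_image inj_on_def N_def)
    have marks: "reval (A x y, B x y) (Pt (x i)) = Pt (y (h i))" if "i < n" for i
    proof -
      have e: "poly (A x y) (x i) = y (h i) * poly (B x y) (x i)"
        unfolding A_def B_def by (rule solution_props(1)[OF n that])
      hence "poly (B x y) (x i) \<noteq> 0" using sb_common_root[OF S(1), of "x i"] by auto
      thus ?thesis using e by (simp add: reval_def)
    qed
    interpret branch_data d n k \<mu>s x y "(A x y, B x y)" ?V
    proof
      show "d \<ge> 1" "n = 2 * d + 1" "length (flat_profile \<mu>s) = n" "k = length \<mu>s" "k \<ge> 3"
        "inj_on x {..<n}" "inj_on y {..<k}" by fact+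
      show "fst (flat_profile \<mu>s ! i) < k" "snd (flat_profile \<mu>s ! i) = 1" if "i < n" for i
        using prof that by blast+
      show "card {i. i < n \<and> fst (flat_profile \<mu>s ! i) = j} \<le> d" for j by (rule card_class)
      show "is_ratmap (A x y, B x y)" "rdeg (A x y, B x y) = d" by (rule sb_ratmap[OF S(1)])+
      show "reval (A x y, B x y) (Pt (x i)) = Pt (y (fst (flat_profile \<mu>s ! i)))" if "i < n" for i
        using marks[OF that] by (simp add: h_def)
      show "finite ?V" using card_branch_values(1)[OF S(1)] by simp
      show "Pt (y j) \<notin> ?V" if "j < k" for j using nz(5)[OF that] S(2) by auto
      show "card {z. reval (A x y, B x y) z = q} < d" if "q \<in> ?V" for q by (rule sb_card_fibre[OF S(1) that])
      show "ram_index (A x y, B x y) z = 1" if "reval (A x y, B x y) z \<notin> ?V" for z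
        by (rule sb_unramified[OF S(1) that])
      show "ram_index (A x y, B x y) z = 1 \<or> ram_index (A x y, B x y) z = 2" for z
        by (rule sb_simply_ramified(1)[OF S(1)])
      show "\<exists>!z. reval (A x y, B x y) z = q \<and> ram_index (A x y, B x y) z = 2" if "q \<in> ?V" for q
        by (rule sb_simply_ramified(2)[OF S(1) that])
    qed
    show "finite (fibre_classes d N \<mu>s x y) \<and> fibre_count d N \<mu>s x y = fact N"
      using fibre_count_fact unfolding cV by blast
  qed
qed

section \<open>Unramified profiles and the value of the degree\<close>

lemma flat_profile_replicate:
  fixes r :: "nat list"
  defines "xs \<equiv> flat_profile (map (\<lambda>m. replicate m 1) r)"
  shows "length xs = sum_list r"
    "i < length xs \<Longrightarrow> fst (xs ! i) < length r" "i < length xs \<Longrightarrow> snd (xs ! i) = 1"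
    "card {i. i < length xs \<and> fst (xs ! i) = h} = (if h < length r then r ! h else 0)"
proof -
  have xs: "xs = concat (map (\<lambda>h. replicate (r ! h) (h, 1)) [0..<length r])"
    unfolding xs_def flat_profile_def by (intro arg_cong[of _ _ concat]) (auto intro!: map_cong)
  have "length xs = (\<Sum>h\<leftarrow>[0..<length r]. r ! h)" by (simp add: xs length_concat o_def)
  also have "map (\<lambda>h. r ! h) [0..<length r] = r" by (rule map_nth)
  finally show "length xs = sum_list r" .
  have "fst p < length r \<and> snd p = 1" if "p \<in> set xs" for p using that by (auto simp: xs)
  thus "i < length xs \<Longrightarrow> fst (xs ! i) < length r" "i < length xs \<Longrightarrow> snd (xs ! i) = 1"
    by auto
  have "card {i. i < length xs \<and> fst (xs ! i) = h} = length (filter (\<lambda>p. fst p = h) xs)"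
    by (simp add: length_filter_conv_card)
  also have "\<dots> = (\<Sum>j\<leftarrow>[0..<length r]. if j = h then r ! j else 0)"
    unfolding xs filter_concat length_concat map_map o_def
    by (intro arg_cong[of _ _ sum_list] map_cong) auto
  also have "\<dots> = (\<Sum>j = 0..<length r. if j = h then r ! j else 0)"
    by (rule interv_sum_list_conv_sum_set_nat[unfolded atLeastLessThan_upt[symmetric]])
  also have "\<dots> = (if h < length r then r ! h else 0)" by simp
  finally show "card {i. i < length xs \<and> fst (xs ! i) = h} = (if h < length r then r ! h else 0)" .
qed

theorem proposition8:
  fixes l :: int and r :: "nat list"
  assumes "l \<ge> 0"
    and "\<forall>m\<in>set r. m \<ge> 1"
    and "3 + 2 * l = int (sum_list r)"
    and "\<forall>m\<in>set r. int m \<le> l + 1"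
    and "length r \<ge> 3"
  shows "Tev0_simple l r = 1"
proof -
  define \<mu>s :: "nat list list" where "\<mu>s = map (\<lambda>m. replicate m 1) r"
  define d where "d = nat (l + 1)"
  let ?N = "2 * d - 2" and ?n = "length (flat_profile \<mu>s)" and ?k = "length \<mu>s"
  note fp = flat_profile_replicate[where r = r, folded \<mu>s_def]
  have l: "l = int d - 1" "d \<ge> 1" using assms(1) by (auto simp: d_def)
  have n: "?n = 2 * d + 1" using fp(1) assms(3) l by simp
  have k: "?k = length r" by (simp add: \<mu>s_def)
  have cl: "card {i. i < ?n \<and> fst (flat_profile \<mu>s ! i) = h} \<le> d" for h
    using assms(4) l by (auto simp: fp(4))
  let ?\<Phi> = "\<lambda>N x y. finite (fibre_classes d ?N \<mu>s x y) \<and> fibre_count d ?N \<mu>s x y = N"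
  have gen: "generally ?n ?k (?\<Phi> (fact ?N))"
    by (rule generally_fibre_count[OF l(2) n refl refl _ _ _ cl]) (use fp(2,3) k assms(5) in auto)
  have "tau_degree d ?N \<mu>s = fact ?N"
    unfolding tau_degree_def
  proof (rule the_equality)
    show "generally ?n ?k (?\<Phi> (fact ?N))" by (rule gen)
  next
    \<comment> \<open>At a point common to both open sets the two counts are the same
      number.\<close>
    fix N assume "generally ?n ?k (?\<Phi> N)"
    from generally_common[OF gen this] show "N = fact ?N" by auto
  qed
  moreover have "Tev0_simple l r = tau_degree d ?N \<mu>s / fact ?N"
  proof -
    have lens: "(\<Sum>\<mu>\<leftarrow>\<mu>s. length \<mu>) = sum_list r" "(\<Sum>\<mu>\<leftarrow>\<mu>s. sum_list \<mu>) = sum_list r"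
      by (simp_all add: \<mu>s_def o_def sum_list_replicate)
    have "\<forall>\<mu>\<in>set \<mu>s. int (sum_list \<mu>) \<le> 1 + l"
      using assms(4) by (auto simp: \<mu>s_def sum_list_replicate)
    \<comment> \<open>All prescribed indices are 1, so \<open>n\<close> cancels the total in
      \<open>b\<close> and leaves \<open>2 * d - 2\<close>.\<close>
    moreover have "nat (2 * (1 + l) - 2) = ?N" "nat (1 + l) = d" using l by auto
    ultimately show ?thesis
      unfolding Tev0_simple_def Tev0_def Let_def \<mu>s_def[symmetric] lens
      using assms(3,5) k by (simp add: add.commute)
  qed
  ultimately show ?thesis by simp
qed

end
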